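(* Let $Y_1,\dots,Y_p$ be independent unit rate Poisson processes on a complete probability space $(\Omega,\mathcal{F},\mathbb{P})$, let $X(0)$ be an $\mathbb{R}^d$-valued random variable on this space, let $\nu_1,\dots,\nu_p\in\mathbb{R}^d$, and let $f:\mathbb{R}^d\to\mathbb{R}^d$ and $\lambda_k:\mathbb{R}^d\to\mathbb{R}_+$, $k=1,\dots,p$, be in $C^1_b$. Then the random time change equation $$X(t)=X(0)+\int_0^t f(X(s))\,\mathrm{d}s+\sum_{k=1}^p Y_k\Bigl(\int_0^t\lambda_k(X(s))\,\mathrm{d}s\Bigr)\nu_k,\qquad t\ge 0,$$ possesses for almost all $\omega\in\Omega$ a unique càdlàg solution $(X(t))_{t\ge 0}$. Furthermore, this solution solves the martingale problem posed by the generator $$\mathcal{A}F(x)=\nabla F(x)[f(x)]+\sum_{k=1}^p\lambda_k(x)\bigl(F(x+\nu_k)-F(x)\bigr)$$ and any $F\in C^1_b(\mathbb{R}^d)$; that is, for every $F\in C^1_b(\mathbb{R}^d)$ the process $$F(X(t))-F(X(0))-\int_0^t\mathcal{A}F(X(s))\,\mathrm{d}s,\qquad t\ge 0,$$ is a martingale with respect to the natural filtration of $X$.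
   Context: $C^1_b(\mathbb{R}^d)$ is the set of bounded continuously differentiable functions from $\mathbb{R}^d$ to $\mathbb{R}$ with bounded first derivatives; a vector-valued function is in $C^1_b$ if each of its components is. The notation $\nabla F(x)[v]=\sum_{j=1}^d\frac{\partial F}{\partial x_j}(x)\,v_j$ denotes the derivative of $F$ at $x$ applied to $v\in\mathbb{R}^d$. The operator $\mathcal{A}$ is the generator of the piecewise deterministic Markov process whose motion between jumps follows $\dot x=f(x)$ and which jumps from $x$ to $x+\nu_k$ with instantaneous rate $\lambda_k(x)$.
   Formalization: For the martingale claim, X(0) is additionally assumed independent of the Poisson processes (Y_1,...,Y_p); without this it fails, e.g. f=0, λ=ν=1, X(0)=Y_1(1). Existence and uniqueness are stated without this assumption. *)

theory Defs
  imports "HOL-Probability.Probability"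
begin

text \<open>Paths and processes have type \<open>real \<Rightarrow> _\<close>, but only times \<open>t \<ge> 0\<close> matter; the values at
  negative times are never used.\<close>

definition partial_derivative :: "(real ^ 'd \<Rightarrow> real) \<Rightarrow> 'd \<Rightarrow> real ^ 'd \<Rightarrow> real" where
  "partial_derivative F j x = deriv (\<lambda>h. F (x + h *\<^sub>R axis j 1)) 0"

definition grad_apply :: "(real ^ 'd \<Rightarrow> real) \<Rightarrow> real ^ 'd \<Rightarrow> real ^ 'd \<Rightarrow> real" where
  "grad_apply F x v = (\<Sum>j\<in>UNIV. partial_derivative F j x * v $ j)"

definition C1b :: "(real ^ 'd \<Rightarrow> real) \<Rightarrow> bool" where
  "C1b F \<longleftrightarrow> bounded (range F) \<and> F differentiable_on UNIV \<and>
     (\<forall>j. continuous_on UNIV (partial_derivative F j) \<and> bounded (range (partial_derivative F j)))"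

definition C1b_vec :: "(real ^ 'd \<Rightarrow> real ^ 'd) \<Rightarrow> bool" where
  "C1b_vec f \<longleftrightarrow> (\<forall>i. C1b (\<lambda>x. f x $ i))"

definition cadlag :: "(real \<Rightarrow> 'a :: topological_space) \<Rightarrow> bool" where
  "cadlag x \<longleftrightarrow> (\<forall>t\<ge>0. (x \<longlongrightarrow> x t) (at_right t)) \<and> (\<forall>t>0. \<exists>l. (x \<longlongrightarrow> l) (at_left t))"

text \<open>The path conditions are only required almost surely. Subtraction on \<open>nat\<close> is truncated,
  but this is harmless for the increments: they are nonnegative for every nondecreasing path,
  that is, almost surely.\<close>

definition unit_poisson_process :: "'w measure \<Rightarrow> (real \<Rightarrow> 'w \<Rightarrow> nat) \<Rightarrow> bool" where
  "unit_poisson_process M Y \<longleftrightarrow>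
     (\<forall>t\<ge>0. Y t \<in> measurable M (count_space UNIV)) \<and>
     (AE \<omega> in M. Y 0 \<omega> = 0 \<and> mono_on {0..} (\<lambda>t. Y t \<omega>) \<and> cadlag (\<lambda>t. Y t \<omega>)) \<and>
     (\<forall>s t. 0 \<le> s \<and> s < t \<longrightarrow>
        distr M (count_space UNIV) (\<lambda>\<omega>. Y t \<omega> - Y s \<omega>) = measure_pmf (poisson_pmf (t - s))) \<and>
     (\<forall>(n::nat) r. 0 \<le> r 0 \<and> strict_mono_on {..n} r \<longrightarrow>
        prob_space.indep_vars M (\<lambda>_. count_space UNIV)
          (\<lambda>i \<omega>. Y (r (Suc i)) \<omega> - Y (r i) \<omega>) {..<n})"

definition path_space :: "(real \<Rightarrow> nat) measure" where
  "path_space = Pi\<^sub>M {0..} (\<lambda>_. count_space UNIV)"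

definition path_of :: "(real \<Rightarrow> 'w \<Rightarrow> nat) \<Rightarrow> 'w \<Rightarrow> real \<Rightarrow> nat" where
  "path_of Y \<omega> = (\<lambda>t\<in>{0..}. Y t \<omega>)"

text \<open>\<open>x\<close> solves the random time change equation driven by the fixed paths \<open>y k\<close>, started at \<open>x0\<close>.\<close>

definition solves_time_change ::
  "nat \<Rightarrow> (real ^ 'd \<Rightarrow> real ^ 'd) \<Rightarrow> (nat \<Rightarrow> real ^ 'd \<Rightarrow> real) \<Rightarrow> (nat \<Rightarrow> real ^ 'd) \<Rightarrow>
   (nat \<Rightarrow> real \<Rightarrow> nat) \<Rightarrow> real ^ 'd \<Rightarrow> (real \<Rightarrow> real ^ 'd) \<Rightarrow> bool" where
  "solves_time_change p f lam \<nu> y x0 x \<longleftrightarrow>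
     (\<forall>t\<ge>0. x t = x0 + set_lebesgue_integral lborel {0..t} (\<lambda>s. f (x s)) +
        (\<Sum>k=1..p. real (y k (set_lebesgue_integral lborel {0..t} (\<lambda>s. lam k (x s)))) *\<^sub>R \<nu> k))"

definition generator ::
  "nat \<Rightarrow> (real ^ 'd \<Rightarrow> real ^ 'd) \<Rightarrow> (nat \<Rightarrow> real ^ 'd \<Rightarrow> real) \<Rightarrow> (nat \<Rightarrow> real ^ 'd) \<Rightarrow>
   (real ^ 'd \<Rightarrow> real) \<Rightarrow> real ^ 'd \<Rightarrow> real" where
  "generator p f lam \<nu> F x =
     grad_apply F x (f x) + (\<Sum>k=1..p. lam k x * (F (x + \<nu> k) - F x))"

definition natural_filtration ::
  "'w measure \<Rightarrow> (real \<Rightarrow> 'w \<Rightarrow> 'a :: topological_space) \<Rightarrow> real \<Rightarrow> 'w measure" where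
  "natural_filtration M X t =
     sigma (space M) (\<Union>s\<in>{0..t}. {X s -` A \<inter> space M | A. A \<in> sets borel})"

text \<open>For a natural filtration, the subalgebra condition below says that the generating
  process consists of random variables.\<close>

definition martingale :: "'w measure \<Rightarrow> (real \<Rightarrow> 'w measure) \<Rightarrow> (real \<Rightarrow> 'w \<Rightarrow> real) \<Rightarrow> bool" where
  "martingale M G Z \<longleftrightarrow>
     filtration (space M) G \<and>
     (\<forall>t\<ge>0. subalgebra M (G t) \<and> Z t \<in> borel_measurable (G t) \<and> integrable M (Z t)) \<and>
     (\<forall>s t. 0 \<le> s \<and> s \<le> t \<longrightarrow> (AE \<omega> in M. real_cond_exp M (G s) (Z t) \<omega> = Z s \<omega>))"

end

theory Submission
  imports Defs
begin

text \<open>Pathwise, between jumps of the driving paths the equation is an ODE with Lipschitz right-hand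
  side, and an integrated rate can only make its path jump at a definite first moment; gluing ODE
  pieces at these moments gives the solution, and since each piece is a measurable function of the
  previous ones, the solution is a measurable functional of \<open>X(0)\<close> and the driving paths.

  For the martingale property let \<open>H(u)\<close>, \<open>u \<in> [0,\<infinity>)\<^sup>p\<close>, be generated by \<open>X(0)\<close> and
  \<open>Y\<^sub>k(r)\<close>, \<open>r \<le> u\<^sub>k\<close>. By uniqueness the vector \<open>\<tau>(t)\<close> of integrated rates satisfies
  \<open>\<tau>(t) \<le> u\<close> exactly when the clocks of the solution driven by the paths stopped at \<open>u\<close> do, and
  then both solutions agree on \<open>[0,t]\<close>. So \<open>\<tau>(t)\<close> is a stopping time for this multiparameter
  filtration, and approximating it from above on a lattice yields optional sampling for
  \<open>Y\<^sub>k(u) - u\<close>. Hence on \<open>[t,t+h]\<close> the jumps may be replaced by their rates up to an error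
  \<open>O(h\<^sup>2)\<close> caused by multiple jumps, so \<open>E[1\<^sub>A Z(t)]\<close>, where \<open>Z\<close> is the candidate martingale and \<open>A\<close>
  an event of the past, has vanishing right derivative in \<open>t\<close> and is constant.\<close>

section \<open>Right-continuous functions and integrals over intervals\<close>

text \<open>The clocks are coupled: \<open>\<tau>\<^sub>k(t)\<close> depends on all driving paths,
  so in general it is not a stopping time for the history of \<open>Y\<^sub>k\<close> alone, and a
  history needs one horizon per coordinate. Freezing the paths at \<open>u\<close> avoids any
  inversion of clocks. \<open>F\<close> has only first derivatives and the position jumps, so no
  expansion along whole paths is attempted. For a fixed path and a fixed time \<open>t\<close> there
  is no jump on some interval after \<open>t\<close>, which gives a first-order expansion from the
  right; jumps within \<open>[t,t+h]\<close> are treated in expectation only. Multiple jumps are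
  measured by \<open>S (S - 1)\<close> with \<open>S\<close> the number of jumps in a clock window:
  it vanishes for \<open>S \<le> 1\<close>, and its Poisson mean is exactly the square of the
  intensity, with no first-order term. Null sets shape the rest. The Poisson paths are regular only
  almost surely and are first replaced by versions regular everywhere. The martingale claim concerns
  any process that solves the equation almost surely, and its natural filtration is not completed:
  completeness of the space makes the process measurable, and its past events are matched up to null
  sets with those of the constructed solution.\<close>

definition right_cont :: "(real \<Rightarrow> 'a :: topological_space) \<Rightarrow> bool" where
  "right_cont x \<longleftrightarrow> (\<forall>t. (x \<longlongrightarrow> x t) (at_right t))"

text \<open>The \<open>+ 1\<close> after the floor places the grid point strictly to the right of
  \<open>t\<close>, where a right-continuous path can be followed to its value at
  \<open>t\<close>.\<close>

lemma grid_at_right: "filterlim (\<lambda>n. (real_of_int \<lfloor>real (Suc n) * t\<rfloor> + 1) / real (Suc n)) (at_right t) sequentially"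
proof -
  let ?u = "\<lambda>n. (real_of_int \<lfloor>real (Suc n) * t\<rfloor> + 1) / real (Suc n)"
  have *: "t < (real_of_int \<lfloor>m * t\<rfloor> + 1) / m \<and> (real_of_int \<lfloor>m * t\<rfloor> + 1) / m \<le> t + 1 / m" if "m > 0" for m :: real
    using that floor_correct[of "m * t"] by (simp add: field_simps)
  have gt: "?u n > t" and le: "?u n \<le> t + 1 / real (Suc n)" for n
    using *[of "real (Suc n)"] by simp_all
  have "?u \<longlonglongrightarrow> t"
  proof (rule tendsto_sandwich[of "\<lambda>_. t" ?u sequentially "\<lambda>n. t + 1 / real (Suc n)"])
    show "(\<lambda>n. t + 1 / real (Suc n)) \<longlonglongrightarrow> t"
      using tendsto_add[OF tendsto_const[of t], of "\<lambda>n. 1 / real (Suc n)" 0 sequentially] LIMSEQ_Suc[OF lim_1_over_n[where 'a=real]] by simp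
    show "\<forall>\<^sub>F n in sequentially. t \<le> ?u n" using gt less_imp_le by (auto intro: always_eventually)
    show "\<forall>\<^sub>F n in sequentially. ?u n \<le> t + 1 / real (Suc n)" using le by (auto intro: always_eventually)
  qed simp
  then show ?thesis
    unfolding filterlim_at using gt by (auto intro!: always_eventually simp: less_imp_neq[symmetric])
qed

text \<open>Reading the process at the next grid point involves only countably many times, hence is
  jointly measurable; right-continuity makes the process the pointwise limit as the grid is
  refined.\<close>

lemma right_cont_process_measurable:
  fixes Z :: "real \<Rightarrow> 'w \<Rightarrow> 'b :: {second_countable_topology, metric_space}"
  assumes [measurable]: "\<And>t. Z t \<in> borel_measurable N"
    and rc: "\<And>\<omega>. \<omega> \<in> space N \<Longrightarrow> right_cont (\<lambda>t. Z t \<omega>)"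
  shows "(\<lambda>(t :: real, \<omega>). Z t \<omega>) \<in> borel_measurable (borel \<Otimes>\<^sub>M N)"
proof (rule borel_measurable_LIMSEQ_metric)
  fix n
  have "(\<lambda>z. Z ((real_of_int \<lfloor>real (Suc n) * fst z\<rfloor> + 1) / real (Suc n)) (snd z)) \<in> borel_measurable (borel \<Otimes>\<^sub>M N)"
    by (rule measurable_compose_countable[where f="\<lambda>i z. Z ((real_of_int i + 1) / real (Suc n)) (snd z)"]) simp_all
  then show "(\<lambda>(t, \<omega>). Z ((real_of_int \<lfloor>real (Suc n) * t\<rfloor> + 1) / real (Suc n)) \<omega>) \<in> borel_measurable (borel \<Otimes>\<^sub>M N)"
    by (simp add: case_prod_beta')
next
  fix z :: "real \<times> 'w" assume "z \<in> space (borel \<Otimes>\<^sub>M N)"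
  then obtain t \<omega> where z: "z = (t, \<omega>)" "\<omega> \<in> space N" by (auto simp: space_pair_measure)
  have "((\<lambda>t. Z t \<omega>) \<longlongrightarrow> Z t \<omega>) (at_right t)"
    using rc[OF z(2)] by (auto simp: right_cont_def)
  from filterlim_compose[OF this grid_at_right]
  show "(\<lambda>n. case z of (t, \<omega>) \<Rightarrow> Z ((real_of_int \<lfloor>real (Suc n) * t\<rfloor> + 1) / real (Suc n)) \<omega>) \<longlonglongrightarrow> (case z of (t, \<omega>) \<Rightarrow> Z t \<omega>)"
    by (simp add: z(1))
qed

lemma right_cont_borel_measurable:
  fixes x :: "real \<Rightarrow> 'b :: {second_countable_topology, metric_space}"
  assumes "right_cont x" shows "x \<in> borel_measurable borel"
proof -
  \<comment> \<open>A path is a process on a one-point space.\<close>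
  have "(\<lambda>(t, u::unit). x t) \<in> borel_measurable (borel \<Otimes>\<^sub>M count_space UNIV)"
    by (rule right_cont_process_measurable) (use assms in auto)
  then have "(\<lambda>t. case (t, ()) of (t, u) \<Rightarrow> x t) \<in> borel_measurable borel"
    by (rule measurable_compose[rotated]) simp
  then show ?thesis by simp
qed

lemma right_cont_compose:
  assumes "right_cont x" "continuous_on UNIV g"
  shows "right_cont (\<lambda>t. g (x t))"
  using assms unfolding right_cont_def by (auto intro!: continuous_on_tendsto_compose[OF assms(2)])

text \<open>Bridges paths that are controlled at times \<open>t \<ge> 0\<close> only and
  \<open>right_cont\<close>, which speaks of all real times.\<close>

lemma right_cont_clip:
  assumes "\<And>t. t \<ge> 0 \<Longrightarrow> (x \<longlongrightarrow> x t) (at_right t)"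
  shows "right_cont (\<lambda>t. x (max 0 t))"
  unfolding right_cont_def
proof
  fix t :: real
  show "((\<lambda>t. x (max 0 t)) \<longlongrightarrow> x (max 0 t)) (at_right t)"
  proof (cases "t \<ge> 0")
    case True
    have "\<forall>\<^sub>F s in at_right t. x s = x (max 0 s)"
      using True by (intro eventually_at_rightI[of t "t+1"]) auto
    then show ?thesis using assms[OF True] True by (auto intro: Lim_transform_eventually)
  next
    case False
    have "\<forall>\<^sub>F s in at_right t. x 0 = x (max 0 s)"
      using False by (intro eventually_at_rightI[of t 0]) auto
    then show ?thesis using False by (auto intro: Lim_transform_eventually)
  qed
qed

text \<open>Freezing at \<open>T\<close> as well leaves a path built from values on
  \<open>[0,T]\<close> only; this is what adaptedness of a time integral will rest on.\<close>

lemma right_cont_clip2: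
  assumes "\<And>t. t \<ge> 0 \<Longrightarrow> (x \<longlongrightarrow> x t) (at_right t)" "0 \<le> T"
  shows "right_cont (\<lambda>t. x (max 0 (min t T)))"
  unfolding right_cont_def
proof
  fix t :: real
  have rc: "right_cont (\<lambda>t. x (max 0 t))" using assms by (intro right_cont_clip)
  show "((\<lambda>t. x (max 0 (min t T))) \<longlongrightarrow> x (max 0 (min t T))) (at_right t)"
  proof (cases "t < T")
    case True
    have "\<forall>\<^sub>F s in at_right t. x (max 0 s) = x (max 0 (min s T))"
      using True by (intro eventually_at_rightI[of t T]) auto
    then show ?thesis using rc[unfolded right_cont_def, rule_format, of t] True
      by (auto intro: Lim_transform_eventually)
  next
    case False
    have "\<forall>\<^sub>F s in at_right t. x T = x (max 0 (min s T))"
      using False assms(2) by (intro eventually_at_rightI[of t "t+1"]) auto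
    then show ?thesis using False assms(2) by (auto intro: Lim_transform_eventually)
  qed
qed

section \<open>Integrals of bounded functions over compact intervals\<close>

lemma set_integrable_const_Icc: "set_integrable lborel {a..b :: real} (\<lambda>_. c :: 'b :: {banach, second_countable_topology})"
  unfolding set_integrable_def
  by (rule integrable_scaleR_left, rule integrable_real_indicator) (auto simp: emeasure_lborel_Icc_eq)

context
  fixes g :: "real \<Rightarrow> 'b :: {banach, second_countable_topology}" and C :: real
  assumes g[measurable]: "g \<in> borel_measurable borel" and bnd: "\<And>s. norm (g s) \<le> C"
begin

lemma bounded_set_integrable:
  assumes "emeasure lborel A < \<infinity>" "A \<in> sets borel"
  shows "set_integrable lborel A g"
proof -
  have "set_integrable lborel A (\<lambda>_. C)"
    using assms unfolding set_integrable_def by simp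
  then show ?thesis
    using assms by (elim set_integrable_bound) (auto simp: set_borel_measurable_def intro!: AE_I2 order_trans[OF bnd])
qed

lemma bounded_set_integrable_Icc: "set_integrable lborel {a..b} g"
  by (rule bounded_set_integrable) (cases "a \<le> b"; simp)+

lemma norm_integral_Icc_le:
  assumes "a \<le> b" shows "norm (LBINT s:{a..b}. g s) \<le> C * (b - a)"
proof -
  have "norm (LBINT s:{a..b}. g s) \<le> (LBINT s:{a..b}. norm (g s))"
    by (rule set_integral_norm_bound[OF bounded_set_integrable_Icc])
  also have "\<dots> \<le> (LBINT s:{a..b}. C)"
    by (rule set_integral_mono) (auto intro: set_integrable_norm bounded_set_integrable_Icc set_integrable_const_Icc bnd)
  also have "\<dots> = C * (b - a)" using assms by (simp add: set_lebesgue_integral_def)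
  finally show ?thesis .
qed

lemma integral_Icc_split:
  assumes "a \<le> c" "c \<le> b"
  shows "(LBINT s:{a..b}. g s) = (LBINT s:{a..c}. g s) + (LBINT s:{c..b}. g s)"
proof -
  have "(LBINT s:{a..b}. g s) = (LBINT s:{a..c} \<union> {c<..b}. g s)"
    using assms by (simp add: ivl_disj_un)
  also have "\<dots> = (LBINT s:{a..c}. g s) + (LBINT s:{c<..b}. g s)"
    by (rule set_integral_Un) (auto intro!: bounded_set_integrable_Icc set_integrable_subset[OF bounded_set_integrable_Icc[of c b]])
  also have "(LBINT s:{c<..b}. g s) = (LBINT s:{c..b}. g s)"
  proof (intro set_integral_cong_set)
    show "AE x in lborel. (x \<in> {c..b}) = (x \<in> {c<..b})"
      using AE_lborel_singleton[of c] by eventually_elim auto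
  qed (auto simp: set_borel_measurable_def)
  finally show ?thesis .
qed

lemma integral_Icc_shift: "(LBINT s:{c..c+t}. g s) = (LBINT s:{0..t}. g (c + s))"
proof -
  have "(LBINT s:{c..c+t}. g s) = (\<integral>x. indicator {c..c+t} (c + 1 * x) *\<^sub>R g (c + 1 * x) \<partial>lborel)"
    unfolding set_lebesgue_integral_def
    by (subst lborel_integral_real_affine[of 1 _ c]) auto
  also have "\<dots> = (LBINT s:{0..t}. g (c + s))"
    unfolding set_lebesgue_integral_def by (intro Bochner_Integration.integral_cong) (auto simp: indicator_def)
  finally show ?thesis .
qed

lemma average_right_limit:
  assumes "(g \<longlongrightarrow> g t) (at_right t)"
  shows "((\<lambda>h. (LBINT s:{t..t+h}. g s) /\<^sub>R h) \<longlongrightarrow> g t) (at_right 0)"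
proof (rule tendstoI)
  fix e :: real assume "e > 0"
  then have "\<forall>\<^sub>F s in at_right t. dist (g s) (g t) < e/2" using tendstoD[OF assms, of "e/2"] by simp
  then obtain b where b: "b > t" "\<And>s. t < s \<Longrightarrow> s < b \<Longrightarrow> dist (g s) (g t) < e/2"
    by (auto simp: eventually_at_right[OF less_add_one])
  have "dist ((LBINT s:{t..t+h}. g s) /\<^sub>R h) (g t) < e" if h: "0 < h" "h < b - t" for h
  proof -
    have i1: "set_integrable lborel {t..t+h} (\<lambda>s. g t)"
      by (rule set_integrable_const_Icc)
    have eq: "(LBINT s:{t..t+h}. g s - g t) = (LBINT s:{t..t+h}. g s) - h *\<^sub>R g t"
      using h i1 by (subst set_integral_diff) (auto intro: bounded_set_integrable_Icc simp: set_lebesgue_integral_def)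
    have "norm (LBINT s:{t..t+h}. g s - g t) \<le> (LBINT s:{t..t+h}. norm (g s - g t))"
      by (rule set_integral_norm_bound) (auto intro: bounded_set_integrable_Icc i1)
    also have "\<dots> \<le> (LBINT s:{t..t+h}. e/2)"
    proof (rule set_integral_mono)
      show "set_integrable lborel {t..t+h} (\<lambda>s. norm (g s - g t))"
        by (intro set_integrable_norm set_integral_diff bounded_set_integrable_Icc i1)
      show "set_integrable lborel {t..t+h} (\<lambda>s. e/2)" by (rule set_integrable_const_Icc)
      fix s assume "s \<in> {t..t+h}"
      then show "norm (g s - g t) \<le> e/2" using b(2)[of s] h \<open>e > 0\<close> by (cases "s = t") (auto simp: dist_norm)
    qed
    also have "\<dots> = h * (e/2)" using h by (simp add: set_lebesgue_integral_def)
    finally have "norm ((LBINT s:{t..t+h}. g s) - h *\<^sub>R g t) \<le> h * (e/2)" using eq by simp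
    moreover have "(LBINT s:{t..t+h}. g s) /\<^sub>R h - g t = ((LBINT s:{t..t+h}. g s) - h *\<^sub>R g t) /\<^sub>R h"
      using h by (simp add: algebra_simps)
    ultimately have "dist ((LBINT s:{t..t+h}. g s) /\<^sub>R h) (g t) \<le> e/2"
      using h by (simp add: dist_norm divide_inverse_commute[symmetric] pos_divide_le_eq mult.commute)
    then show ?thesis using \<open>e > 0\<close> by simp
  qed
  then show "\<forall>\<^sub>F h in at_right 0. dist ((LBINT s:{t..t+h}. g s) /\<^sub>R h) (g t) < e"
    using b(1) by (intro eventually_at_rightI[of 0 "b - t"]) auto
qed

end

lemma integral_Icc_cong:
  fixes a b :: real
  shows "(\<And>s. a \<le> s \<Longrightarrow> s \<le> b \<Longrightarrow> g s = h s) \<Longrightarrow> (LBINT s:{a..b}. g s) = (LBINT s:{a..b}. h s)"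
  by (rule set_lebesgue_integral_cong) (simp_all add: sets_lborel)

lemma integral_Icc_cong_less:
  fixes g h :: "real \<Rightarrow> 'b :: {banach, second_countable_topology}"
  assumes [measurable]: "g \<in> borel_measurable borel" "h \<in> borel_measurable borel"
  and "\<And>s. a \<le> s \<Longrightarrow> s < b \<Longrightarrow> g s = h s"
  shows "(LBINT s:{a..b}. g s) = (LBINT s:{a..b}. h s)"
proof (intro set_lebesgue_integral_cong_AE)
  show "AE x \<in> {a..b} in lborel. g x = h x"
    using AE_lborel_singleton[of b] by eventually_elim (use assms(3) in auto)
qed auto

lemma norm_integral_Icc_le_on:
  fixes g :: "real \<Rightarrow> 'b :: {banach, second_countable_topology}"
  assumes [measurable]: "g \<in> borel_measurable borel"
    and "a \<le> b" "\<And>s. a \<le> s \<Longrightarrow> s \<le> b \<Longrightarrow> norm (g s) \<le> C"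
  shows "norm (LBINT s:{a..b}. g s) \<le> C * (b - a)"
proof -
  have "0 \<le> C" using assms(2) assms(3)[of a] norm_ge_zero[of "g a"] by linarith
  then have "norm (LBINT s:{a..b}. indicator {a..b} s *\<^sub>R g s) \<le> C * (b - a)"
    using assms(2,3) by (intro norm_integral_Icc_le) (auto simp: indicator_def)
  also have "(LBINT s:{a..b}. indicator {a..b} s *\<^sub>R g s) = (LBINT s:{a..b}. g s)"
    by (rule integral_Icc_cong) simp
  finally show ?thesis .
qed

text \<open>A single admissible \<open>h\<close> for each \<open>x\<close> and \<open>e\<close> is
  enough: the points reached from \<open>s\<close> with slope at most \<open>e\<close> form a closed
  set, and its supremum could be pushed further by \<open>step\<close> if it lay before
  \<open>t\<close>.\<close>

lemma right_derivative_zero_imp_const: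
  fixes q :: "real \<Rightarrow> real"
  assumes "s \<le> t" and cont: "continuous_on {s..t} q"
    and step: "\<And>x e. s \<le> x \<Longrightarrow> x < t \<Longrightarrow> e > 0 \<Longrightarrow> \<exists>h>0. x + h \<le> t \<and> \<bar>q (x + h) - q x\<bar> \<le> e * h"
  shows "q t = q s"
proof -
  have "\<bar>q t - q s\<bar> \<le> e * (t - s)" if "e > 0" for e
  proof -
    define S where "S = {x\<in>{s..t}. \<bar>q x - q s\<bar> \<le> e * (x - s)}"
    have sS: "s \<in> S" using assms(1) by (auto simp: S_def)
    have "closed S" unfolding S_def
      by (intro continuous_on_closed_Collect_le continuous_intros cont closed_atLeastAtMost)
    moreover have bdd: "bdd_above S" by (auto simp: S_def bdd_above_def)
    ultimately have x: "Sup S \<in> S" using closed_contains_Sup sS by blast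
    have "Sup S = t"
    proof (rule ccontr)
      assume "Sup S \<noteq> t"
      then have "Sup S < t" "s \<le> Sup S" using x by (auto simp: S_def)
      from step[OF this(2,1) that] obtain h where h: "h > 0" "Sup S + h \<le> t" "\<bar>q (Sup S + h) - q (Sup S)\<bar> \<le> e * h" by auto
      have "\<bar>q (Sup S) - q s\<bar> \<le> e * (Sup S - s)" using x unfolding S_def by blast
      then have "\<bar>q (Sup S + h) - q s\<bar> \<le> e * (Sup S + h - s)" using h(3) by (simp add: algebra_simps)
      then have "Sup S + h \<in> S" using h(1,2) \<open>s \<le> Sup S\<close> unfolding S_def by simp
      then show False using cSup_upper[OF _ bdd, of "Sup S + h"] h by simp
    qed
    then show ?thesis using x by (simp add: S_def)
  qed
  then have *: "\<bar>q t - q s\<bar> \<le> 0 + e" if "e > 0" for e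
  proof -
    \<comment> \<open>The \<open>+ 1\<close> keeps the denominator positive when
      \<open>s = t\<close>.\<close>
    have "\<bar>q t - q s\<bar> \<le> e / (t - s + 1) * (t - s)"
      using \<open>\<And>e. e > 0 \<Longrightarrow> \<bar>q t - q s\<bar> \<le> e * (t - s)\<close>[of "e / (t - s + 1)"] that assms(1) by simp
    also have "\<dots> \<le> e" using that assms(1) by (simp add: field_simps)
    finally show ?thesis by simp
  qed
  show ?thesis using field_le_epsilon[OF *] by auto
qed

section \<open>The flow and pathwise uniqueness\<close>

lemma integral_upto_lipschitz:
  fixes g :: "real \<Rightarrow> 'b :: {banach, second_countable_topology}"
  assumes "g \<in> borel_measurable borel" "\<And>s. norm (g s) \<le> C" "0 \<le> s" "0 \<le> t"
  shows "norm ((LBINT r:{0..t}. g r) - (LBINT r:{0..s}. g r)) \<le> C * \<bar>t - s\<bar>"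
proof -
  have *: "norm ((LBINT r:{0..t}. g r) - (LBINT r:{0..s}. g r)) \<le> C * (t - s)" if "0 \<le> s" "s \<le> t" for s t
    using integral_Icc_split[OF assms(1,2) that] norm_integral_Icc_le[OF assms(1,2) that(2)] by simp
  show ?thesis
    using *[of s t] *[of t s] assms by (cases "s \<le> t") (auto simp: norm_minus_commute)
qed

lemma integral_upto_continuous:
  fixes g :: "real \<Rightarrow> 'b :: {banach, second_countable_topology}"
  assumes "g \<in> borel_measurable borel" "\<And>s. norm (g s) \<le> C"
  shows "continuous_on UNIV (\<lambda>t. LBINT r:{0..max 0 t}. g r)"
proof -
  have "C \<ge> 0" using assms(2) norm_ge_zero order_trans by blast
  have "C-lipschitz_on UNIV (\<lambda>t. LBINT r:{0..max 0 t}. g r)"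
  proof (rule lipschitz_onI)
    fix x y :: real
    have "dist (LBINT r:{0..max 0 x}. g r) (LBINT r:{0..max 0 y}. g r) \<le> C * \<bar>max 0 x - max 0 y\<bar>"
      unfolding dist_norm by (rule integral_upto_lipschitz[OF assms]) auto
    also have "\<dots> \<le> C * dist x y" using \<open>C \<ge> 0\<close> by (intro mult_left_mono) (auto simp: dist_real_def)
    finally show "dist (LBINT r:{0..max 0 x}. g r) (LBINT r:{0..max 0 y}. g r) \<le> C * dist x y" .
  qed fact
  then show ?thesis by (rule lipschitz_on_continuous_on)
qed

lemma integral_exp_le:
  fixes c t :: real
  assumes "c > 0" "0 \<le> t"
  shows "(LBINT s:{0..t}. exp (c * s)) \<le> exp (c * t) / c"
proof -
  have "((\<lambda>s. exp (c * s) / c) has_real_derivative exp (c * s)) (at s within A)" for s :: real and A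
    using assms by (auto intro!: derivative_eq_intros)
  then have "(LBINT s:{0..t}. exp (c * s)) = exp (c * t) / c - exp (c * 0) / c"
    unfolding set_lebesgue_integral_def using assms
    by (subst integral_FTC_Icc_real[symmetric]) (auto intro!: continuous_intros simp: mult.commute)
  then show ?thesis using assms by simp
qed

lemma set_integrable_continuous_Icc:
  fixes g :: "real \<Rightarrow> 'b :: {banach, second_countable_topology}"
  assumes "continuous_on {a..b} g" shows "set_integrable lborel {a..b} g"
  unfolding set_integrable_def by (rule borel_integrable_compact) (use assms in auto)

text \<open>Driving paths are extended by a constant to negative times, which removes side conditions
  on the sign of the time.\<close>

definition step_path :: "(real \<Rightarrow> nat) \<Rightarrow> bool" where
  "step_path y \<longleftrightarrow> mono y \<and> (\<forall>t. \<forall>\<^sub>F s in at_right t. y s = y t)"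

text \<open>The base points \<open>c k\<close> differ because each path is read at its own clock; a
  common \<open>d\<close> exists because there are finitely many paths.\<close>

lemma step_path_const_right:
  assumes "\<And>k. k \<in> {1..p::nat} \<Longrightarrow> step_path (y k)"
  shows "\<exists>d>0. \<forall>k\<in>{1..p}. \<forall>r. c k \<le> r \<and> r < c k + d \<longrightarrow> y k r = y k (c k)"
proof -
  have "\<forall>\<^sub>F h in at_right 0. y k (c k + h) = y k (c k)" if "k \<in> {1..p}" for k
  proof -
    have "\<forall>\<^sub>F s in at_right (c k). y k s = y k (c k)" using assms[OF that] by (auto simp: step_path_def)
    then show ?thesis unfolding at_right_to_0[of "c k"] eventually_filtermap by (simp add: add.commute)
  qed
  then have "\<forall>\<^sub>F h in at_right 0. \<forall>k\<in>{1..p}. y k (c k + h) = y k (c k)"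
    by (intro eventually_ball_finite) auto
  then obtain d where d: "d > 0" "\<And>h. 0 < h \<Longrightarrow> h < d \<Longrightarrow> \<forall>k\<in>{1..p}. y k (c k + h) = y k (c k)"
    by (auto simp: eventually_at_right[OF zero_less_one])
  show ?thesis
  proof (intro exI[of _ d] conjI ballI allI impI)
    fix k r assume k: "k \<in> {1..p}" and r: "c k \<le> r \<and> r < c k + d"
    show "y k r = y k (c k)"
    proof (cases "r = c k")
      case False
      then have "0 < r - c k" "r - c k < d" using r by auto
      from bspec[OF d(2)[OF this] k] have "y k (c k + (r - c k)) = y k (c k)" .
      then show ?thesis by simp
    qed simp
  qed fact
qed

text \<open>The Lipschitz bound concerns the drift alone: while the counts are constant, the rates
  do not move the position and only decide when the next jump comes. The rate bounds range over all
  \<open>k\<close>, so rates will be extended by zero beyond \<open>p\<close>.\<close>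

locale time_change =
  fixes p :: nat and f :: "real ^ 'd \<Rightarrow> real ^ 'd" and lam :: "nat \<Rightarrow> real ^ 'd \<Rightarrow> real"
    and \<nu> :: "nat \<Rightarrow> real ^ 'd" and L C R :: real
  assumes L_nonneg: "0 \<le> L"
    and f_lipschitz: "\<And>x y. norm (f x - f y) \<le> L * norm (x - y)"
    and f_bounded: "\<And>x. norm (f x) \<le> C"
    and lam_continuous: "\<And>k. continuous_on UNIV (lam k)"
    and lam_nonneg: "\<And>k x. 0 \<le> lam k x"
    and lam_le: "\<And>k x. lam k x \<le> R"
begin

lemma C_nonneg: "0 \<le> C" using f_bounded norm_ge_zero order_trans by blast

lemma R_nonneg: "0 \<le> R" using lam_nonneg lam_le order_trans by blast

lemma f_continuous: "continuous_on UNIV f"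
  by (rule lipschitz_on_continuous_on[of L]) (auto intro!: lipschitz_onI f_lipschitz L_nonneg simp: dist_norm)

lemma f_measurable [measurable]: "f \<in> borel_measurable borel"
  using f_continuous by (rule borel_measurable_continuous_onI)

lemma lam_measurable [measurable]: "lam k \<in> borel_measurable borel"
  using lam_continuous by (rule borel_measurable_continuous_onI)

lemma norm_lam_le: "norm (lam k x) \<le> R"
  using lam_nonneg lam_le by simp

text \<open>The Picard map after substituting \<open>x(s) = exp((2L+1)s) w(s)\<close>, that is, in
  an exponentially weighted supremum norm. The weight yields the contraction factor
  \<open>L/(2L+1)\<close> on the whole half-line at once; \<open>max 0 t\<close> extends the result
  to the real line, where bounded continuous functions form a complete space.\<close>

definition picard :: "real ^ 'd \<Rightarrow> (real \<Rightarrow>\<^sub>C (real ^ 'd)) \<Rightarrow> real \<Rightarrow> real ^ 'd" where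
  "picard x w t = exp (- ((2*L+1) * max 0 t)) *\<^sub>R (x + (LBINT s:{0..max 0 t}. f (exp ((2*L+1) * s) *\<^sub>R w s)))"

lemma apply_bcontfun_measurable [measurable]: "apply_bcontfun w \<in> borel_measurable borel"
  by (intro borel_measurable_continuous_onI) simp

text \<open>A bounded \<open>f\<close> lets the integral grow at most linearly, and the weight
  absorbs this: \<open>u \<le> exp((2L+1)u)\<close> because \<open>2L+1 \<ge> 1\<close>.\<close>

lemma picard_bcontfun: "picard x w \<in> bcontfun"
proof -
  have "continuous_on UNIV (picard x w)"
    unfolding picard_def
    by (intro continuous_intros integral_upto_continuous[of _ C]) (auto intro: f_bounded)
  moreover have "norm (picard x w t) \<le> norm x + C" for t
  proof -
    define u where "u = max 0 t"
    have u: "u \<ge> 0" by (simp add: u_def)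
    have e: "u \<le> exp ((2*L+1) * u)"
    proof -
      have "(2*L+1) * u = 2 * (L * u) + u" by (simp add: algebra_simps)
      then show ?thesis using exp_ge_add_one_self[of "(2*L+1) * u"] mult_nonneg_nonneg[OF L_nonneg u] by linarith
    qed
    have "norm (picard x w t) = exp (- ((2*L+1) * u)) * norm (x + (LBINT s:{0..u}. f (exp ((2*L+1) * s) *\<^sub>R w s)))"
      unfolding picard_def u_def[symmetric] by simp
    also have "\<dots> \<le> exp (- ((2*L+1) * u)) * (norm x + C * u)"
    proof (intro mult_left_mono norm_triangle_le add_left_mono)
      show "norm (LBINT s:{0..u}. f (exp ((2*L+1) * s) *\<^sub>R w s)) \<le> C * u"
        using norm_integral_Icc_le[of "\<lambda>s. f (exp ((2*L+1) * s) *\<^sub>R w s)" C 0 u] f_bounded u by simp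
    qed simp
    also have "\<dots> = exp (- ((2*L+1) * u)) * norm x + C * (u * exp (- ((2*L+1) * u)))" by (simp add: algebra_simps)
    also have "\<dots> \<le> 1 * norm x + C * 1"
    proof (intro add_mono mult_right_mono mult_left_mono C_nonneg)
      show "exp (- ((2*L+1) * u)) \<le> 1" using L_nonneg u by (simp add: mult_nonneg_nonneg)
      have "u * exp (- ((2*L+1) * u)) \<le> exp ((2*L+1) * u) * exp (- ((2*L+1) * u))"
        using e by (rule mult_right_mono) simp
      also have "\<dots> = 1" by (simp add: mult_exp_exp)
      finally show "u * exp (- ((2*L+1) * u)) \<le> 1" .
    qed simp
    finally show ?thesis by simp
  qed
  ultimately show ?thesis unfolding bcontfun_def by (auto intro!: boundedI)
qed

text \<open>Start and curve vary together so that one estimate serves twice: equal starts give the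
  contraction, two fixed points give Lipschitz dependence on the start.\<close>

lemma picard_dist:
  "dist (picard x w t) (picard x' w' t) \<le> norm (x - x') + dist w w' / 2"
proof -
  define u c where "u = max 0 t" and "c = 2*L+1"
  have u: "u \<ge> 0" and c: "c \<ge> 1" using L_nonneg by (auto simp: u_def c_def)
  define g g' where "g = (\<lambda>s. f (exp (c * s) *\<^sub>R w s))" and "g' = (\<lambda>s. f (exp (c * s) *\<^sub>R w' s))"
  have [measurable]: "g \<in> borel_measurable borel" "g' \<in> borel_measurable borel" unfolding g_def g'_def by measurable
  have int: "set_integrable lborel {0..u} g" "set_integrable lborel {0..u} g'"
    by (auto intro!: bounded_set_integrable_Icc[where C=C] simp: g_def g'_def f_bounded)
  have "norm ((LBINT s:{0..u}. g s) - (LBINT s:{0..u}. g' s)) = norm (LBINT s:{0..u}. g s - g' s)"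
    using int by (simp add: set_integral_diff)
  also have "\<dots> \<le> (LBINT s:{0..u}. norm (g s - g' s))"
    by (intro set_integral_norm_bound set_integral_diff int)
  also have "\<dots> \<le> (LBINT s:{0..u}. (L * dist w w') * exp (c * s))"
  proof (rule set_integral_mono)
    show "set_integrable lborel {0..u} (\<lambda>s. norm (g s - g' s))" by (intro set_integrable_norm set_integral_diff int)
    show "set_integrable lborel {0..u} (\<lambda>s. L * dist w w' * exp (c * s))"
      by (intro set_integrable_continuous_Icc continuous_intros)
    fix s
    have "norm (g s - g' s) \<le> L * (exp (c * s) * norm (w s - w' s))"
      unfolding g_def g'_def using f_lipschitz[of "exp (c * s) *\<^sub>R w s" "exp (c * s) *\<^sub>R w' s"]
      by (simp add: scaleR_diff_right[symmetric])
    also have "\<dots> \<le> L * (exp (c * s) * dist w w')"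
      using L_nonneg dist_bounded[of w s w'] by (intro mult_left_mono) (auto simp: dist_norm)
    finally show "norm (g s - g' s) \<le> L * dist w w' * exp (c * s)" by (simp add: ac_simps)
  qed
  also have "\<dots> = L * dist w w' * (LBINT s:{0..u}. exp (c * s))" by simp
  also have "\<dots> \<le> L * dist w w' * (exp (c * u) / c)"
    using integral_exp_le[of c u] c u L_nonneg by (intro mult_left_mono) auto
  also have "\<dots> \<le> exp (c * u) * (dist w w' / 2)"
  proof -
    have "L / c \<le> 1 / 2" using c by (simp add: c_def field_simps)
    from mult_right_mono[OF this, of "dist w w' * exp (c * u)"] show ?thesis by (simp add: ac_simps)
  qed
  finally have *: "norm ((LBINT s:{0..u}. g s) - (LBINT s:{0..u}. g' s)) \<le> exp (c * u) * (dist w w' / 2)" .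
  have "dist (picard x w t) (picard x' w' t) = exp (- (c * u)) * norm ((x - x') + ((LBINT s:{0..u}. g s) - (LBINT s:{0..u}. g' s)))"
    unfolding picard_def dist_norm u_def[symmetric] c_def[symmetric] g_def[symmetric] g'_def[symmetric]
      scaleR_diff_right[symmetric] norm_scaleR by (simp add: algebra_simps)
  also have "\<dots> \<le> exp (- (c * u)) * (norm (x - x') + exp (c * u) * (dist w w' / 2))"
    by (intro mult_left_mono norm_triangle_le add_left_mono *) auto
  also have "\<dots> = exp (- (c * u)) * norm (x - x') + dist w w' / 2" by (simp add: algebra_simps exp_minus)
  also have "exp (- (c * u)) * norm (x - x') \<le> 1 * norm (x - x')" using c u by (intro mult_right_mono) auto
  finally show ?thesis by simp
qed

lemma picard_fixpoint: "\<exists>w. Bcontfun (picard x w) = w"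
proof -
  have "\<forall>w w'. dist (Bcontfun (picard x w)) (Bcontfun (picard x w')) \<le> 1/2 * dist w w'"
  proof (intro allI dist_bound)
    fix w w' t
    show "dist (apply_bcontfun (Bcontfun (picard x w)) t) (apply_bcontfun (Bcontfun (picard x w')) t) \<le> 1/2 * dist w w'"
      using picard_dist[of x w t x w'] by (simp add: Bcontfun_inverse picard_bcontfun)
  qed
  then show ?thesis using banach_fix_type[of "1/2" "\<lambda>w. Bcontfun (picard x w)"] by auto
qed

definition flow_bcontfun :: "real ^ 'd \<Rightarrow> (real \<Rightarrow>\<^sub>C (real ^ 'd))" where
  "flow_bcontfun x = (SOME w. Bcontfun (picard x w) = w)"

definition flow :: "real ^ 'd \<Rightarrow> real \<Rightarrow> real ^ 'd" where
  "flow x t = exp ((2*L+1) * max 0 t) *\<^sub>R flow_bcontfun x (max 0 t)"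

lemma flow_bcontfun: "flow_bcontfun x t = picard x (flow_bcontfun x) t"
proof -
  have "Bcontfun (picard x (flow_bcontfun x)) = flow_bcontfun x"
    using someI_ex[OF picard_fixpoint[of x]] unfolding flow_bcontfun_def .
  from arg_cong[OF this, of "\<lambda>w. apply_bcontfun w t"] show ?thesis
    by (simp add: Bcontfun_inverse picard_bcontfun)
qed

lemma flow_clip: "flow x (max 0 t) = flow x t"
  by (simp add: flow_def)

lemma flow_continuous: "continuous_on UNIV (flow x)"
  unfolding flow_def by (intro continuous_intros continuous_on_compose2[OF continuous_on_apply_bcontfun[of UNIV]]) auto

lemma flow_eq:
  assumes "0 \<le> t" shows "flow x t = x + (LBINT s:{0..t}. f (flow x s))"
proof -
  have "(LBINT s:{0..t}. f (exp ((2*L+1) * s) *\<^sub>R flow_bcontfun x s)) = (LBINT s:{0..t}. f (flow x s))"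
    by (rule integral_Icc_cong) (simp add: flow_def)
  then show ?thesis
    using assms flow_bcontfun[of x t] by (simp add: flow_def picard_def mult_exp_exp)
qed

lemma flow_0 [simp]: "flow x 0 = x"
proof -
  have "(LBINT s:{0..0}. f (flow x s)) = 0"
    using norm_integral_Icc_le_on[of "\<lambda>s. f (flow x s)" 0 0 C] f_bounded flow_continuous[of x]
    by (auto intro!: borel_measurable_continuous_onI continuous_on_compose2[OF f_continuous])
  then show ?thesis using flow_eq[of 0 x] by simp
qed

lemma flow_dist: "dist (flow x t) (flow y t) \<le> 2 * exp ((2*L+1) * max 0 t) * norm (x - y)"
proof -
  \<comment> \<open>With both fixed points inserted, their distance occurs on both sides, halved on
    the right, and can be absorbed.\<close>
  have "dist (flow_bcontfun x) (flow_bcontfun y) \<le> norm (x - y) + dist (flow_bcontfun x) (flow_bcontfun y) / 2"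
    by (rule dist_bound, subst (1 2) flow_bcontfun) (rule picard_dist)
  then have "dist (flow_bcontfun x (max 0 t)) (flow_bcontfun y (max 0 t)) \<le> 2 * norm (x - y)"
    using dist_bounded[of "flow_bcontfun x" "max 0 t" "flow_bcontfun y"] by linarith
  then show ?thesis
    unfolding flow_def dist_norm scaleR_diff_right[symmetric] norm_scaleR
    by (simp add: dist_norm)
qed

lemma flow_continuous_start: "continuous_on UNIV (\<lambda>x. flow x t)"
proof (rule lipschitz_on_continuous_on, rule lipschitz_onI)
  fix x y show "dist (flow x t) (flow y t) \<le> 2 * exp ((2*L+1) * max 0 t) * dist x y"
    using flow_dist unfolding dist_norm[of x y] .
qed simp

lemma right_cont_flow: "right_cont (flow x)"
  unfolding right_cont_def
proof
  fix t
  have "(flow x \<longlongrightarrow> flow x t) (at t)" using flow_continuous[of x] by (simp add: continuous_on_def)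
  then show "(flow x \<longlongrightarrow> flow x t) (at_right t)" by (rule tendsto_within_subset) simp
qed

lemma flow_measurable2 [measurable]: "(\<lambda>(t, x). flow x t) \<in> borel_measurable (borel \<Otimes>\<^sub>M borel)"
proof (rule right_cont_process_measurable)
  show "(\<lambda>x. flow x t) \<in> borel_measurable borel" for t
    by (rule borel_measurable_continuous_onI) (rule flow_continuous_start)
qed (rule right_cont_flow)

lemma flow_measurable [measurable]: "flow x \<in> borel_measurable borel"
  by (intro borel_measurable_continuous_onI flow_continuous)

section \<open>Clocks and pathwise uniqueness\<close>

definition clock :: "(real \<Rightarrow> real ^ 'd) \<Rightarrow> nat \<Rightarrow> real \<Rightarrow> real" where
  "clock x k t = (LBINT s:{0..t}. lam k (x s))"

definition solves_upto :: "(nat \<Rightarrow> real \<Rightarrow> nat) \<Rightarrow> real ^ 'd \<Rightarrow> real \<Rightarrow> (real \<Rightarrow> real ^ 'd) \<Rightarrow> bool" where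
  "solves_upto y x0 T x \<longleftrightarrow> (\<forall>t\<in>{0..T}. x t = x0 + (LBINT s:{0..t}. f (x s)) +
     (\<Sum>k=1..p. real (y k (clock x k t)) *\<^sub>R \<nu> k))"

context
  fixes x :: "real \<Rightarrow> real ^ 'd" assumes x[measurable]: "x \<in> borel_measurable borel"
begin

lemma clock_0 [simp]: "clock x k 0 = 0"
  using norm_integral_Icc_le[of "\<lambda>s. lam k (x s)" R 0 0] norm_lam_le by (simp add: clock_def)

lemma clock_diff:
  assumes "0 \<le> s" "s \<le> t" shows "clock x k t = clock x k s + (LBINT r:{s..t}. lam k (x r))"
  unfolding clock_def using assms norm_lam_le by (intro integral_Icc_split) auto

lemma clock_le:
  assumes "0 \<le> s" "s \<le> t" shows "clock x k t \<le> clock x k s + R * (t - s)"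
  using clock_diff[OF assms, of k] norm_integral_Icc_le[of "\<lambda>r. lam k (x r)" R s t] norm_lam_le assms
  by (auto simp: abs_le_iff)

lemma clock_mono:
  assumes "0 \<le> s" "s \<le> t" shows "clock x k s \<le> clock x k t"
proof -
  have "0 \<le> (LBINT r:{s..t}. lam k (x r))"
    unfolding set_lebesgue_integral_def by (rule integral_nonneg_AE) (auto simp: lam_nonneg)
  then show ?thesis using clock_diff[OF assms] by simp
qed

lemma clock_nonneg: "0 \<le> t \<Longrightarrow> 0 \<le> clock x k t"
  using clock_mono[of 0 t k] by simp

text \<open>A clock advances by at most \<open>R * (s - t)\<close>, so it stays inside the constancy
  interval of its path as long as \<open>s - t < d / (R + 1)\<close>; the \<open>+ 1\<close> covers
  \<open>R = 0\<close>.\<close>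

lemma clock_const_right:
  assumes "\<And>k. k \<in> {1..p} \<Longrightarrow> step_path (y k)" "0 \<le> t"
  shows "\<exists>d>0. \<forall>k\<in>{1..p}. \<forall>s. t \<le> s \<and> s < t + d \<longrightarrow> y k (clock x k s) = y k (clock x k t)"
proof -
  obtain d where d: "d > 0" "\<And>k r. k \<in> {1..p} \<Longrightarrow> clock x k t \<le> r \<Longrightarrow> r < clock x k t + d \<Longrightarrow> y k r = y k (clock x k t)"
    using step_path_const_right[where y=y and p=p and c="\<lambda>k. clock x k t", OF assms(1)] by blast
  show ?thesis
  proof (intro exI[of _ "d / (R + 1)"] conjI ballI allI impI)
    show "d / (R + 1) > 0" using d R_nonneg by simp
    fix k s assume k: "k \<in> {1..p}" and s: "t \<le> s \<and> s < t + d / (R + 1)"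
    have "R * (s - t) \<le> (R + 1) * (s - t)" using s by (intro mult_right_mono) auto
    also have "\<dots> < d" using s R_nonneg by (simp add: field_simps)
    finally show "y k (clock x k s) = y k (clock x k t)"
      using d(2)[OF k, of "clock x k s"] clock_le[of t s k] clock_mono[of t s k] s assms(2) by auto
  qed
qed

end

text \<open>Argument at the first time \<open>t0\<close> of disagreement. Clocks are integrals, so
  they still agree at \<open>t0\<close>, and with them the counts and the positions. Just after
  \<open>t0\<close> the counts of both solutions are frozen, and the Lipschitz drift forces
  agreement on a further interval.\<close>

lemma solves_upto_unique:
  assumes y: "\<And>k. k \<in> {1..p} \<Longrightarrow> step_path (y k)"
    and m[measurable]: "x \<in> borel_measurable borel" "x' \<in> borel_measurable borel"
    and sol: "solves_upto y x0 T x" "solves_upto y x0 T x'"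
    and t: "t \<in> {0..T}"
  shows "x t = x' t"
proof (rule ccontr)
  assume ne: "x t \<noteq> x' t"
  define D where "D = {t\<in>{0..T}. x t \<noteq> x' t}"
  define t0 where "t0 = Inf D"
  have tD: "t \<in> D" using ne t by (simp add: D_def)
  have bdd: "bdd_below D" by (auto simp: D_def bdd_below_def)
  have "t0 \<le> t" unfolding t0_def by (rule cInf_lower[OF tD bdd])
  moreover have "0 \<le> t0" unfolding t0_def using tD by (intro cInf_greatest) (auto simp: D_def)
  ultimately have t0: "0 \<le> t0" "t0 \<le> t" by auto
  have less: "x s = x' s" if "0 \<le> s" "s < t0" for s
  proof (rule ccontr)
    assume "x s \<noteq> x' s"
    then have "s \<in> D" using that t0 t by (simp add: D_def)
    from cInf_lower[OF this bdd] show False using that by (simp add: t0_def)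
  qed
  have int_eq: "(LBINT s:{0..t0}. g (x s)) = (LBINT s:{0..t0}. g (x' s))"
    if [measurable]: "g \<in> borel_measurable borel" for g :: "real ^ 'd \<Rightarrow> 'c :: {banach, second_countable_topology}"
    by (rule integral_Icc_cong_less) (auto simp: less)
  have clock_eq: "clock x k t0 = clock x' k t0" for k
    unfolding clock_def by (rule int_eq) simp
  have at_t0: "x t0 = x' t0"
  proof -
    have "t0 \<in> {0..T}" using t0 t by auto
    then have "x t0 = x0 + (LBINT s:{0..t0}. f (x s)) + (\<Sum>k=1..p. real (y k (clock x k t0)) *\<^sub>R \<nu> k)"
      and "x' t0 = x0 + (LBINT s:{0..t0}. f (x' s)) + (\<Sum>k=1..p. real (y k (clock x' k t0)) *\<^sub>R \<nu> k)"
      using sol unfolding solves_upto_def by blast+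
    then show ?thesis using int_eq[OF f_measurable] clock_eq by simp
  qed
  obtain d where d: "d > 0" "\<And>k s. k \<in> {1..p} \<Longrightarrow> t0 \<le> s \<Longrightarrow> s < t0 + d \<Longrightarrow> y k (clock x k s) = y k (clock x k t0)"
    using clock_const_right[where y=y, OF m(1) y t0(1)] by blast
  obtain d' where d': "d' > 0" "\<And>k s. k \<in> {1..p} \<Longrightarrow> t0 \<le> s \<Longrightarrow> s < t0 + d' \<Longrightarrow> y k (clock x' k s) = y k (clock x' k t0)"
    using clock_const_right[where y=y, OF m(2) y t0(1)] by blast
  \<comment> \<open>On the closed interval of length \<open>h\<close> both systems of counts are
    frozen (hence the halving), and \<open>L * h\<close> is at most 1/2.\<close>
  define h where "h = min (min d d' / 2) (1 / (2 * (L + 1)))"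
  have h: "h > 0" "h < d" "h < d'" "L * h \<le> 1/2"
  proof -
    show "h > 0" "h < d" "h < d'" using d d' L_nonneg by (auto simp: h_def)
    have "L * h \<le> L * (1 / (2 * (L + 1)))" using L_nonneg by (intro mult_left_mono) (auto simp: h_def)
    also have "\<dots> \<le> 1/2" using L_nonneg by (simp add: field_simps)
    finally show "L * h \<le> 1/2" .
  qed
  define I where "I = {s. t0 \<le> s \<and> s \<le> t0 + h \<and> s \<le> T}"
  have t0I: "t0 \<in> I" using h t0 t by (auto simp: I_def)
  have diff: "x s - x' s = (LBINT r:{t0..s}. f (x r) - f (x' r))" if s: "s \<in> I" for s
  proof -
    have loc: "z s = z t0 + (LBINT r:{t0..s}. f (z r))"
      if z[measurable]: "z \<in> borel_measurable borel" and zs: "solves_upto y x0 T z"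
        and c: "\<And>k. k \<in> {1..p} \<Longrightarrow> y k (clock z k s) = y k (clock z k t0)" for z
    proof -
      have "s \<in> {0..T}" "t0 \<in> {0..T}" using s t0 t by (auto simp: I_def)
      then have *: "z s = x0 + (LBINT r:{0..s}. f (z r)) + (\<Sum>k=1..p. real (y k (clock z k s)) *\<^sub>R \<nu> k)"
          "z t0 = x0 + (LBINT r:{0..t0}. f (z r)) + (\<Sum>k=1..p. real (y k (clock z k t0)) *\<^sub>R \<nu> k)"
        using zs unfolding solves_upto_def by blast+
      have "(\<Sum>k=1..p. real (y k (clock z k s)) *\<^sub>R \<nu> k) = (\<Sum>k=1..p. real (y k (clock z k t0)) *\<^sub>R \<nu> k)"
        using c by (intro sum.cong) auto
      moreover have "(LBINT r:{0..s}. f (z r)) = (LBINT r:{0..t0}. f (z r)) + (LBINT r:{t0..s}. f (z r))"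
        using s t0 f_bounded by (intro integral_Icc_split[of _ C]) (auto simp: I_def)
      ultimately show ?thesis using * by simp
    qed
    have "x s = x t0 + (LBINT r:{t0..s}. f (x r))" "x' s = x' t0 + (LBINT r:{t0..s}. f (x' r))"
      by (rule loc[OF m(1) sol(1)] loc[OF m(2) sol(2)], rule d(2) d'(2); use s h in \<open>simp add: I_def\<close>)+
    moreover have "(LBINT r:{t0..s}. f (x r) - f (x' r)) = (LBINT r:{t0..s}. f (x r)) - (LBINT r:{t0..s}. f (x' r))"
      by (intro set_integral_diff bounded_set_integrable_Icc[of _ C]) (auto simp: f_bounded)
    ultimately show ?thesis using at_t0 by simp
  qed
  \<comment> \<open>This supremum is finite because \<open>f\<close> is bounded; the Lipschitz
    estimate then shows that it is at most half of itself.\<close>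
  define m where "m = (SUP s\<in>I. norm (x s - x' s))"
  have ub: "norm (x s - x' s) \<le> 2 * C * h" if "s \<in> I" for s
  proof -
    have "norm (x s - x' s) \<le> (2 * C) * (s - t0)"
      unfolding diff[OF that]
    proof (rule norm_integral_Icc_le)
      show "norm (f (x r) - f (x' r)) \<le> 2 * C" for r
        using norm_triangle_ineq4[of "f (x r)" "f (x' r)"] f_bounded[of "x r"] f_bounded[of "x' r"] by linarith
    qed (use that in \<open>auto simp: I_def\<close>)
    also have "\<dots> \<le> 2 * C * h" using that C_nonneg by (intro mult_left_mono) (auto simp: I_def)
    finally show ?thesis .
  qed
  have bdd2: "bdd_above ((\<lambda>s. norm (x s - x' s)) ` I)" using ub by (auto simp: bdd_above_def)
  have m_ub: "norm (x s - x' s) \<le> m" if "s \<in> I" for s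
    unfolding m_def by (rule cSUP_upper[OF that bdd2])
  have m0: "m \<ge> 0" using m_ub[OF t0I] norm_ge_zero order_trans by blast
  have "norm (x s - x' s) \<le> m / 2" if "s \<in> I" for s
  proof -
    have "norm (x s - x' s) \<le> (L * m) * (s - t0)"
      unfolding diff[OF that]
    proof (rule norm_integral_Icc_le_on)
      show "t0 \<le> s" using that by (simp add: I_def)
      fix r assume "t0 \<le> r" "r \<le> s"
      then have "r \<in> I" using that by (auto simp: I_def)
      then show "norm (f (x r) - f (x' r)) \<le> L * m"
        using f_lipschitz[of "x r" "x' r"] m_ub[of r] L_nonneg by (meson mult_left_mono order_trans)
    qed simp
    also have "\<dots> \<le> (L * m) * h" using that L_nonneg m0 by (intro mult_left_mono) (auto simp: I_def)
    also have "\<dots> \<le> m / 2" using mult_right_mono[OF h(4) m0] by (simp add: ac_simps)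
    finally show ?thesis .
  qed
  then have "(SUP s\<in>I. norm (x s - x' s)) \<le> m / 2" using t0I by (intro cSUP_least) auto
  then have "m \<le> m / 2" by (simp add: m_def[symmetric])
  then have "m = 0" using m0 by simp
  then have eqI: "x s = x' s" if "s \<in> I" for s using m_ub[OF that] by simp
  have "t0 + h \<le> s" if "s \<in> D" for s
  proof (rule ccontr)
    assume "\<not> t0 + h \<le> s"
    then have "s \<in> I" using cInf_lower[OF that bdd] that by (simp add: I_def D_def t0_def)
    from eqI[OF this] show False using that by (simp add: D_def)
  qed
  then have "t0 + h \<le> t0" unfolding t0_def using tD by (intro cInf_greatest) auto
  then show False using h by simp
qed

end

section \<open>Construction and measurability of the solution\<close>

context time_change begin

definition changes :: "(nat \<Rightarrow> real \<Rightarrow> nat) \<Rightarrow> real ^ 'd \<Rightarrow> (nat \<Rightarrow> real) \<Rightarrow> real \<Rightarrow> bool" where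
  "changes y x a s \<longleftrightarrow> (\<exists>k\<in>{1..p}. y k (a k + clock (flow x) k s) \<noteq> y k (a k))"

text \<open>The inserted 1 caps a stage at unit length, which also keeps the infimum meaningful when
  no count ever changes. A stage may therefore end without a jump.\<close>

definition holding_time :: "(nat \<Rightarrow> real \<Rightarrow> nat) \<Rightarrow> real ^ 'd \<Rightarrow> (nat \<Rightarrow> real) \<Rightarrow> real" where
  "holding_time y x a = Inf (insert 1 {s. 0 \<le> s \<and> changes y x a s})"

text \<open>The state consists of time, position and clock readings. Jumps are differences of
  counts, so simultaneous jumps of several paths and capped stages without a jump fall under the
  same formula.\<close>

definition step :: "(nat \<Rightarrow> real \<Rightarrow> nat) \<Rightarrow> real \<times> (real ^ 'd) \<times> (nat \<Rightarrow> real) \<Rightarrow> real \<times> (real ^ 'd) \<times> (nat \<Rightarrow> real)" where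
  "step y = (\<lambda>(t, x, a). let s = holding_time y x a; a' = (\<lambda>k. a k + clock (flow x) k s) in
     (t + s, flow x s + (\<Sum>k=1..p. (real (y k (a' k)) - real (y k (a k))) *\<^sub>R \<nu> k), a'))"

text \<open>The equation adds the counts at clock 0 already at time 0, and a general step path need
  not vanish there; hence the sum in the initial position.\<close>

definition stage :: "(nat \<Rightarrow> real \<Rightarrow> nat) \<Rightarrow> real ^ 'd \<Rightarrow> nat \<Rightarrow> real \<times> (real ^ 'd) \<times> (nat \<Rightarrow> real)" where
  "stage y x0 n = (step y ^^ n) (0, x0 + (\<Sum>k=1..p. real (y k 0) *\<^sub>R \<nu> k), \<lambda>_. 0)"

abbreviation stage_time where "stage_time y x0 n \<equiv> fst (stage y x0 n)"
abbreviation stage_pos where "stage_pos y x0 n \<equiv> fst (snd (stage y x0 n))"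
abbreviation stage_clock where "stage_clock y x0 n \<equiv> snd (snd (stage y x0 n))"

definition stage_index :: "(nat \<Rightarrow> real \<Rightarrow> nat) \<Rightarrow> real ^ 'd \<Rightarrow> real \<Rightarrow> nat" where
  "stage_index y x0 t = (LEAST n. t < stage_time y x0 (Suc n))"

definition solution :: "(nat \<Rightarrow> real \<Rightarrow> nat) \<Rightarrow> real ^ 'd \<Rightarrow> real \<Rightarrow> real ^ 'd" where
  "solution y x0 t = flow (stage_pos y x0 (stage_index y x0 t)) (t - stage_time y x0 (stage_index y x0 t))"

lemma stage_0: "stage y x0 0 = (0, x0 + (\<Sum>k=1..p. real (y k 0) *\<^sub>R \<nu> k), \<lambda>_. 0)"
  by (simp add: stage_def)

lemma stage_Suc:
  "stage_time y x0 (Suc n) = stage_time y x0 n + holding_time y (stage_pos y x0 n) (stage_clock y x0 n)"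
  "stage_clock y x0 (Suc n) = (\<lambda>k. stage_clock y x0 n k + clock (flow (stage_pos y x0 n)) k (holding_time y (stage_pos y x0 n) (stage_clock y x0 n)))"
  "stage_pos y x0 (Suc n) = flow (stage_pos y x0 n) (holding_time y (stage_pos y x0 n) (stage_clock y x0 n)) +
     (\<Sum>k=1..p. (real (y k (stage_clock y x0 (Suc n) k)) - real (y k (stage_clock y x0 n k))) *\<^sub>R \<nu> k)"
  by (simp_all add: stage_def step_def Let_def case_prod_beta)

context
  fixes y :: "nat \<Rightarrow> real \<Rightarrow> nat"
  assumes y: "\<And>k. k \<in> {1..p} \<Longrightarrow> step_path (y k)"
begin

lemma y_mono: "k \<in> {1..p} \<Longrightarrow> s \<le> t \<Longrightarrow> y k s \<le> y k t"
  using y[of k] by (auto simp: step_path_def mono_def)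

lemma changes_mono:
  assumes "changes y x a s" "0 \<le> s" "s \<le> s'" shows "changes y x a s'"
proof -
  obtain k where k: "k \<in> {1..p}" "y k (a k + clock (flow x) k s) \<noteq> y k (a k)"
    using assms by (auto simp: changes_def)
  have "y k (a k) \<le> y k (a k + clock (flow x) k s)" "y k (a k + clock (flow x) k s) \<le> y k (a k + clock (flow x) k s')"
    using clock_nonneg[of "flow x" s k] clock_mono[of "flow x" s s' k] assms by (auto intro!: y_mono k)
  then have "y k (a k + clock (flow x) k s') \<noteq> y k (a k)" using k(2) by simp
  then show ?thesis using k(1) by (auto simp: changes_def)
qed

text \<open>Clocks move at bounded speed and a step path is constant just to the right of any point,
  so unchanged counts stay unchanged a little longer. This makes holding times positive and the
  infimum attained.\<close>

lemma changes_right_open: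
  assumes "\<not> changes y x a s" "0 \<le> s"
  shows "\<exists>d>0. \<forall>s'. 0 \<le> s' \<and> s' < s + d \<longrightarrow> \<not> changes y x a s'"
proof -
  have eq: "y k (a k + clock (flow x) k s) = y k (a k)" if "k \<in> {1..p}" for k
    using assms that by (auto simp: changes_def)
  obtain d where d: "d > 0" "\<And>k r. k \<in> {1..p} \<Longrightarrow> a k + clock (flow x) k s \<le> r \<Longrightarrow> r < a k + clock (flow x) k s + d \<Longrightarrow> y k r = y k (a k + clock (flow x) k s)"
    using step_path_const_right[where y=y and p=p and c="\<lambda>k. a k + clock (flow x) k s", OF y] by blast
  have "\<not> changes y x a s'" if s': "s \<le> s'" "s' < s + d / (R + 1)" for s'
  proof -
    have "R * (s' - s) \<le> (R + 1) * (s' - s)" using s' by (intro mult_right_mono) auto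
    also have "\<dots> < d" using s' R_nonneg by (simp add: field_simps)
    finally have "y k (a k + clock (flow x) k s') = y k (a k + clock (flow x) k s)" if "k \<in> {1..p}" for k
      using d(2)[OF that, of "a k + clock (flow x) k s'"] clock_le[of "flow x" s s' k] clock_mono[of "flow x" s s' k] s' assms(2) by auto
    then show ?thesis using eq by (auto simp: changes_def)
  qed
  moreover have "\<not> changes y x a s'" if "0 \<le> s'" "s' < s" for s'
    using changes_mono[of x a s' s] assms that by auto
  ultimately have "\<forall>s'. 0 \<le> s' \<and> s' < s + d / (R + 1) \<longrightarrow> \<not> changes y x a s'"
    by (meson not_le)
  then show ?thesis using d(1) R_nonneg by (intro exI[of _ "d / (R + 1)"]) auto
qed

lemma not_changes_before_holding_time: "\<not> changes y x a s" if "0 \<le> s" "s < holding_time y x a"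
proof
  assume "changes y x a s"
  then have "holding_time y x a \<le> s" unfolding holding_time_def
    using that by (intro cInf_lower bdd_belowI[of _ 0]) auto
  then show False using that by simp
qed

lemma holding_time_le_1: "holding_time y x a \<le> 1"
  unfolding holding_time_def by (intro cInf_lower bdd_belowI[of _ 0]) auto

lemma holding_time_nonneg: "0 \<le> holding_time y x a"
  unfolding holding_time_def by (intro cInf_greatest) auto

lemma holding_time_pos: "0 < holding_time y x a"
proof -
  have "\<not> changes y x a 0" by (simp add: changes_def)
  then obtain d where d: "d > 0" "\<And>s. 0 \<le> s \<Longrightarrow> s < d \<Longrightarrow> \<not> changes y x a s"
    using changes_right_open[of x a 0] by auto
  have "min d 1 \<le> holding_time y x a" unfolding holding_time_def
    using d by (intro cInf_greatest) (auto simp: not_le[symmetric] min_le_iff_disj)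
  then show ?thesis using d by simp
qed

lemma changes_holding_time:
  assumes "holding_time y x a < 1" shows "changes y x a (holding_time y x a)"
proof (rule ccontr)
  assume "\<not> ?thesis"
  from changes_right_open[OF this holding_time_nonneg] obtain d where
    d: "d > 0" "\<And>s. 0 \<le> s \<Longrightarrow> s < holding_time y x a + d \<Longrightarrow> \<not> changes y x a s" by auto
  have "min 1 (holding_time y x a + d) \<le> Inf (insert 1 {s. 0 \<le> s \<and> changes y x a s})"
    using d(2) by (intro cInf_greatest) (auto simp: not_le[symmetric] min_le_iff_disj)
  then show False using assms d(1) by (simp add: holding_time_def[symmetric] min_def split: if_splits)
qed

text \<open>Trades an infimum over a continuum of times for a condition at the single time
  \<open>s\<close>, the form in which measurability of the holding time is shown.\<close>

lemma holding_time_le_iff: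
  assumes "0 \<le> s" "s < 1" shows "holding_time y x a \<le> s \<longleftrightarrow> changes y x a s"
proof
  assume "holding_time y x a \<le> s"
  then show "changes y x a s"
    using changes_mono[OF changes_holding_time holding_time_nonneg] assms by auto
next
  assume "changes y x a s"
  then show "holding_time y x a \<le> s" using not_changes_before_holding_time[of s x a] assms by force
qed

context
  fixes x0 :: "real ^ 'd"
begin

abbreviation (input) "stime \<equiv> stage_time y x0"
abbreviation (input) "spos \<equiv> stage_pos y x0"
abbreviation (input) "sclock \<equiv> stage_clock y x0"
abbreviation (input) "shold n \<equiv> holding_time y (spos n) (sclock n)"

lemma stage_time_less: "stime n < stime (Suc n)"
  using holding_time_pos by (simp add: stage_Suc)

lemma stage_time_mono: "n \<le> m \<Longrightarrow> stime n \<le> stime m"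
  by (rule lift_Suc_mono_le[of stime]) (auto intro: less_imp_le stage_time_less)

lemma stage_time_nonneg: "0 \<le> stime n"
  using stage_time_mono[of 0 n] by (simp add: stage_0)

lemma stage_clock_bounds: "0 \<le> sclock n k \<and> sclock n k \<le> R * stime n"
proof (induction n)
  case (Suc n)
  have "0 \<le> clock (flow (spos n)) k (shold n)" "clock (flow (spos n)) k (shold n) \<le> R * shold n"
    using clock_nonneg[of "flow (spos n)" "shold n" k] clock_le[of "flow (spos n)" 0 "shold n" k] holding_time_nonneg by auto
  then show ?case using Suc by (simp add: stage_Suc algebra_simps)
qed (simp add: stage_0)

text \<open>Each step either lasts one time unit or raises the total jump count, so the stage times
  cannot accumulate.\<close>

lemma stage_time_count: "real n \<le> stime n + (\<Sum>k=1..p. real (y k (sclock n k)))"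
proof (induction n)
  case (Suc n)
  have mono: "y k (sclock n k) \<le> y k (sclock (Suc n) k)" if "k \<in> {1..p}" for k
    unfolding stage_Suc(2) using that clock_nonneg[of "flow (spos n)" "shold n" k] holding_time_nonneg by (intro y_mono) auto
  show ?case
  proof (cases "shold n < 1")
    case False
    then have "shold n = 1" using holding_time_le_1[of "spos n" "sclock n"] by simp
    moreover have "(\<Sum>k=1..p. real (y k (sclock n k))) \<le> (\<Sum>k=1..p. real (y k (sclock (Suc n) k)))"
      using mono by (intro sum_mono) simp
    ultimately show ?thesis using Suc stage_Suc(1)[of y x0 n] by simp
  next
    case True
    from changes_holding_time[OF this] obtain j where j: "j \<in> {1..p}" "y j (sclock (Suc n) j) \<noteq> y j (sclock n j)"
      by (auto simp: changes_def stage_Suc)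
    have "(\<Sum>k=1..p. y k (sclock n k)) < (\<Sum>k=1..p. y k (sclock (Suc n) k))"
      using mono j by (intro sum_strict_mono_ex1) (auto intro!: bexI[of _ j] simp: le_neq_implies_less)
    then have "(\<Sum>k=1..p. real (y k (sclock n k))) + 1 \<le> (\<Sum>k=1..p. real (y k (sclock (Suc n) k)))"
      unfolding of_nat_sum[symmetric] by linarith
    then show ?thesis using Suc stage_time_less[of n] by simp
  qed
qed (simp add: stage_0 sum_nonneg)

lemma stage_time_unbounded: "\<exists>n. t < stime (Suc n)"
proof (rule ccontr)
  assume "\<not> ?thesis"
  then have le: "stime n \<le> t" for n using stage_time_less[of n] by (meson less_imp_le not_less order_trans)
  \<comment> \<open>Stage times bounded by \<open>t\<close> keep every clock at most
    \<open>R * t\<close>, so the total count in \<open>stage_time_count\<close> stays bounded while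
    \<open>n\<close> grows.\<close>
  obtain n where n: "t + (\<Sum>k=1..p. real (y k (R * t))) < real n" using reals_Archimedean2 by blast
  have "y k (sclock n k) \<le> y k (R * t)" if "k \<in> {1..p}" for k
    using stage_clock_bounds[of n k] mult_left_mono[OF le[of n] R_nonneg] by (intro y_mono that) auto
  then have "(\<Sum>k=1..p. real (y k (sclock n k))) \<le> (\<Sum>k=1..p. real (y k (R * t)))" by (intro sum_mono) simp
  then show False using n stage_time_count[of n] le[of n] by linarith
qed

lemma stage_index_eq:
  assumes "stime n \<le> t" "t < stime (Suc n)" shows "stage_index y x0 t = n"
  unfolding stage_index_def
proof (rule Least_equality)
  fix m assume "t < stime (Suc m)"
  then have "\<not> Suc m \<le> n" using stage_time_mono[of "Suc m" n] assms by auto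
  then show "n \<le> m" by simp
qed fact

lemma stage_exists:
  assumes "0 \<le> t" obtains n where "stime n \<le> t" "t < stime (Suc n)"
proof -
  define n where "n = (LEAST n. t < stime (Suc n))"
  have "t < stime (Suc n)" using LeastI_ex[OF stage_time_unbounded[of t]] by (simp add: n_def)
  moreover have "stime n \<le> t"
  proof (cases n)
    case (Suc m)
    then show ?thesis using not_less_Least[of m "\<lambda>n. t < stime (Suc n)"] by (auto simp: n_def[symmetric])
  qed (use assms in \<open>simp add: stage_0\<close>)
  ultimately show ?thesis using that by blast
qed

lemma solution_eq_flow: "stime n \<le> t \<Longrightarrow> t < stime (Suc n) \<Longrightarrow> solution y x0 t = flow (spos n) (t - stime n)"
  by (simp add: solution_def stage_index_eq)

lemma solution_neg:
  assumes "t \<le> 0" shows "solution y x0 t = solution y x0 0"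
proof -
  have "stage_index y x0 t = 0" unfolding stage_index_def
    using stage_time_less[of 0] stage_time_nonneg[of 0] assms by (intro Least_equality) auto
  moreover have "solution y x0 0 = flow (spos 0) (0 - stime 0)"
    using stage_time_less[of 0] by (intro solution_eq_flow) (auto simp: stage_0)
  ultimately show ?thesis
    using assms flow_clip[of "spos 0" t] by (cases "t = 0") (simp_all add: solution_def stage_0 max_def)
qed

lemma solution_right_cont: "right_cont (solution y x0)"
proof -
  have "(solution y x0 \<longlongrightarrow> solution y x0 t) (at_right t)" if t: "t \<ge> 0" for t
  proof -
    obtain n where n: "stime n \<le> t" "t < stime (Suc n)" using stage_exists[OF t] by blast
    have "continuous_on UNIV (\<lambda>s. flow (spos n) (s - stime n))"
      by (intro continuous_on_compose2[OF flow_continuous] continuous_intros) auto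
    then have "((\<lambda>s. flow (spos n) (s - stime n)) \<longlongrightarrow> flow (spos n) (t - stime n)) (at t)" by (simp add: continuous_on_def)
    then have "((\<lambda>s. flow (spos n) (s - stime n)) \<longlongrightarrow> flow (spos n) (t - stime n)) (at_right t)"
      by (rule tendsto_within_subset) simp
    moreover have "\<forall>\<^sub>F s in at_right t. flow (spos n) (s - stime n) = solution y x0 s"
      using n by (intro eventually_at_rightI[of t "stime (Suc n)"]) (auto intro!: solution_eq_flow[symmetric])
    ultimately show ?thesis using solution_eq_flow[OF n] by (auto intro: Lim_transform_eventually)
  qed
  from right_cont_clip[OF this] have "right_cont (\<lambda>t. solution y x0 (max 0 t))" by simp
  moreover have "solution y x0 (max 0 t) = solution y x0 t" for t
    using solution_neg[of t] by (simp add: max_def)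
  ultimately show ?thesis by simp
qed

lemma solution_measurable [measurable]: "solution y x0 \<in> borel_measurable borel"
  by (rule right_cont_borel_measurable[OF solution_right_cont])

lemma solution_cadlag: "cadlag (solution y x0)"
  unfolding cadlag_def
proof (intro conjI allI impI)
  show "(solution y x0 \<longlongrightarrow> solution y x0 t) (at_right t)" for t
    using solution_right_cont by (simp add: right_cont_def)
  fix t :: real assume t: "0 < t"
  \<comment> \<open>A left limit at a stage boundary belongs to the preceding stage, so the strict
    inequality is moved to the left end.\<close>
  obtain n where n: "stime n < t" "t \<le> stime (Suc n)"
  proof -
    obtain m where m: "stime m \<le> t" "t < stime (Suc m)" using stage_exists[of t] t by auto
    show ?thesis
    proof (cases "stime m = t")
      case False then show ?thesis using m that[of m] by simp
    next
      case True
      then obtain j where "m = Suc j" using t by (cases m) (auto simp: stage_0)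
      then show ?thesis using True stage_time_less[of j] that[of j] by simp
    qed
  qed
  have "continuous_on UNIV (\<lambda>s. flow (spos n) (s - stime n))"
    by (intro continuous_on_compose2[OF flow_continuous] continuous_intros) auto
  then have "((\<lambda>s. flow (spos n) (s - stime n)) \<longlongrightarrow> flow (spos n) (t - stime n)) (at t)" by (simp add: continuous_on_def)
  then have "((\<lambda>s. flow (spos n) (s - stime n)) \<longlongrightarrow> flow (spos n) (t - stime n)) (at_left t)"
    by (rule tendsto_within_subset) simp
  moreover have "\<forall>\<^sub>F s in at_left t. flow (spos n) (s - stime n) = solution y x0 s"
    using n by (intro eventually_at_leftI[of "stime n" t]) (auto intro!: solution_eq_flow[symmetric])
  ultimately show "\<exists>l. (solution y x0 \<longlongrightarrow> l) (at_left t)" by (blast intro: Lim_transform_eventually)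
qed

lemma integral_solution_stage:
  fixes g :: "real ^ 'd \<Rightarrow> 'c :: {banach, second_countable_topology}"
  assumes [measurable]: "g \<in> borel_measurable borel" and "\<And>x. norm (g x) \<le> B"
    and t: "stime n \<le> t" "t \<le> stime (Suc n)"
  shows "(LBINT s:{0..t}. g (solution y x0 s)) = (LBINT s:{0..stime n}. g (solution y x0 s)) + (LBINT s:{0..t - stime n}. g (flow (spos n) s))"
proof -
  have "(LBINT s:{0..t}. g (solution y x0 s)) = (LBINT s:{0..stime n}. g (solution y x0 s)) + (LBINT s:{stime n..t}. g (solution y x0 s))"
    using assms stage_time_nonneg[of n] by (intro integral_Icc_split[of _ B]) auto
  \<comment> \<open>At the right end of the stage the solution may already have jumped; a single
    point does not affect the integral.\<close>
  also have "(LBINT s:{stime n..t}. g (solution y x0 s)) = (LBINT s:{stime n..stime n + (t - stime n)}. g (flow (spos n) (s - stime n)))"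
    using t by (simp, intro integral_Icc_cong_less) (auto simp: solution_eq_flow)
  also have "\<dots> = (LBINT s:{0..t - stime n}. g (flow (spos n) s))"
    using assms by (subst integral_Icc_shift[of _ B]) auto
  finally show ?thesis .
qed

lemma clock_solution_stage:
  assumes "stime n \<le> t" "t \<le> stime (Suc n)"
  shows "clock (solution y x0) k t = clock (solution y x0) k (stime n) + clock (flow (spos n)) k (t - stime n)"
  unfolding clock_def by (rule integral_solution_stage[OF lam_measurable norm_lam_le assms])

text \<open>The readings carried along by the recursion are the integrated rates of the glued path;
  this is why a step can be computed from the current state alone.\<close>

lemma stage_clock_eq: "sclock n k = clock (solution y x0) k (stime n)"
proof (induction n)
  case 0 then show ?case by (simp add: stage_0)
next
  case (Suc n)
  show ?case
    using clock_solution_stage[of n "stime (Suc n)" k] stage_time_less[of n] Suc by (simp add: stage_Suc)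
qed

lemma stage_pos_eq: "spos n = x0 + (LBINT s:{0..stime n}. f (solution y x0 s)) + (\<Sum>k=1..p. real (y k (sclock n k)) *\<^sub>R \<nu> k)"
proof (induction n)
  case 0
  have "(LBINT s:{0..0}. f (solution y x0 s)) = 0"
    using norm_integral_Icc_le[of "\<lambda>s. f (solution y x0 s)" C 0 0] f_bounded by simp
  then show ?case by (simp add: stage_0)
next
  case (Suc n)
  have "(LBINT s:{0..stime (Suc n)}. f (solution y x0 s)) = (LBINT s:{0..stime n}. f (solution y x0 s)) + (LBINT s:{0..shold n}. f (flow (spos n) s))"
    using integral_solution_stage[OF f_measurable f_bounded, of n "stime (Suc n)"] stage_time_less[of n] by (simp add: stage_Suc)
  then show ?case
    unfolding stage_Suc(3)[of y x0 n] flow_eq[OF holding_time_nonneg]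
    using Suc by (simp add: scaleR_diff_left sum_subtractf)
qed

theorem solution_solves: "solves_upto y x0 t (solution y x0)"
  unfolding solves_upto_def
proof
  fix t' assume "t' \<in> {0..t}"
  then have "0 \<le> t'" by simp
  then obtain n where n: "stime n \<le> t'" "t' < stime (Suc n)" by (rule stage_exists)
  have h: "0 \<le> t' - stime n" "t' - stime n < shold n" using n by (auto simp: stage_Suc)
  \<comment> \<open>Until the holding time has elapsed no count changes, so the counts are those at
    the start of the stage.\<close>
  have y_eq: "y k (clock (solution y x0) k t') = y k (sclock n k)" if "k \<in> {1..p}" for k
    using not_changes_before_holding_time[OF h] that clock_solution_stage[of n t' k] n
    by (auto simp: changes_def stage_clock_eq)
  have "solution y x0 t' = spos n + (LBINT s:{0..t' - stime n}. f (flow (spos n) s))"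
    using solution_eq_flow[OF n] flow_eq[OF h(1)] by simp
  also have "\<dots> = x0 + (LBINT s:{0..t'}. f (solution y x0 s)) + (\<Sum>k=1..p. real (y k (sclock n k)) *\<^sub>R \<nu> k)"
    using integral_solution_stage[OF f_measurable f_bounded, of n t'] n stage_pos_eq[of n] by simp
  finally show "solution y x0 t' = x0 + (LBINT s:{0..t'}. f (solution y x0 s)) + (\<Sum>k=1..p. real (y k (clock (solution y x0) k t')) *\<^sub>R \<nu> k)"
    using y_eq by simp
qed

end

end

section \<open>Measurable dependence of the solution on start and driving paths\<close>

lemma clock_flow_measurable [measurable]: "(\<lambda>(s, x). clock (flow x) k s) \<in> borel_measurable (borel \<Otimes>\<^sub>M borel)"
proof -
  have "(\<lambda>z. \<integral>r. (if 0 \<le> r \<and> r \<le> fst z then lam k (case (r, snd z) of (t, x) \<Rightarrow> flow x t) else 0) \<partial>lborel) \<in> borel_measurable (borel \<Otimes>\<^sub>M borel)"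
    by (rule lborel.borel_measurable_lebesgue_integral) measurable
  moreover have "(\<lambda>(s, x). clock (flow x) k s) = (\<lambda>z. \<integral>r. (if 0 \<le> r \<and> r \<le> fst z then lam k (case (r, snd z) of (t, x) \<Rightarrow> flow x t) else 0) \<partial>lborel)"
    unfolding clock_def set_lebesgue_integral_def
    by (auto simp: fun_eq_iff indicator_def intro!: Bochner_Integration.integral_cong)
  ultimately show ?thesis by simp
qed

context
  fixes N :: "'w measure" and Y :: "nat \<Rightarrow> real \<Rightarrow> 'w \<Rightarrow> nat" and X0 :: "'w \<Rightarrow> real ^ 'd"
  assumes Y: "\<And>k \<omega>. k \<in> {1..p} \<Longrightarrow> \<omega> \<in> space N \<Longrightarrow> step_path (\<lambda>t. Y k t \<omega>)"
    and Y_meas: "\<And>k t. k \<in> {1..p} \<Longrightarrow> Y k t \<in> measurable N (count_space UNIV)"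
    and X0 [measurable]: "X0 \<in> borel_measurable N"
begin

text \<open>Clocks are random times, and a path read at a random time is measurable because
  right-continuity makes the count jointly measurable in time and \<open>\<omega>\<close>.\<close>

lemma Y_joint_measurable:
  assumes k: "k \<in> {1..p}" and [measurable]: "a \<in> borel_measurable N"
  shows "(\<lambda>\<omega>. real (Y k (a \<omega>) \<omega>)) \<in> borel_measurable N"
proof -
  have "(\<lambda>(t, \<omega>). real (Y k t \<omega>)) \<in> borel_measurable (borel \<Otimes>\<^sub>M N)"
  proof (rule right_cont_process_measurable)
    show "(\<lambda>\<omega>. real (Y k t \<omega>)) \<in> borel_measurable N" for t
      using Y_meas[OF k] by measurable
    fix \<omega> assume "\<omega> \<in> space N"
    from Y[OF k this] show "right_cont (\<lambda>t. real (Y k t \<omega>))"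
      unfolding step_path_def right_cont_def by (auto intro!: tendsto_eventually elim: eventually_mono)
  qed
  from measurable_compose[OF _ this, of "\<lambda>\<omega>. (a \<omega>, \<omega>)" N] show ?thesis by simp
qed

lemma holding_time_measurable:
  assumes [measurable]: "x \<in> borel_measurable N" "\<And>k. (\<lambda>\<omega>. a \<omega> k) \<in> borel_measurable N"
  shows "(\<lambda>\<omega>. holding_time (\<lambda>k t. Y k t \<omega>) (x \<omega>) (a \<omega>)) \<in> borel_measurable N"
  unfolding borel_measurable_iff_le
proof
  fix s :: real
  let ?h = "\<lambda>\<omega>. holding_time (\<lambda>k t. Y k t \<omega>) (x \<omega>) (a \<omega>)"
  \<comment> \<open>The outer cases are settled by the bounds 0 and 1 on holding times; in the
    middle one the infimum reduces to counts at fixed clock readings.\<close>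
  consider "s < 0" | "0 \<le> s \<and> s < 1" | "1 \<le> s" by linarith
  then show "{\<omega> \<in> space N. ?h \<omega> \<le> s} \<in> sets N"
  proof cases
    case 1
    then have "{\<omega> \<in> space N. ?h \<omega> \<le> s} = {}"
      using holding_time_nonneg[of "\<lambda>k t. Y k t _", OF Y] by (auto simp: not_le intro: less_le_trans)
    then show ?thesis by (metis sets.empty_sets)
  next
    case 3
    then have "{\<omega> \<in> space N. ?h \<omega> \<le> s} = space N"
      using holding_time_le_1[of "\<lambda>k t. Y k t _", OF Y] by (auto intro: order_trans)
    then show ?thesis by simp
  next
    case 2
    have [measurable]: "(\<lambda>\<omega>. clock (flow (x \<omega>)) k s) \<in> borel_measurable N" for k
      using measurable_compose[OF _ clock_flow_measurable, of "\<lambda>\<omega>. (s, x \<omega>)" N k] by simp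
    have m1: "(\<lambda>\<omega>. real (Y k (a \<omega> k + clock (flow (x \<omega>)) k s) \<omega>)) \<in> borel_measurable N"
      and m2: "(\<lambda>\<omega>. real (Y k (a \<omega> k) \<omega>)) \<in> borel_measurable N" if "k \<in> {1..p}" for k
      using that by (auto intro!: Y_joint_measurable)
    have "{\<omega> \<in> space N. ?h \<omega> \<le> s} = {\<omega> \<in> space N. changes (\<lambda>k t. Y k t \<omega>) (x \<omega>) (a \<omega>) s}"
      using holding_time_le_iff[of "\<lambda>k t. Y k t _", OF Y] 2 by auto
    also have "\<dots> = (\<Union>k\<in>{1..p}. {\<omega> \<in> space N. real (Y k (a \<omega> k + clock (flow (x \<omega>)) k s) \<omega>) \<noteq> real (Y k (a \<omega> k) \<omega>)})"
      by (auto simp: changes_def)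
    also have "\<dots> \<in> sets N"
      by (intro sets.finite_UN borel_measurable_neq m1 m2) auto
    finally show ?thesis .
  qed
qed

lemma stage_measurable:
  "(\<lambda>\<omega>. stage_time (\<lambda>k t. Y k t \<omega>) (X0 \<omega>) n) \<in> borel_measurable N \<and>
   (\<lambda>\<omega>. stage_pos (\<lambda>k t. Y k t \<omega>) (X0 \<omega>) n) \<in> borel_measurable N \<and>
   (\<forall>k. (\<lambda>\<omega>. stage_clock (\<lambda>k t. Y k t \<omega>) (X0 \<omega>) n k) \<in> borel_measurable N)"
proof (induction n)
  case 0
  have [measurable]: "(\<lambda>\<omega>. real (Y k 0 \<omega>)) \<in> borel_measurable N" if "k \<in> {1..p}" for k
    using Y_meas[OF that] by measurable
  show ?case by (auto simp: stage_0 intro!: borel_measurable_add borel_measurable_sum borel_measurable_scaleR)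
next
  case (Suc n)
  let ?y = "\<lambda>\<omega> k t. Y k t \<omega>"
  have [measurable]: "(\<lambda>\<omega>. stage_time (?y \<omega>) (X0 \<omega>) n) \<in> borel_measurable N"
   "(\<lambda>\<omega>. stage_pos (?y \<omega>) (X0 \<omega>) n) \<in> borel_measurable N"
   "\<And>k. (\<lambda>\<omega>. stage_clock (?y \<omega>) (X0 \<omega>) n k) \<in> borel_measurable N"
    using Suc by auto
  define h where "h \<omega> = holding_time (?y \<omega>) (stage_pos (?y \<omega>) (X0 \<omega>) n) (stage_clock (?y \<omega>) (X0 \<omega>) n)" for \<omega>
  have [measurable]: "h \<in> borel_measurable N" unfolding h_def by (rule holding_time_measurable) measurable
  have [measurable]: "(\<lambda>\<omega>. clock (flow (stage_pos (?y \<omega>) (X0 \<omega>) n)) k (h \<omega>)) \<in> borel_measurable N" for k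
    using measurable_compose[OF _ clock_flow_measurable, of "\<lambda>\<omega>. (h \<omega>, stage_pos (?y \<omega>) (X0 \<omega>) n)" N k] by simp
  have [measurable]: "(\<lambda>\<omega>. flow (stage_pos (?y \<omega>) (X0 \<omega>) n) (h \<omega>)) \<in> borel_measurable N"
    using measurable_compose[OF _ flow_measurable2, of "\<lambda>\<omega>. (h \<omega>, stage_pos (?y \<omega>) (X0 \<omega>) n)" N] by simp
  have clk: "(\<lambda>\<omega>. stage_clock (?y \<omega>) (X0 \<omega>) (Suc n) k) \<in> borel_measurable N" for k
    unfolding stage_Suc h_def[symmetric] by measurable
  have tm: "(\<lambda>\<omega>. stage_time (?y \<omega>) (X0 \<omega>) (Suc n)) \<in> borel_measurable N"
    unfolding stage_Suc h_def[symmetric] by measurable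
  have "(\<lambda>\<omega>. stage_pos (?y \<omega>) (X0 \<omega>) (Suc n)) \<in> borel_measurable N"
    unfolding stage_Suc(3) h_def[symmetric]
    by (intro borel_measurable_add borel_measurable_sum borel_measurable_scaleR borel_measurable_diff Y_joint_measurable clk) measurable
  then show ?case using clk tm by blast
qed

text \<open>The sigma-algebra \<open>N\<close> is left free for two uses: with the events of the
  probability space it makes the solution a random variable, and with a history and frozen paths it
  makes the solution depend on the past only.\<close>

theorem solution_random_measurable: "(\<lambda>\<omega>. solution (\<lambda>k t. Y k t \<omega>) (X0 \<omega>) t) \<in> borel_measurable N"
proof -
  let ?y = "\<lambda>\<omega> k t. Y k t \<omega>"
  have [measurable]: "(\<lambda>\<omega>. stage_time (?y \<omega>) (X0 \<omega>) n) \<in> borel_measurable N"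
   "(\<lambda>\<omega>. stage_pos (?y \<omega>) (X0 \<omega>) n) \<in> borel_measurable N" for n
    using stage_measurable by auto
  have [measurable]: "(\<lambda>\<omega>. stage_index (?y \<omega>) (X0 \<omega>) t) \<in> measurable N (count_space UNIV)"
    unfolding stage_index_def by measurable
  show ?thesis unfolding solution_def
  proof (rule measurable_compose_countable[where f="\<lambda>n \<omega>. flow (stage_pos (?y \<omega>) (X0 \<omega>) n) (t - stage_time (?y \<omega>) (X0 \<omega>) n)"])
    fix n show "(\<lambda>\<omega>. flow (stage_pos (?y \<omega>) (X0 \<omega>) n) (t - stage_time (?y \<omega>) (X0 \<omega>) n)) \<in> borel_measurable N"
      using measurable_compose[OF _ flow_measurable2, of "\<lambda>\<omega>. (t - stage_time (?y \<omega>) (X0 \<omega>) n, stage_pos (?y \<omega>) (X0 \<omega>) n)" N] by simp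
  qed measurable
qed

end

end

section \<open>Independence of past and increments\<close>

text \<open>Moving the factor \<open>exp (- r)\<close> of the Poisson weights to the other side lets
  moments be read off the exponential series; nonnegativity of \<open>g\<close> turns convergence of
  the series into integrability.\<close>

lemma poisson_expectation_sums:
  assumes r: "0 < r" and g: "\<And>n. 0 \<le> g n" and s: "(\<lambda>n. g n * (r ^ n / fact n)) sums (c * exp r)"
  shows "integrable (measure_pmf (poisson_pmf r)) g" "measure_pmf.expectation (poisson_pmf r) g = c"
proof -
  have s2: "(\<lambda>n. pmf (poisson_pmf r) n * g n) sums c"
    using sums_mult2[OF s, of "exp (- r)"] r by (simp add: pmf_poisson ac_simps exp_minus)
  have i: "integrable (count_space UNIV) (\<lambda>n. pmf (poisson_pmf r) n * g n)"
    unfolding integrable_count_space_nat_iff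
    using s2 g by (simp add: abs_mult sums_iff del: pmf_poisson)
  show "integrable (measure_pmf (poisson_pmf r)) g"
    unfolding measure_pmf_eq_density using i by (subst integrable_density) auto
  have "measure_pmf.expectation (poisson_pmf r) g = (\<integral>n. pmf (poisson_pmf r) n * g n \<partial>count_space UNIV)"
    unfolding measure_pmf_eq_density by (subst integral_density) auto
  also have "\<dots> = c" using integral_count_space_nat[OF i] s2 by (simp add: sums_iff del: pmf_poisson)
  finally show "measure_pmf.expectation (poisson_pmf r) g = c" .
qed

lemma poisson_mean_sums: "(\<lambda>n. real n * (r ^ n / fact n)) sums (r * exp (r :: real))"
proof -
  have "(\<lambda>n. r * (r ^ n / fact n)) sums (r * exp r)"
    using sums_mult[OF exp_converges[of r], of r] by (simp add: divide_inverse ac_simps)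
  then have "(\<lambda>n. real (Suc n) * (r ^ Suc n / fact (Suc n))) sums (r * exp r)"
    by (simp add: field_simps del: of_nat_Suc)
  then show ?thesis by (subst (asm) sums_Suc_iff) simp
qed

lemma poisson_factorial_moment_sums: "(\<lambda>n. (real n * (real n - 1)) * (r ^ n / fact n)) sums (r\<^sup>2 * exp (r :: real))"
proof -
  have "(\<lambda>n. r\<^sup>2 * (r ^ n / fact n)) sums (r\<^sup>2 * exp r)"
    using sums_mult[OF exp_converges[of r], of "r\<^sup>2"] by (simp add: divide_inverse ac_simps)
  \<comment> \<open>The first two terms of the series vanish; after a shift by two the factors
    \<open>n (n - 1)\<close> cancel against the factorial.\<close>
  moreover have "real (Suc (Suc n)) * (real (Suc (Suc n)) - 1) * (r ^ Suc (Suc n) / fact (Suc (Suc n))) = r\<^sup>2 * (r ^ n / fact n)" for n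
  proof -
    have *: "(m + 1) * ((m + 1) - 1) * (r ^ Suc (Suc n) / ((m + 1) * (m * F))) = r\<^sup>2 * (r ^ n / F)" if "m > 0" for m F :: real
      using that by (simp add: power2_eq_square)
    show ?thesis using *[of "real (Suc n)" "fact n"] by (simp add: fact_Suc[of "Suc n"] fact_Suc[of n] del: fact_Suc)
  qed
  ultimately have "(\<lambda>n. real (Suc (Suc n)) * (real (Suc (Suc n)) - 1) * (r ^ Suc (Suc n) / fact (Suc (Suc n)))) sums (r\<^sup>2 * exp r)"
    by (simp only:)
  then have "(\<lambda>n. real (Suc n) * (real (Suc n) - 1) * (r ^ Suc n / fact (Suc n))) sums (r\<^sup>2 * exp r)"
    by (subst (asm) sums_Suc_iff) simp
  then show ?thesis by (subst (asm) sums_Suc_iff) simp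
qed

lemma (in prob_space) indep_set_mono:
  assumes "indep_set A B" "A' \<subseteq> A" "B' \<subseteq> B" shows "indep_set A' B'"
  using assms unfolding indep_sets2_eq by blast

text \<open>Independence of increments is available for increasing sequences of times, so a finite
  set of past times has to be sorted, with a later time appended as the last node.\<close>

lemma sorted_enumeration_below:
  fixes S :: "real set"
  assumes "finite S" "S \<noteq> {}" "\<And>x. x \<in> S \<Longrightarrow> x < b"
  obtains r n where "strict_mono_on {..Suc n} r" "r ` {..n} = S" "r (Suc n) = b" "r 0 = Min S" "r n = Max S"
proof -
  define xs where "xs = sorted_list_of_set S"
  have xs: "sorted_wrt (<) xs" "set xs = S" "xs \<noteq> []"
    using assms by (auto simp: xs_def strict_sorted_list_of_set)
  define n where "n = length xs - 1"
  define r where "r i = (if i < length xs then xs ! i else b)" for i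
  have len: "length xs = Suc n" using xs by (simp add: n_def)
  have mono: "strict_mono_on {..Suc n} r"
  proof (rule strict_mono_onI)
    fix i j assume ij: "i \<in> {..Suc n}" "j \<in> {..Suc n}" "i < j"
    show "r i < r j"
    proof (cases "j < length xs")
      case True then show ?thesis using sorted_wrt_nth_less[OF xs(1), of i j] ij by (simp add: r_def)
    next
      case False
      then have "i < length xs" using ij len by simp
      then show ?thesis using False assms(3)[of "xs ! i"] xs(2) nth_mem[of i xs] by (simp add: r_def)
    qed
  qed
  have img: "r ` {..n} = S"
  proof -
    have "r ` {..n} = (!) xs ` {..<length xs}" unfolding len lessThan_Suc_atMost by (intro image_cong) (auto simp: r_def len)
    also have "\<dots> = set xs" by (auto simp: in_set_conv_nth)
    finally show ?thesis using xs by simp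
  qed
  have le: "r i \<le> r j" if "i \<le> j" "j \<le> n" for i j
    using strict_mono_onD[OF mono, of i j] that by (cases "i = j") auto
  have "r 0 = Min S" using assms(1) img le by (intro Min_eqI[symmetric]) auto
  moreover have "r n = Max S" using assms(1) img le by (intro Max_eqI[symmetric]) auto
  ultimately show ?thesis using that mono img by (simp add: r_def len)
qed

text \<open>Every path is a step path that vanishes up to time 0, without exceptional null sets. The
  joint independence of \<open>X0\<close> and the paths is recorded as a product formula on
  rectangles, the form in which it meets the cylinder events below.\<close>

locale poisson_family = prob_space M for M :: "'w measure" +
  fixes p :: nat and Y :: "nat \<Rightarrow> real \<Rightarrow> 'w \<Rightarrow> nat" and X0 :: "'w \<Rightarrow> 'e :: euclidean_space"
  assumes Y_step: "\<And>k \<omega>. k \<in> {1..p} \<Longrightarrow> step_path (\<lambda>t. Y k t \<omega>)"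
    and Y_nonpos: "\<And>k t \<omega>. k \<in> {1..p} \<Longrightarrow> t \<le> 0 \<Longrightarrow> Y k t \<omega> = 0"
    and Y_measurable: "\<And>k t. k \<in> {1..p} \<Longrightarrow> Y k t \<in> measurable M (count_space UNIV)"
    and X0_measurable [measurable]: "X0 \<in> borel_measurable M"
    and product: "\<And>B E. B \<in> sets borel \<Longrightarrow> (\<And>k. k \<in> {1..p} \<Longrightarrow> E k \<in> sets path_space) \<Longrightarrow>
        prob {\<omega>\<in>space M. X0 \<omega> \<in> B \<and> (\<forall>k\<in>{1..p}. path_of (Y k) \<omega> \<in> E k)} =
        prob {\<omega>\<in>space M. X0 \<omega> \<in> B} * (\<Prod>k=1..p. prob {\<omega>\<in>space M. path_of (Y k) \<omega> \<in> E k})"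
    and increments_indep: "\<And>k n r. k \<in> {1..p} \<Longrightarrow> 0 \<le> r 0 \<Longrightarrow> strict_mono_on {..n::nat} r \<Longrightarrow>
        indep_vars (\<lambda>_. count_space UNIV) (\<lambda>i \<omega>. Y k (r (Suc i)) \<omega> - Y k (r i) \<omega>) {..<n}"
    and increments_distr: "\<And>k s t. k \<in> {1..p} \<Longrightarrow> 0 \<le> s \<Longrightarrow> s < t \<Longrightarrow>
        distr M (count_space UNIV) (\<lambda>\<omega>. Y k t \<omega> - Y k s \<omega>) = measure_pmf (poisson_pmf (t - s))"
begin

lemma Y_mono: "k \<in> {1..p} \<Longrightarrow> s \<le> t \<Longrightarrow> Y k s \<omega> \<le> Y k t \<omega>"
  using Y_step[of k \<omega>] by (auto simp: step_path_def mono_def)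

section \<open>Cylinder events and the increments of a single path\<close>

definition cylinder :: "real set \<Rightarrow> (real \<Rightarrow> nat set) \<Rightarrow> (real \<Rightarrow> nat) set" where
  "cylinder Q S = {\<phi>\<in>space path_space. \<forall>r\<in>Q. \<phi> r \<in> S r}"

lemma path_component_measurable: "0 \<le> r \<Longrightarrow> (\<lambda>\<phi>. \<phi> r) \<in> measurable path_space (count_space UNIV)"
  unfolding path_space_def by (rule measurable_component_singleton) simp

lemma cylinder_sets:
  assumes "finite Q" "Q \<subseteq> {0..}" shows "cylinder Q S \<in> sets path_space"
proof -
  have "{\<phi>\<in>space path_space. \<phi> r \<in> S r} \<in> sets path_space" if "r \<in> Q" for r
  proof -
    have "(\<lambda>\<phi>. \<phi> r) -` S r \<inter> space path_space \<in> sets path_space"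
      using path_component_measurable[of r] assms that by (intro measurable_sets[of _ path_space "count_space UNIV"]) auto
    also have "(\<lambda>\<phi>. \<phi> r) -` S r \<inter> space path_space = {\<phi>\<in>space path_space. \<phi> r \<in> S r}" by auto
    finally show ?thesis .
  qed
  then show ?thesis unfolding cylinder_def using assms(1) by (intro sets.sets_Collect_finite_All) auto
qed

lemma path_of_in_space: "path_of (Y k) \<omega> \<in> space path_space"
  by (auto simp: path_of_def path_space_def space_PiM)

lemma path_of_in_cylinder: "Q \<subseteq> {0..} \<Longrightarrow> path_of (Y k) \<omega> \<in> cylinder Q S \<longleftrightarrow> (\<forall>r\<in>Q. Y k r \<omega> \<in> S r)"
  using path_of_in_space by (auto simp: cylinder_def path_of_def subset_eq)

definition window :: "real \<Rightarrow> real \<Rightarrow> nat set \<Rightarrow> (real \<Rightarrow> nat) set" where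
  "window a b S = {\<phi>\<in>space path_space. \<phi> b - \<phi> a \<in> S}"

lemma window_sets:
  assumes "0 \<le> a" "0 \<le> b" shows "window a b S \<in> sets path_space"
proof -
  have [measurable]: "(\<lambda>\<phi>. \<phi> a) \<in> measurable path_space (count_space UNIV)" "(\<lambda>\<phi>. \<phi> b) \<in> measurable path_space (count_space UNIV)"
    using assms by (auto intro: path_component_measurable)
  show ?thesis unfolding window_def by measurable
qed

lemma path_of_in_window: "0 \<le> a \<Longrightarrow> 0 \<le> b \<Longrightarrow> path_of (Y k) \<omega> \<in> window a b S \<longleftrightarrow> Y k b \<omega> - Y k a \<omega> \<in> S"
  using path_of_in_space by (auto simp: window_def path_of_def)

text \<open>Values at past times are partial sums of increments over the sorted times, so they are
  functions of the increments preceding the last one, and the last one is the window.\<close>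

lemma single_window_indep:
  assumes k: "k \<in> {1..p}" and Q: "finite Q" "Q \<subseteq> {0..a}" and ab: "0 \<le> a" "a < b"
  shows "prob {\<omega>\<in>space M. (\<forall>r\<in>Q. Y k r \<omega> \<in> S r) \<and> Y k b \<omega> - Y k a \<omega> \<in> S'} =
    prob {\<omega>\<in>space M. \<forall>r\<in>Q. Y k r \<omega> \<in> S r} * prob {\<omega>\<in>space M. Y k b \<omega> - Y k a \<omega> \<in> S'}"
proof -
  \<comment> \<open>Time 0, where the path vanishes, turns values into sums of increments; time
    \<open>a\<close> makes the last increment start exactly there.\<close>
  define Q' where "Q' = insert 0 (insert a Q)"
  have Q': "finite Q'" "Q' \<noteq> {}" "\<And>x. x \<in> Q' \<Longrightarrow> x < b" "Min Q' = 0" "Max Q' = a"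
  proof -
    show "finite Q'" "Q' \<noteq> {}" "\<And>x. x \<in> Q' \<Longrightarrow> x < b" using Q ab by (auto simp: Q'_def)
    show "Min Q' = 0" using Q ab by (intro Min_eqI) (auto simp: Q'_def)
    show "Max Q' = a" using Q ab by (intro Max_eqI) (auto simp: Q'_def)
  qed
  obtain r n where r: "strict_mono_on {..Suc n} r" "r ` {..n} = Q'" "r (Suc n) = b" "r 0 = 0" "r n = a"
    using sorted_enumeration_below[OF Q'(1-3)] Q'(4,5) by metis
  define D where "D i \<omega> = Y k (r (Suc i)) \<omega> - Y k (r i) \<omega>" for i \<omega>
  have ind: "indep_vars (\<lambda>_. count_space UNIV) D {..<Suc n}"
    unfolding D_def by (rule increments_indep[OF k _ r(1)]) (simp add: r)
  have Yr: "Y k (r i) \<omega> = (\<Sum>l<i. D l \<omega>)" if "i \<le> n" for i \<omega>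
    using that
  proof (induction i)
    case 0 then show ?case using Y_nonpos[OF k, of 0] r by simp
  next
    case (Suc i)
    have "r i < r (Suc i)" using strict_mono_onD[OF r(1), of i "Suc i"] Suc by simp
    then have "Y k (r i) \<omega> \<le> Y k (r (Suc i)) \<omega>" by (intro Y_mono k) simp
    then show ?case using Suc by (simp add: D_def)
  qed
  let ?P1 = "PiM {..<n} (\<lambda>_. count_space UNIV) :: (nat \<Rightarrow> nat) measure"
  let ?P2 = "PiM {n} (\<lambda>_. count_space UNIV) :: (nat \<Rightarrow> nat) measure"
  define U where "U = {g\<in>space ?P1. \<forall>i\<in>{i. i \<le> n \<and> r i \<in> Q}. (\<Sum>l<i. g l) \<in> S (r i)}"
  define V where "V = {g\<in>space ?P2. g n \<in> S'}"
  have iv: "indep_var ?P1 (\<lambda>\<omega>. \<lambda>i\<in>{..<n}. D i \<omega>) ?P2 (\<lambda>\<omega>. \<lambda>i\<in>{n}. D i \<omega>)"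
    by (rule indep_var_restrict[OF ind]) auto
  have U: "U \<in> sets ?P1"
    unfolding U_def
  proof (rule sets.sets_Collect_finite_All)
    fix i assume i: "i \<in> {i. i \<le> n \<and> r i \<in> Q}"
    have "(\<lambda>g. \<Sum>l<i. g l) \<in> measurable ?P1 (count_space UNIV)"
      using i by (intro measurable_sum_nat) (auto intro!: measurable_component_singleton)
    from measurable_sets[OF this, of "S (r i)"]
    show "{g \<in> space ?P1. (\<Sum>l<i. g l) \<in> S (r i)} \<in> sets ?P1" by (simp add: vimage_def Int_def conj_commute)
  qed simp
  have V: "V \<in> sets ?P2"
    using measurable_sets[OF measurable_component_singleton[of n "{n}" "\<lambda>_. count_space UNIV"], of S']
    unfolding V_def by (simp add: vimage_def Int_def conj_commute)
  have Ueq: "(\<lambda>i\<in>{..<n}. D i \<omega>) \<in> U \<longleftrightarrow> (\<forall>r\<in>Q. Y k r \<omega> \<in> S r)" for \<omega>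
  proof -
    have "(\<lambda>i\<in>{..<n}. D i \<omega>) \<in> U \<longleftrightarrow> (\<forall>i\<in>{i. i \<le> n \<and> r i \<in> Q}. (\<Sum>l<i. (\<lambda>i\<in>{..<n}. D i \<omega>) l) \<in> S (r i))"
      by (auto simp: U_def space_PiM)
    also have "\<dots> \<longleftrightarrow> (\<forall>i\<in>{i. i \<le> n \<and> r i \<in> Q}. Y k (r i) \<omega> \<in> S (r i))"
      by (intro ball_cong refl) (auto simp: Yr)
    also have "\<dots> \<longleftrightarrow> (\<forall>r\<in>Q. Y k r \<omega> \<in> S r)"
    proof -
      have "Q = r ` {i. i \<le> n \<and> r i \<in> Q}" using r(2) by (auto simp: Q'_def)
      then have "(\<forall>r\<in>Q. Y k r \<omega> \<in> S r) \<longleftrightarrow> (\<forall>r\<in>r ` {i. i \<le> n \<and> r i \<in> Q}. Y k r \<omega> \<in> S r)" by simp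
      then show ?thesis by simp
    qed
    finally show ?thesis .
  qed
  have Veq: "(\<lambda>i\<in>{n}. D i \<omega>) \<in> V \<longleftrightarrow> Y k b \<omega> - Y k a \<omega> \<in> S'" for \<omega>
    by (auto simp: V_def space_PiM D_def r)
  show ?thesis
    using indep_varD[OF iv U V] by (simp add: vimage_def Int_def Ueq Veq conj_ac)
qed

section \<open>Histories with one horizon per path\<close>

definition past :: "(nat \<Rightarrow> real) \<Rightarrow> 'w set set" where
  "past a = {{\<omega>\<in>space M. X0 \<omega> \<in> B \<and> (\<forall>k\<in>{1..p}. \<forall>r\<in>Q k. Y k r \<omega> \<in> S k r)} | B Q S.
     B \<in> sets borel \<and> (\<forall>k. finite (Q k) \<and> Q k \<subseteq> {0..a k})}"

text \<open>The generators \<open>past a\<close> are kept as a family of their own because they are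
  stable under intersection: independence can be checked on them by product formulas and then
  extended.\<close>

definition hist :: "(nat \<Rightarrow> real) \<Rightarrow> 'w measure" where
  "hist a = sigma (space M) (past a)"

lemma past_Pow: "past a \<subseteq> Pow (space M)"
  by (auto simp: past_def)

lemma space_hist [simp]: "space (hist a) = space M"
  unfolding hist_def by (rule space_measure_of[OF past_Pow])

lemma sets_hist: "sets (hist a) = sigma_sets (space M) (past a)"
  unfolding hist_def by (rule sets_measure_of[OF past_Pow])

lemma past_events: "past a \<subseteq> events"
proof
  fix A assume "A \<in> past a"
  then obtain B Q S where A: "A = {\<omega>\<in>space M. X0 \<omega> \<in> B \<and> (\<forall>k\<in>{1..p}. \<forall>r\<in>Q k. Y k r \<omega> \<in> S k r)}"
    "B \<in> sets borel" "\<And>k. finite (Q k)" by (auto simp: past_def)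
  have "{\<omega>\<in>space M. Y k r \<omega> \<in> S k r} \<in> events" if "k \<in> {1..p}" for k r
    using measurable_sets[OF Y_measurable[OF that, of r], of "S k r"] by (simp add: vimage_def Int_def conj_commute)
  then have "{\<omega>\<in>space M. \<forall>k\<in>{1..p}. \<forall>r\<in>Q k. Y k r \<omega> \<in> S k r} \<in> events"
    using A(3) by (intro sets.sets_Collect_finite_All) auto
  moreover have "{\<omega>\<in>space M. X0 \<omega> \<in> B} \<in> events" using A(2) by measurable
  ultimately have "{\<omega>\<in>space M. X0 \<omega> \<in> B} \<inter> {\<omega>\<in>space M. \<forall>k\<in>{1..p}. \<forall>r\<in>Q k. Y k r \<omega> \<in> S k r} \<in> events" by blast
  moreover have "A = {\<omega>\<in>space M. X0 \<omega> \<in> B} \<inter> {\<omega>\<in>space M. \<forall>k\<in>{1..p}. \<forall>r\<in>Q k. Y k r \<omega> \<in> S k r}"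
    unfolding A(1) by auto
  ultimately show "A \<in> events" by simp
qed

lemma hist_subset_events: "sets (hist a) \<subseteq> events"
  unfolding sets_hist by (rule sets.sigma_sets_subset[OF past_events])

lemma hist_subalgebra: "subalgebra M (hist a)"
  using hist_subset_events by (simp add: subalgebra_def)

lemma hist_mono:
  assumes "\<And>k. k \<in> {1..p} \<Longrightarrow> a k \<le> b k" shows "sets (hist a) \<subseteq> sets (hist b)"
proof -
  have "past a \<subseteq> past b"
  proof
    fix A assume "A \<in> past a"
    then obtain B Q S where A: "A = {\<omega>\<in>space M. X0 \<omega> \<in> B \<and> (\<forall>k\<in>{1..p}. \<forall>r\<in>Q k. Y k r \<omega> \<in> S k r)}"
      "B \<in> sets borel" "\<And>k. finite (Q k) \<and> Q k \<subseteq> {0..a k}" by (auto simp: past_def)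
    \<comment> \<open>\<open>past\<close> restricts the times of every index, while horizons are
      compared for \<open>k \<in> {1..p}\<close> only; the remaining indices are given no
      times.\<close>
    define Q' where "Q' k = (if k \<in> {1..p} then Q k else {})" for k
    have "finite (Q' k) \<and> Q' k \<subseteq> {0..b k}" for k
      using A(3)[of k] assms[of k] by (auto simp: Q'_def)
    moreover have "A = {\<omega>\<in>space M. X0 \<omega> \<in> B \<and> (\<forall>k\<in>{1..p}. \<forall>r\<in>Q' k. Y k r \<omega> \<in> S k r)}"
      unfolding A(1) Q'_def by simp
    ultimately show "A \<in> past b" using A(2) unfolding past_def by blast
  qed
  then show ?thesis unfolding sets_hist by (rule sigma_sets_mono')
qed

lemma X0_hist_measurable: "X0 \<in> borel_measurable (hist a)"
proof (rule measurableI)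
  fix B :: "'e set" assume "B \<in> sets borel"
  then have "{\<omega>\<in>space M. X0 \<omega> \<in> B \<and> (\<forall>k\<in>{1..p}. \<forall>r\<in>{}. Y k r \<omega> \<in> UNIV)} \<in> past a"
    unfolding past_def by (intro CollectI exI[of _ B] exI[of _ "\<lambda>_. {}"] exI[of _ "\<lambda>_ _. UNIV"]) auto
  then show "X0 -` B \<inter> space (hist a) \<in> sets (hist a)"
    unfolding sets_hist by (auto simp: vimage_def Int_def conj_commute intro: sigma_sets.Basic)
qed auto

lemma Y_hist_measurable:
  assumes k: "k \<in> {1..p}" and r: "0 \<le> r" "r \<le> a k"
  shows "Y k r \<in> measurable (hist a) (count_space UNIV)"
proof (rule measurableI)
  fix S :: "nat set"
  have "{\<omega>\<in>space M. X0 \<omega> \<in> UNIV \<and> (\<forall>k'\<in>{1..p}. \<forall>r'\<in>if k' = k then {r} else {}. Y k' r' \<omega> \<in> S)} \<in> past a"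
    unfolding past_def using r
    by (intro CollectI exI[of _ UNIV] exI[of _ "\<lambda>k'. if k' = k then {r} else {}"] exI[of _ "\<lambda>_ _. S"]) auto
  also have "{\<omega>\<in>space M. X0 \<omega> \<in> UNIV \<and> (\<forall>k'\<in>{1..p}. \<forall>r'\<in>if k' = k then {r} else {}. Y k' r' \<omega> \<in> S)} = Y k r -` S \<inter> space (hist a)"
    using k by auto
  finally show "Y k r -` S \<inter> space (hist a) \<in> sets (hist a)"
    unfolding sets_hist by (rule sigma_sets.Basic)
qed auto

lemma past_Int_stable: "Int_stable (past a)"
proof (rule Int_stableI)
  fix A1 A2 assume "A1 \<in> past a" "A2 \<in> past a"
  then obtain B1 Q1 S1 B2 Q2 S2 where
    A1: "A1 = {\<omega>\<in>space M. X0 \<omega> \<in> B1 \<and> (\<forall>k\<in>{1..p}. \<forall>r\<in>Q1 k. Y k r \<omega> \<in> S1 k r)}"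
      "B1 \<in> sets borel" "\<forall>k. finite (Q1 k) \<and> Q1 k \<subseteq> {0..a k}"
    and A2: "A2 = {\<omega>\<in>space M. X0 \<omega> \<in> B2 \<and> (\<forall>k\<in>{1..p}. \<forall>r\<in>Q2 k. Y k r \<omega> \<in> S2 k r)}"
      "B2 \<in> sets borel" "\<forall>k. finite (Q2 k) \<and> Q2 k \<subseteq> {0..a k}"
    unfolding past_def by blast
  \<comment> \<open>A time constrained by only one of the two events receives the trivial constraint
    from the other.\<close>
  define S where "S k r = (if r \<in> Q1 k then S1 k r else UNIV) \<inter> (if r \<in> Q2 k then S2 k r else UNIV)" for k r
  have "A1 \<inter> A2 = {\<omega>\<in>space M. X0 \<omega> \<in> B1 \<inter> B2 \<and> (\<forall>k\<in>{1..p}. \<forall>r\<in>Q1 k \<union> Q2 k. Y k r \<omega> \<in> S k r)}"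
    unfolding A1(1) A2(1) S_def by auto
  then show "A1 \<inter> A2 \<in> past a"
    using A1(2,3) A2(2,3) unfolding past_def
    by (intro CollectI exI[of _ "B1 \<inter> B2"] exI[of _ "\<lambda>k. Q1 k \<union> Q2 k"] exI[of _ S]) auto
qed

text \<open>In the product over the paths only the factor of path \<open>j\<close> sees the window,
  so independence across paths reduces the claim to a single path.\<close>

lemma past_window_prob:
  assumes A: "A \<in> past a" and j: "j \<in> {1..p}" and a: "\<And>k. 0 \<le> a k" and b: "a j < b"
  shows "prob (A \<inter> {\<omega>\<in>space M. Y j b \<omega> - Y j (a j) \<omega> \<in> S'}) = prob A * prob {\<omega>\<in>space M. Y j b \<omega> - Y j (a j) \<omega> \<in> S'}"
proof -
  obtain B Q S where A: "A = {\<omega>\<in>space M. X0 \<omega> \<in> B \<and> (\<forall>k\<in>{1..p}. \<forall>r\<in>Q k. Y k r \<omega> \<in> S k r)}"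
    "B \<in> sets borel" and Q: "\<And>k. finite (Q k)" "\<And>k. Q k \<subseteq> {0..a k}" using A unfolding past_def by blast
  have Q0: "Q k \<subseteq> {0..}" for k using Q(2)[of k] by auto
  have b0: "0 \<le> b" using a[of j] b by simp
  define E where "E k = cylinder (Q k) (S k)" for k
  define E' where "E' k = (if k = j then E k \<inter> window (a j) b S' else E k)" for k
  have E: "E k \<in> sets path_space" "E' k \<in> sets path_space" for k
    using cylinder_sets[OF Q(1) Q0] window_sets[OF a b0] by (simp_all add: E_def E'_def sets.Int)
  have inE: "path_of (Y k) \<omega> \<in> E k \<longleftrightarrow> (\<forall>r\<in>Q k. Y k r \<omega> \<in> S k r)" for k \<omega>
    unfolding E_def by (rule path_of_in_cylinder[OF Q0])
  have inE': "path_of (Y k) \<omega> \<in> E' k \<longleftrightarrow> (\<forall>r\<in>Q k. Y k r \<omega> \<in> S k r) \<and> (k = j \<longrightarrow> Y j b \<omega> - Y j (a j) \<omega> \<in> S')" for k \<omega>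
    using path_of_in_window[OF a[of j] b0] inE[of k] by (auto simp: E'_def)
  have "A \<inter> {\<omega>\<in>space M. Y j b \<omega> - Y j (a j) \<omega> \<in> S'} = {\<omega>\<in>space M. X0 \<omega> \<in> B \<and> (\<forall>k\<in>{1..p}. path_of (Y k) \<omega> \<in> E' k)}"
    unfolding A(1) inE' using j by auto
  then have "prob (A \<inter> {\<omega>\<in>space M. Y j b \<omega> - Y j (a j) \<omega> \<in> S'}) =
    prob {\<omega>\<in>space M. X0 \<omega> \<in> B} * (\<Prod>k=1..p. prob {\<omega>\<in>space M. path_of (Y k) \<omega> \<in> E' k})"
    using product[OF A(2), of E'] E by simp
  also have "(\<Prod>k=1..p. prob {\<omega>\<in>space M. path_of (Y k) \<omega> \<in> E' k}) =
     (\<Prod>k=1..p. prob {\<omega>\<in>space M. path_of (Y k) \<omega> \<in> E k} * (if k = j then prob {\<omega>\<in>space M. Y j b \<omega> - Y j (a j) \<omega> \<in> S'} else 1))"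
  proof (intro prod.cong refl)
    fix k assume k: "k \<in> {1..p}"
    show "prob {\<omega>\<in>space M. path_of (Y k) \<omega> \<in> E' k} = prob {\<omega>\<in>space M. path_of (Y k) \<omega> \<in> E k} * (if k = j then prob {\<omega>\<in>space M. Y j b \<omega> - Y j (a j) \<omega> \<in> S'} else 1)"
      unfolding inE inE'
      using single_window_indep[OF j Q(1)[of j] Q(2)[of j] a[of j] b, of "S j" S'] by (cases "k = j") auto
  qed
  also have "\<dots> = (\<Prod>k=1..p. prob {\<omega>\<in>space M. path_of (Y k) \<omega> \<in> E k}) * prob {\<omega>\<in>space M. Y j b \<omega> - Y j (a j) \<omega> \<in> S'}"
    using j by (simp add: prod.distrib)
  also have "prob {\<omega>\<in>space M. X0 \<omega> \<in> B} * \<dots> = prob {\<omega>\<in>space M. X0 \<omega> \<in> B \<and> (\<forall>k\<in>{1..p}. path_of (Y k) \<omega> \<in> E k)} * prob {\<omega>\<in>space M. Y j b \<omega> - Y j (a j) \<omega> \<in> S'}"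
    using product[OF A(2), of E] E by simp
  also have "{\<omega>\<in>space M. X0 \<omega> \<in> B \<and> (\<forall>k\<in>{1..p}. path_of (Y k) \<omega> \<in> E k)} = A" unfolding A(1) inE ..
  finally show ?thesis .
qed

lemma increment_measurable [measurable]:
  "j \<in> {1..p} \<Longrightarrow> (\<lambda>\<omega>. Y j b \<omega> - Y j a \<omega>) \<in> measurable M (count_space UNIV)"
  using Y_measurable[of j a] Y_measurable[of j b] by measurable

text \<open>Independence extends from intersection-stable generators. The window starts at the
  horizon of path \<open>j\<close>, whereas the horizons of the other paths are arbitrary; this
  freedom is the gain of the multiparameter history.\<close>

lemma hist_increment_indep:
  assumes j: "j \<in> {1..p}" and a: "\<And>k. 0 \<le> a k" and b: "a j < b"
    and \<xi>: "\<xi> \<in> borel_measurable (hist a)"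
  shows "indep_var borel \<xi> borel (\<lambda>\<omega>. g (Y j b \<omega> - Y j (a j) \<omega>) :: real)"
proof -
  define W where "W \<omega> = Y j b \<omega> - Y j (a j) \<omega>" for \<omega>
  have W: "W \<in> measurable M (count_space UNIV)" unfolding W_def using j by measurable
  define G where "G = {{\<omega>\<in>space M. W \<omega> \<in> S} | S. True}"
  have G: "G \<subseteq> events"
    using measurable_sets[OF W] by (auto simp: G_def vimage_def Int_def conj_commute)
  have "indep_set (past a) G"
  proof (rule indep_setI[OF past_events G])
    fix A B assume "A \<in> past a" "B \<in> G"
    then show "prob (A \<inter> B) = prob A * prob B"
      using past_window_prob[where a=a and b=b and j=j] j a b by (auto simp: G_def W_def)
  qed
  moreover have "Int_stable G"
  proof (rule Int_stableI)
    fix A B assume "A \<in> G" "B \<in> G"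
    then obtain S S' where "A = {\<omega>\<in>space M. W \<omega> \<in> S}" "B = {\<omega>\<in>space M. W \<omega> \<in> S'}" by (auto simp: G_def)
    then have "A \<inter> B = {\<omega>\<in>space M. W \<omega> \<in> S \<inter> S'}" by auto
    then show "A \<inter> B \<in> G" unfolding G_def by blast
  qed
  ultimately have ind: "indep_set (sigma_sets (space M) (past a)) (sigma_sets (space M) G)"
    by (intro indep_set_sigma_sets past_Int_stable)
  have "{\<xi> -` A \<inter> space M |A. A \<in> sets borel} \<subseteq> sets (hist a)"
    using measurable_sets[OF \<xi>] by auto
  then have 1: "sigma_sets (space M) {\<xi> -` A \<inter> space M |A. A \<in> sets borel} \<subseteq> sigma_sets (space M) (past a)"
    using sets.sigma_sets_subset[of _ "hist a"] by (simp add: sets_hist)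
  have "{(\<lambda>\<omega>. g (W \<omega>)) -` A \<inter> space M |A. A \<in> sets borel} \<subseteq> G"
  proof
    fix B assume "B \<in> {(\<lambda>\<omega>. g (W \<omega>)) -` A \<inter> space M |A. A \<in> sets borel}"
    then obtain A where "B = {\<omega>\<in>space M. W \<omega> \<in> g -` A}" by auto
    then show "B \<in> G" unfolding G_def by blast
  qed
  then have 2: "sigma_sets (space M) {(\<lambda>\<omega>. g (W \<omega>)) -` A \<inter> space M |A. A \<in> sets borel} \<subseteq> sigma_sets (space M) G"
    by (rule sigma_sets_mono')
  have "indep_var borel \<xi> borel (\<lambda>\<omega>. g (W \<omega>))"
    unfolding indep_var_eq
    using indep_set_mono[OF ind 1 2] measurable_from_subalg[OF hist_subalgebra \<xi>] measurable_compose[OF W, of g borel]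
    by simp
  then show ?thesis by (simp add: W_def)
qed

lemma increment_integral:
  fixes g :: "nat \<Rightarrow> real"
  assumes j: "j \<in> {1..p}" and ab: "0 \<le> a" "a < b"
  shows "integrable M (\<lambda>\<omega>. g (Y j b \<omega> - Y j a \<omega>)) \<longleftrightarrow> integrable (measure_pmf (poisson_pmf (b - a))) g"
    and "expectation (\<lambda>\<omega>. g (Y j b \<omega> - Y j a \<omega>)) = measure_pmf.expectation (poisson_pmf (b - a)) g"
  unfolding increments_distr[OF j ab, symmetric]
  using j by (auto simp: integrable_distr_eq integral_distr)

text \<open>Besides the mean, the second factorial moment is computed: for a Poisson count it equals
  the square of the window length exactly, which makes it a second-order quantity.\<close>

lemma
  assumes j: "j \<in> {1..p}" and a: "\<And>k. 0 \<le> a k" and b: "a j < b"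
    and \<xi>: "\<xi> \<in> borel_measurable (hist a)" "integrable M \<xi>"
  shows hist_increment_integrable: "integrable M (\<lambda>\<omega>. \<xi> \<omega> * real (Y j b \<omega> - Y j (a j) \<omega>))"
    and hist_increment_mean: "expectation (\<lambda>\<omega>. \<xi> \<omega> * real (Y j b \<omega> - Y j (a j) \<omega>)) = expectation \<xi> * (b - a j)"
    and hist_increment_moment_integrable: "integrable M (\<lambda>\<omega>. \<xi> \<omega> * (real (Y j b \<omega> - Y j (a j) \<omega>) * (real (Y j b \<omega> - Y j (a j) \<omega>) - 1)))"
    and hist_increment_moment: "expectation (\<lambda>\<omega>. \<xi> \<omega> * (real (Y j b \<omega> - Y j (a j) \<omega>) * (real (Y j b \<omega> - Y j (a j) \<omega>) - 1))) = expectation \<xi> * (b - a j)\<^sup>2"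
proof -
  have pos: "0 < b - a j" using b by simp
  have nn: "0 \<le> real n * (real n - 1)" for n by (cases n) auto
  note i = increment_integral[OF j a[of j] b]
  note P1 = poisson_expectation_sums[OF pos of_nat_0_le_iff poisson_mean_sums]
  note P2 = poisson_expectation_sums[OF pos nn poisson_factorial_moment_sums]
  note ind1 = hist_increment_indep[where a=a, OF j a b \<xi>(1), of real]
  note ind2 = hist_increment_indep[where a=a, OF j a b \<xi>(1), of "\<lambda>n. real n * (real n - 1)"]
  show "integrable M (\<lambda>\<omega>. \<xi> \<omega> * real (Y j b \<omega> - Y j (a j) \<omega>))"
    by (rule indep_var_integrable[OF ind1 \<xi>(2)]) (use i(1)[of real] P1 in simp)
  show "expectation (\<lambda>\<omega>. \<xi> \<omega> * real (Y j b \<omega> - Y j (a j) \<omega>)) = expectation \<xi> * (b - a j)"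
    by (subst indep_var_lebesgue_integral[OF ind1 \<xi>(2)]) (use i[of real] P1 in simp_all)
  show "integrable M (\<lambda>\<omega>. \<xi> \<omega> * (real (Y j b \<omega> - Y j (a j) \<omega>) * (real (Y j b \<omega> - Y j (a j) \<omega>) - 1)))"
    by (rule indep_var_integrable[OF ind2 \<xi>(2)]) (use i(1)[of "\<lambda>n. real n * (real n - 1)"] P2 in simp)
  show "expectation (\<lambda>\<omega>. \<xi> \<omega> * (real (Y j b \<omega> - Y j (a j) \<omega>) * (real (Y j b \<omega> - Y j (a j) \<omega>) - 1))) = expectation \<xi> * (b - a j)\<^sup>2"
    by (subst indep_var_lebesgue_integral[OF ind2 \<xi>(2)]) (use i[of "\<lambda>n. real n * (real n - 1)"] P2 in simp_all)
qed

end

section \<open>Optional sampling at multiparameter stopping times\<close>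

context poisson_family
begin

definition below :: "(nat \<Rightarrow> 'w \<Rightarrow> real) \<Rightarrow> (nat \<Rightarrow> real) \<Rightarrow> 'w set" where
  "below \<tau> a = {\<omega>\<in>space M. \<forall>k\<in>{1..p}. \<tau> k \<omega> \<le> a k}"

text \<open>Measurability with respect to the history stopped at \<open>\<tau>\<close>, expressed
  without constructing that sigma-algebra. For \<open>\<xi> = 1\<close> it says that
  \<open>below \<tau> a\<close> lies in \<open>hist a\<close>, that is, \<open>\<tau>\<close> is a
  stopping time.\<close>

definition stopped_measurable :: "(nat \<Rightarrow> 'w \<Rightarrow> real) \<Rightarrow> ('w \<Rightarrow> real) \<Rightarrow> bool" where
  "stopped_measurable \<tau> \<xi> \<longleftrightarrow> (\<forall>a. (\<forall>k. 0 \<le> a k) \<longrightarrow> (\<lambda>\<omega>. indicator (below \<tau> a) \<omega> * \<xi> \<omega>) \<in> borel_measurable (hist a))"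

lemma stopped_measurable_mult:
  assumes "stopped_measurable \<tau> \<xi>" "stopped_measurable \<tau> \<zeta>"
  shows "stopped_measurable \<tau> (\<lambda>\<omega>. \<xi> \<omega> * \<zeta> \<omega>)"
proof -
  have "(\<lambda>\<omega>. (indicator (below \<tau> a) \<omega> * \<xi> \<omega>) * (indicator (below \<tau> a) \<omega> * \<zeta> \<omega>)) \<in> borel_measurable (hist a)" if "\<forall>k. 0 \<le> a k" for a
    by (rule borel_measurable_times) (use assms that in \<open>simp_all add: stopped_measurable_def\<close>)
  moreover have "(\<lambda>\<omega>. (indicator (below \<tau> a) \<omega> * \<xi> \<omega>) * (indicator (below \<tau> a) \<omega> * \<zeta> \<omega>)) = (\<lambda>\<omega>. indicator (below \<tau> a) \<omega> * (\<xi> \<omega> * \<zeta> \<omega>))" for a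
    by (auto simp: indicator_def)
  ultimately show ?thesis unfolding stopped_measurable_def by simp
qed

definition cell :: "nat \<Rightarrow> (nat \<Rightarrow> 'w \<Rightarrow> real) \<Rightarrow> (nat \<Rightarrow> nat) \<Rightarrow> 'w set" where
  "cell N \<tau> m = {\<omega>\<in>space M. \<forall>k\<in>{1..p}. nat \<lceil>real N * \<tau> k \<omega>\<rceil> = m k}"

text \<open>Here and in the next two definitions the coordinates outside \<open>{1..p}\<close> are
  set to 0, so that bounds quantified over all \<open>k\<close> hold.\<close>

definition lattice :: "nat \<Rightarrow> (nat \<Rightarrow> nat) \<Rightarrow> nat \<Rightarrow> real" where
  "lattice N m k = (if k \<in> {1..p} then real (m k) / real N else 0)"

definition round_up :: "nat \<Rightarrow> (nat \<Rightarrow> 'w \<Rightarrow> real) \<Rightarrow> 'w \<Rightarrow> nat \<Rightarrow> real" where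
  "round_up N \<tau> \<omega> k = (if k \<in> {1..p} then real (nat \<lceil>real N * \<tau> k \<omega>\<rceil>) / real N else 0)"

definition at_time :: "(nat \<Rightarrow> 'w \<Rightarrow> real) \<Rightarrow> 'w \<Rightarrow> nat \<Rightarrow> real" where
  "at_time \<tau> \<omega> k = (if k \<in> {1..p} then \<tau> k \<omega> else 0)"

lemma lattice_nonneg: "0 \<le> lattice N m k"
  by (simp add: lattice_def)

lemma round_up_eq_lattice: "\<omega> \<in> cell N \<tau> m \<Longrightarrow> round_up N \<tau> \<omega> = lattice N m"
  by (auto simp: cell_def lattice_def round_up_def fun_eq_iff)

lemma nat_ceiling_le_iff_divide: "0 < N \<Longrightarrow> nat \<lceil>real N * x\<rceil> \<le> m \<longleftrightarrow> x \<le> real m / real N"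
  by (simp add: nat_le_iff ceiling_le_iff field_simps)

text \<open>Lowering one coordinate at a time suffices, since a rounded coordinate smaller than
  \<open>m k\<close> is at most \<open>m k - 1\<close>. A cell is thus built from stopping events at
  its own lattice point and at smaller ones, all of which its own history contains.\<close>

lemma cell_eq:
  assumes "0 < N"
  shows "cell N \<tau> m = below \<tau> (lattice N m) - (\<Union>k\<in>{k\<in>{1..p}. 0 < m k}. below \<tau> (lattice N (m(k := m k - 1))))"
proof -
  have below: "\<omega> \<in> below \<tau> (lattice N m) \<longleftrightarrow> \<omega> \<in> space M \<and> (\<forall>k\<in>{1..p}. nat \<lceil>real N * \<tau> k \<omega>\<rceil> \<le> m k)" for m \<omega>
    unfolding nat_ceiling_le_iff_divide[OF assms] by (auto simp: below_def lattice_def)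
  show ?thesis
  proof (rule set_eqI, goal_cases)
    case (1 \<omega>)
    show ?case
    proof
      assume w: "\<omega> \<in> cell N \<tau> m"
      have "\<omega> \<in> below \<tau> (lattice N m)" using w unfolding below by (simp add: cell_def)
      moreover have "\<omega> \<notin> below \<tau> (lattice N (m(k := m k - 1)))" if "k \<in> {1..p}" "0 < m k" for k
        using w that unfolding below cell_def by (auto intro!: bexI[of _ k])
      ultimately show "\<omega> \<in> below \<tau> (lattice N m) - (\<Union>k\<in>{k\<in>{1..p}. 0 < m k}. below \<tau> (lattice N (m(k := m k - 1))))"
        by blast
    next
      assume w: "\<omega> \<in> below \<tau> (lattice N m) - (\<Union>k\<in>{k\<in>{1..p}. 0 < m k}. below \<tau> (lattice N (m(k := m k - 1))))"
      then have le: "\<omega> \<in> space M" "\<And>k. k \<in> {1..p} \<Longrightarrow> nat \<lceil>real N * \<tau> k \<omega>\<rceil> \<le> m k" using below by auto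
      have "nat \<lceil>real N * \<tau> k \<omega>\<rceil> = m k" if k: "k \<in> {1..p}" for k
      proof (rule ccontr)
        assume "nat \<lceil>real N * \<tau> k \<omega>\<rceil> \<noteq> m k"
        then have "nat \<lceil>real N * \<tau> k \<omega>\<rceil> \<le> m k - 1" "0 < m k" using le(2)[OF k] by linarith+
        then have "\<omega> \<in> below \<tau> (lattice N (m(k := m k - 1)))" unfolding below using le by auto
        then show False using w k \<open>0 < m k\<close> by blast
      qed
      then show "\<omega> \<in> cell N \<tau> m" using le(1) by (simp add: cell_def)
    qed
  qed
qed

lemma cell_hist:
  assumes "0 < N" and \<tau>: "stopped_measurable \<tau> (\<lambda>_. 1)"
  shows "cell N \<tau> m \<in> sets (hist (lattice N m))"
proof -
  have b: "below \<tau> a \<in> sets (hist a)" if "\<And>k. 0 \<le> a k" for a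
  proof -
    have "(\<lambda>\<omega>. indicator (below \<tau> a) \<omega> * (1 :: real)) \<in> borel_measurable (hist a)"
      using \<tau>[unfolded stopped_measurable_def] that by blast
    then have "below \<tau> a \<inter> space (hist a) \<in> sets (hist a)" by (simp add: borel_measurable_indicator_iff)
    moreover have "below \<tau> a \<inter> space (hist a) = below \<tau> a" by (auto simp: below_def)
    ultimately show ?thesis by simp
  qed
  have step: "below \<tau> (lattice N (m(k := m k - 1))) \<in> sets (hist (lattice N m))" for k
  proof -
    have "sets (hist (lattice N (m(k := m k - 1)))) \<subseteq> sets (hist (lattice N m))"
    proof (rule hist_mono)
      fix j show "lattice N (m(k := m k - 1)) j \<le> lattice N m j"
        unfolding lattice_def by (cases "j = k") (simp_all add: divide_right_mono)
    qed
    then show ?thesis using b[OF lattice_nonneg] by (rule subsetD)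
  qed
  have "(\<Union>k\<in>{k\<in>{1..p}. 0 < m k}. below \<tau> (lattice N (m(k := m k - 1)))) \<in> sets (hist (lattice N m))"
    by (rule sets.finite_UN) (simp, rule step)
  then show ?thesis unfolding cell_eq[OF assms(1)] by (intro sets.Diff b lattice_nonneg)
qed

text \<open>Tested form of: given \<open>hist a\<close>, the variable \<open>W a\<close> has the
  deterministic conditional mean \<open>w a\<close>. The abstraction lets one sampling argument
  serve both the compensated increments and the factorial moment of the total count.\<close>

definition hist_mean :: "real \<Rightarrow> real \<Rightarrow> ((nat \<Rightarrow> real) \<Rightarrow> 'w \<Rightarrow> real) \<Rightarrow> ((nat \<Rightarrow> real) \<Rightarrow> real) \<Rightarrow> bool" where
  "hist_mean K B W w \<longleftrightarrow> (\<forall>a \<zeta>. (\<forall>k. 0 \<le> a k \<and> a k \<le> K) \<longrightarrow> \<zeta> \<in> borel_measurable (hist a) \<longrightarrow> (\<forall>\<omega>. \<bar>\<zeta> \<omega>\<bar> \<le> B) \<longrightarrow>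
     integrable M (\<lambda>\<omega>. \<zeta> \<omega> * W a \<omega>) \<and> expectation (\<lambda>\<omega>. \<zeta> \<omega> * W a \<omega>) = expectation \<zeta> * w a)"

context
  fixes \<tau> :: "nat \<Rightarrow> 'w \<Rightarrow> real" and \<xi> :: "'w \<Rightarrow> real" and K B :: real
    and W :: "(nat \<Rightarrow> real) \<Rightarrow> 'w \<Rightarrow> real" and w :: "(nat \<Rightarrow> real) \<Rightarrow> real"
  assumes \<tau>: "stopped_measurable \<tau> (\<lambda>_. 1)" "\<And>k \<omega>. 0 \<le> \<tau> k \<omega>" "\<And>k \<omega>. \<tau> k \<omega> \<le> K"
    and \<xi>: "stopped_measurable \<tau> \<xi>" "\<And>\<omega>. \<bar>\<xi> \<omega>\<bar> \<le> B"
    and W: "hist_mean (K + 1) B W w"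
begin

lemma round_up_bounds:
  assumes "0 < N" "k \<in> {1..p}"
  shows "\<tau> k \<omega> \<le> round_up N \<tau> \<omega> k" "round_up N \<tau> \<omega> k \<le> \<tau> k \<omega> + 1 / real N"
proof -
  have "real N * \<tau> k \<omega> \<le> real (nat \<lceil>real N * \<tau> k \<omega>\<rceil>)" "real (nat \<lceil>real N * \<tau> k \<omega>\<rceil>) \<le> real N * \<tau> k \<omega> + 1"
  proof -
    have "0 \<le> real N * \<tau> k \<omega>" using \<tau>(2)[of k \<omega>] by simp
    then have "real (nat \<lceil>real N * \<tau> k \<omega>\<rceil>) = of_int \<lceil>real N * \<tau> k \<omega>\<rceil>" by (intro of_nat_nat) (simp add: le_ceiling_iff)
    then show "real N * \<tau> k \<omega> \<le> real (nat \<lceil>real N * \<tau> k \<omega>\<rceil>)" "real (nat \<lceil>real N * \<tau> k \<omega>\<rceil>) \<le> real N * \<tau> k \<omega> + 1"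
      using ceiling_correct[of "real N * \<tau> k \<omega>"] by linarith+
  qed
  then show "\<tau> k \<omega> \<le> round_up N \<tau> \<omega> k" "round_up N \<tau> \<omega> k \<le> \<tau> k \<omega> + 1 / real N"
    using assms by (simp_all add: round_up_def field_simps)
qed

lemma round_up_range: "0 < N \<Longrightarrow> 0 \<le> round_up N \<tau> \<omega> k \<and> round_up N \<tau> \<omega> k \<le> K + 1"
proof (cases "k \<in> {1..p}")
  case True
  assume N: "0 < N"
  then have "1 / real N \<le> 1" by simp
  then show ?thesis using round_up_bounds[OF N True, of \<omega>] \<tau>(2,3)[of k \<omega>] by linarith
next
  case False
  then have "round_up N \<tau> \<omega> k = 0" unfolding round_up_def by (rule if_not_P)
  then show ?thesis using \<tau>(2,3)[of k \<omega>] by simp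
qed

lemma round_up_LIMSEQ:
  assumes k: "k \<in> {1..p}" shows "(\<lambda>N. round_up (Suc N) \<tau> \<omega> k) \<longlonglongrightarrow> \<tau> k \<omega>"
proof (rule tendsto_sandwich[of "\<lambda>_. \<tau> k \<omega>" _ _ "\<lambda>N. \<tau> k \<omega> + 1 / real (Suc N)"])
  show "(\<lambda>N. \<tau> k \<omega> + 1 / real (Suc N)) \<longlonglongrightarrow> \<tau> k \<omega>"
    using tendsto_add[OF tendsto_const[of "\<tau> k \<omega>"], of "\<lambda>n. 1 / real (Suc n)" 0 sequentially] LIMSEQ_Suc[OF lim_1_over_n[where 'a=real]] by simp
  show "\<forall>\<^sub>F N in sequentially. round_up (Suc N) \<tau> \<omega> k \<le> \<tau> k \<omega> + 1 / real (Suc N)"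
    by (rule always_eventually) (use round_up_bounds(2)[OF zero_less_Suc k] in blast)
qed (use round_up_bounds(1)[OF zero_less_Suc k] in \<open>auto intro!: always_eventually\<close>)

text \<open>Rounding goes upwards and step paths are constant just to the right, so the values
  become equal and do not merely converge. The shift \<open>d\<close> serves the right end of a
  window.\<close>

lemma Y_round_up_eventually:
  assumes k: "k \<in> {1..p}"
  shows "\<forall>\<^sub>F N in sequentially. Y k (round_up (Suc N) \<tau> \<omega> k + d) \<omega> = Y k (\<tau> k \<omega> + d) \<omega>"
proof -
  have "\<forall>\<^sub>F s in at_right (\<tau> k \<omega> + d). Y k s \<omega> = Y k (\<tau> k \<omega> + d) \<omega>"
    using Y_step[OF k] by (auto simp: step_path_def)
  then obtain e where e: "\<tau> k \<omega> + d < e" "\<And>s. \<tau> k \<omega> + d < s \<Longrightarrow> s < e \<Longrightarrow> Y k s \<omega> = Y k (\<tau> k \<omega> + d) \<omega>"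
    by (auto simp: eventually_at_right[OF less_add_one])
  have "\<forall>\<^sub>F N in sequentially. round_up (Suc N) \<tau> \<omega> k < e - d"
    using e(1) by (intro order_tendstoD(2)[OF round_up_LIMSEQ[OF k]]) simp
  then show ?thesis
  proof eventually_elim
    case (elim N)
    then show ?case using e(2)[of "round_up (Suc N) \<tau> \<omega> k + d"] round_up_bounds(1)[of "Suc N" k \<omega>] k
      by (cases "round_up (Suc N) \<tau> \<omega> k = \<tau> k \<omega>") auto
  qed
qed

text \<open>On a cell the rounded time is a fixed lattice point, and \<open>\<xi>\<close> cut down
  to the cell is measurable for the history there, so the deterministic statement applies cell by
  cell. Boundedness of \<open>\<tau>\<close> leaves finitely many cells.\<close>

lemma round_up_expectation:
  assumes N: "0 < N"
  shows "integrable M (\<lambda>\<omega>. \<xi> \<omega> * W (round_up N \<tau> \<omega>) \<omega>)"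
    and "integrable M (\<lambda>\<omega>. \<xi> \<omega> * w (round_up N \<tau> \<omega>))"
    and "expectation (\<lambda>\<omega>. \<xi> \<omega> * W (round_up N \<tau> \<omega>) \<omega>) = expectation (\<lambda>\<omega>. \<xi> \<omega> * w (round_up N \<tau> \<omega>))"
proof -
  define I where "I = PiE {1..p} (\<lambda>_. {..nat \<lceil>real N * K\<rceil>})"
  have I: "finite I" unfolding I_def by (intro finite_PiE) auto
  \<comment> \<open>In a nonempty cell the lattice point is a value of the rounded time and inherits
    its bound \<open>K + 1\<close>.\<close>
  define I' where "I' = {m\<in>I. cell N \<tau> m \<noteq> {}}"
  have I': "finite I'" using I by (simp add: I'_def)
  define \<zeta> where "\<zeta> m \<omega> = indicator (cell N \<tau> m) \<omega> * \<xi> \<omega>" for m \<omega>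
  have \<zeta>: "\<zeta> m \<in> borel_measurable (hist (lattice N m))" for m
  proof -
    have "(\<lambda>\<omega>. indicator (below \<tau> (lattice N m)) \<omega> * \<xi> \<omega>) \<in> borel_measurable (hist (lattice N m))"
      using \<xi>(1) lattice_nonneg unfolding stopped_measurable_def by auto
    from borel_measurable_times[OF borel_measurable_indicator[OF cell_hist[OF N \<tau>(1)]] this]
    have "(\<lambda>\<omega>. indicator (cell N \<tau> m) \<omega> * (indicator (below \<tau> (lattice N m)) \<omega> * \<xi> \<omega>)) \<in> borel_measurable (hist (lattice N m))"
      .
    moreover have "(\<lambda>\<omega>. indicator (cell N \<tau> m) \<omega> * (indicator (below \<tau> (lattice N m)) \<omega> * \<xi> \<omega>)) = \<zeta> m"
      by (auto simp: \<zeta>_def indicator_def cell_eq[OF N])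
    ultimately show ?thesis by simp
  qed
  have \<zeta>_bound: "\<bar>\<zeta> m \<omega>\<bar> \<le> B" for m \<omega>
    using \<xi>(2)[of \<omega>] by (auto simp: \<zeta>_def indicator_def)
  have \<zeta>_int: "integrable M (\<zeta> m)" for m
    using measurable_from_subalg[OF hist_subalgebra \<zeta>] \<zeta>_bound by (intro integrable_const_bound[of _ B]) auto
  have range: "lattice N m k \<le> K + 1" if m: "m \<in> I'" for m k
  proof -
    obtain \<omega> where "\<omega> \<in> cell N \<tau> m" using m unfolding I'_def by blast
    then show ?thesis using round_up_range[OF N, of \<omega> k] by (simp add: round_up_eq_lattice)
  qed
  have WI: "integrable M (\<lambda>\<omega>. \<zeta> m \<omega> * W (lattice N m) \<omega>) \<and> expectation (\<lambda>\<omega>. \<zeta> m \<omega> * W (lattice N m) \<omega>) = expectation (\<zeta> m) * w (lattice N m)"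
    if "m \<in> I'" for m
    using W[unfolded hist_mean_def, rule_format, of "lattice N m" "\<zeta> m"] range[OF that] \<zeta> \<zeta>_bound lattice_nonneg by simp
  have partition: "(\<Sum>m\<in>I'. \<zeta> m \<omega> * g (lattice N m)) = \<xi> \<omega> * g (round_up N \<tau> \<omega>)" if \<omega>: "\<omega> \<in> space M" for \<omega> and g :: "(nat \<Rightarrow> real) \<Rightarrow> real"
  proof -
    define m0 where "m0 = (\<lambda>k\<in>{1..p}. nat \<lceil>real N * \<tau> k \<omega>\<rceil>)"
    have c: "\<omega> \<in> cell N \<tau> m0" using \<omega> by (simp add: cell_def m0_def)
    have "nat \<lceil>real N * \<tau> k \<omega>\<rceil> \<le> nat \<lceil>real N * K\<rceil>" for k
      by (intro nat_mono ceiling_mono mult_left_mono \<tau>(3)) simp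
    then have "m0 \<in> I" unfolding I_def m0_def by (intro restrict_PiE_iff[THEN iffD2]) simp
    then have m0: "m0 \<in> I'" using c unfolding I'_def by blast
    have other: "\<omega> \<notin> cell N \<tau> m" if "m \<in> I'" "m \<noteq> m0" for m
    proof
      assume "\<omega> \<in> cell N \<tau> m"
      then have "m k = m0 k" if "k \<in> {1..p}" for k using that by (simp add: cell_def m0_def)
      moreover have "m \<in> extensional {1..p}" "m0 \<in> extensional {1..p}"
        using \<open>m \<in> I'\<close> m0 unfolding I'_def I_def PiE_def by simp_all
      ultimately show False using \<open>m \<noteq> m0\<close> extensionalityI[of m "{1..p}" m0] by blast
    qed
    have "(\<Sum>m\<in>I'. \<zeta> m \<omega> * g (lattice N m)) = (\<Sum>m\<in>{m0}. \<zeta> m \<omega> * g (lattice N m))"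
      using I' m0 other by (intro sum.mono_neutral_right) (auto simp: \<zeta>_def)
    also have "\<dots> = \<xi> \<omega> * g (round_up N \<tau> \<omega>)" using c by (simp add: \<zeta>_def round_up_eq_lattice)
    finally show ?thesis .
  qed
  have 1: "integrable M (\<lambda>\<omega>. \<Sum>m\<in>I'. \<zeta> m \<omega> * W (lattice N m) \<omega>)"
    using WI by (intro Bochner_Integration.integrable_sum) auto
  have 2: "integrable M (\<lambda>\<omega>. \<Sum>m\<in>I'. \<zeta> m \<omega> * w (lattice N m))"
    using \<zeta>_int by (intro Bochner_Integration.integrable_sum integrable_mult_left) auto
  have 3: "expectation (\<lambda>\<omega>. \<Sum>m\<in>I'. \<zeta> m \<omega> * W (lattice N m) \<omega>) = expectation (\<lambda>\<omega>. \<Sum>m\<in>I'. \<zeta> m \<omega> * w (lattice N m))"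
    using WI \<zeta>_int by (simp add: Bochner_Integration.integral_sum)
  have eqW: "(\<Sum>m\<in>I'. \<zeta> m \<omega> * W (lattice N m) \<omega>) = \<xi> \<omega> * W (round_up N \<tau> \<omega>) \<omega>" if "\<omega> \<in> space M" for \<omega>
    using partition[OF that, of "\<lambda>a. W a \<omega>"] .
  show "integrable M (\<lambda>\<omega>. \<xi> \<omega> * W (round_up N \<tau> \<omega>) \<omega>)"
    using 1 by (rule Bochner_Integration.integrable_cong[THEN iffD1, rotated 2]) (auto simp: eqW)
  show "integrable M (\<lambda>\<omega>. \<xi> \<omega> * w (round_up N \<tau> \<omega>))"
    using 2 by (rule Bochner_Integration.integrable_cong[THEN iffD1, rotated 2]) (auto simp: partition)
  show "expectation (\<lambda>\<omega>. \<xi> \<omega> * W (round_up N \<tau> \<omega>) \<omega>) = expectation (\<lambda>\<omega>. \<xi> \<omega> * w (round_up N \<tau> \<omega>))"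
    using 3 by (simp add: eqW partition cong: Bochner_Integration.integral_cong)
qed

text \<open>Dominated convergence as the lattice is refined; the bounds by \<open>V\<close> and
  \<open>c\<close> are required up to \<open>K + 1\<close>, the range of the rounded times.\<close>

lemma stopped_expectation:
  assumes V: "integrable M V" "\<forall>a \<omega>. (\<forall>k. 0 \<le> a k \<and> a k \<le> K + 1) \<longrightarrow> \<bar>W a \<omega>\<bar> \<le> V \<omega>"
    and w_bound: "\<forall>a. (\<forall>k. 0 \<le> a k \<and> a k \<le> K + 1) \<longrightarrow> \<bar>w a\<bar> \<le> c"
    and W_lim: "\<And>\<omega>. \<omega> \<in> space M \<Longrightarrow> (\<lambda>N. W (round_up (Suc N) \<tau> \<omega>) \<omega>) \<longlonglongrightarrow> W (at_time \<tau> \<omega>) \<omega>"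
    and w_lim: "\<And>\<omega>. \<omega> \<in> space M \<Longrightarrow> (\<lambda>N. w (round_up (Suc N) \<tau> \<omega>)) \<longlonglongrightarrow> w (at_time \<tau> \<omega>)"
  shows "integrable M (\<lambda>\<omega>. \<xi> \<omega> * W (at_time \<tau> \<omega>) \<omega>)"
    and "integrable M (\<lambda>\<omega>. \<xi> \<omega> * w (at_time \<tau> \<omega>))"
    and "expectation (\<lambda>\<omega>. \<xi> \<omega> * W (at_time \<tau> \<omega>) \<omega>) = expectation (\<lambda>\<omega>. \<xi> \<omega> * w (at_time \<tau> \<omega>))"
proof -
  have B: "0 \<le> B" using \<xi>(2) abs_ge_zero order_trans by blast
  note r = round_up_expectation[OF zero_less_Suc]
  have lim1: "AE \<omega> in M. (\<lambda>N. \<xi> \<omega> * W (round_up (Suc N) \<tau> \<omega>) \<omega>) \<longlonglongrightarrow> \<xi> \<omega> * W (at_time \<tau> \<omega>) \<omega>"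
    by (rule AE_I2) (intro tendsto_mult tendsto_const W_lim)
  have lim2: "AE \<omega> in M. (\<lambda>N. \<xi> \<omega> * w (round_up (Suc N) \<tau> \<omega>)) \<longlonglongrightarrow> \<xi> \<omega> * w (at_time \<tau> \<omega>)"
    by (rule AE_I2) (intro tendsto_mult tendsto_const w_lim)
  have b1: "AE \<omega> in M. norm (\<xi> \<omega> * W (round_up (Suc N) \<tau> \<omega>) \<omega>) \<le> B * V \<omega>" for N
    unfolding real_norm_def abs_mult
    by (rule AE_I2, rule mult_mono) (use \<xi>(2) V(2) round_up_range B in auto)
  have b2: "AE \<omega> in M. norm (\<xi> \<omega> * w (round_up (Suc N) \<tau> \<omega>)) \<le> B * c" for N
    unfolding real_norm_def abs_mult
    by (rule AE_I2, rule mult_mono) (use \<xi>(2) w_bound round_up_range B in auto)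
  have m1: "(\<lambda>\<omega>. \<xi> \<omega> * W (at_time \<tau> \<omega>) \<omega>) \<in> borel_measurable M"
    by (rule borel_measurable_LIMSEQ_real[where u="\<lambda>N \<omega>. \<xi> \<omega> * W (round_up (Suc N) \<tau> \<omega>) \<omega>"])
      (use W_lim r(1) in \<open>auto intro!: tendsto_mult tendsto_const\<close>)
  have m2: "(\<lambda>\<omega>. \<xi> \<omega> * w (at_time \<tau> \<omega>)) \<in> borel_measurable M"
    by (rule borel_measurable_LIMSEQ_real[where u="\<lambda>N \<omega>. \<xi> \<omega> * w (round_up (Suc N) \<tau> \<omega>)"])
      (use w_lim r(2) in \<open>auto intro!: tendsto_mult tendsto_const\<close>)
  have iV: "integrable M (\<lambda>\<omega>. B * V \<omega>)" using V(1) by simp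
  have ic: "integrable M (\<lambda>\<omega>. B * c)" by simp
  note d1 = integrable_dominated_convergence[OF m1 borel_measurable_integrable[OF r(1)] iV lim1 b1]
    integral_dominated_convergence[OF m1 borel_measurable_integrable[OF r(1)] iV lim1 b1]
  note d2 = integrable_dominated_convergence[OF m2 borel_measurable_integrable[OF r(2)] ic lim2 b2]
    integral_dominated_convergence[OF m2 borel_measurable_integrable[OF r(2)] ic lim2 b2]
  show "integrable M (\<lambda>\<omega>. \<xi> \<omega> * W (at_time \<tau> \<omega>) \<omega>)" by (rule d1(1))
  show "integrable M (\<lambda>\<omega>. \<xi> \<omega> * w (at_time \<tau> \<omega>))" by (rule d2(1))
  show "expectation (\<lambda>\<omega>. \<xi> \<omega> * W (at_time \<tau> \<omega>) \<omega>) = expectation (\<lambda>\<omega>. \<xi> \<omega> * w (at_time \<tau> \<omega>))"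
    using LIMSEQ_unique[OF d1(2)] d2(2) unfolding r(3) by blast
qed

end

lemma bounded_hist_integrable:
  fixes B :: real
  assumes "\<zeta> \<in> borel_measurable (hist a)" "\<And>\<omega>. \<bar>\<zeta> \<omega>\<bar> \<le> B"
  shows "integrable M \<zeta>"
  using measurable_from_subalg[OF hist_subalgebra assms(1)] assms(2) by (intro integrable_const_bound[of _ B]) auto

text \<open>Only increments after the horizon are independent of a history, so the count at the
  stopping time is reached from a fixed later time \<open>b\<close>. The choice
  \<open>b > K + 1\<close> keeps \<open>b\<close> beyond all rounded times.\<close>

lemma stopped_compensated:
  assumes j: "j \<in> {1..p}"
    and \<tau>: "stopped_measurable \<tau> (\<lambda>_. 1)" "\<And>k \<omega>. 0 \<le> \<tau> k \<omega>" "\<And>k \<omega>. \<tau> k \<omega> \<le> K"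
    and \<xi>: "stopped_measurable \<tau> \<xi>" "\<And>\<omega>. \<bar>\<xi> \<omega>\<bar> \<le> B"
    and b: "b > K + 1"
  shows "integrable M (\<lambda>\<omega>. \<xi> \<omega> * (real (Y j b \<omega>) - real (Y j (\<tau> j \<omega>) \<omega>)))"
    and "integrable M (\<lambda>\<omega>. \<xi> \<omega> * (b - \<tau> j \<omega>))"
    and "expectation (\<lambda>\<omega>. \<xi> \<omega> * (real (Y j b \<omega>) - real (Y j (\<tau> j \<omega>) \<omega>))) = expectation (\<lambda>\<omega>. \<xi> \<omega> * (b - \<tau> j \<omega>))"
proof -
  define W where "W a \<omega> = real (Y j b \<omega>) - real (Y j (a j) \<omega>)" for a :: "nat \<Rightarrow> real" and \<omega>
  define w where "w a = b - a j" for a :: "nat \<Rightarrow> real"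
  have K0: "0 \<le> K" using \<tau>(2,3)[of 0 undefined] by linarith
  have W: "hist_mean (K + 1) B W w" for B
    unfolding hist_mean_def
  proof (intro allI impI)
    fix a \<zeta> assume a: "\<forall>k. 0 \<le> a k \<and> a k \<le> K + 1" and \<zeta>: "\<zeta> \<in> borel_measurable (hist a)" "\<forall>\<omega>. \<bar>\<zeta> \<omega>\<bar> \<le> B"
    have a0: "0 \<le> a k" for k using a by simp
    have lt: "a j < b" using a[rule_format, of j] b by simp
    have i: "integrable M \<zeta>" using bounded_hist_integrable[OF \<zeta>(1)] \<zeta>(2) by blast
    have eq: "real (Y j b \<omega> - Y j (a j) \<omega>) = W a \<omega>" for \<omega>
      unfolding W_def using Y_mono[OF j, of "a j" b \<omega>] lt by (simp add: of_nat_diff)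
    show "integrable M (\<lambda>\<omega>. \<zeta> \<omega> * W a \<omega>) \<and> expectation (\<lambda>\<omega>. \<zeta> \<omega> * W a \<omega>) = expectation \<zeta> * w a"
      using hist_increment_integrable[where a=a and b=b and \<xi>=\<zeta>, OF j a0 lt \<zeta>(1) i]
        hist_increment_mean[where a=a and b=b and \<xi>=\<zeta>, OF j a0 lt \<zeta>(1) i]
      unfolding eq w_def by simp
  qed
  \<comment> \<open>The instance of horizon 0 and test variable 1, where \<open>W\<close> is the
    count at \<open>b\<close>.\<close>
  have V: "integrable M (\<lambda>\<omega>. real (Y j b \<omega>))"
    using W[of 1, unfolded hist_mean_def, rule_format, of "\<lambda>_. 0" "\<lambda>_. 1"] K0 Y_nonpos[OF j, of 0] by (simp add: W_def)
  have Vb: "\<forall>a \<omega>. (\<forall>k. 0 \<le> a k \<and> a k \<le> K + 1) \<longrightarrow> \<bar>W a \<omega>\<bar> \<le> real (Y j b \<omega>)"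
  proof (intro allI impI)
    fix a :: "nat \<Rightarrow> real" and \<omega> assume a: "\<forall>k. 0 \<le> a k \<and> a k \<le> K + 1"
    have "a j \<le> b" using b a[rule_format, of j] by simp
    then show "\<bar>W a \<omega>\<bar> \<le> real (Y j b \<omega>)" using Y_mono[OF j, of "a j" b \<omega>] by (simp add: W_def)
  qed
  have wb: "\<forall>a. (\<forall>k. 0 \<le> a k \<and> a k \<le> K + 1) \<longrightarrow> \<bar>w a\<bar> \<le> b"
  proof (intro allI impI)
    fix a :: "nat \<Rightarrow> real" assume "\<forall>k. 0 \<le> a k \<and> a k \<le> K + 1"
    then have "0 \<le> a j" "a j \<le> K + 1" by auto
    then show "\<bar>w a\<bar> \<le> b" using b by (simp add: w_def)
  qed
  have W_lim: "(\<lambda>N. W (round_up (Suc N) \<tau> \<omega>) \<omega>) \<longlonglongrightarrow> W (at_time \<tau> \<omega>) \<omega>" for \<omega>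
    using Y_round_up_eventually[where \<tau>=\<tau> and \<xi>=\<xi> and K=K and B=B and W=W and w=w and k=j and \<omega>=\<omega> and d=0, OF \<tau> \<xi> W j] j
    by (intro tendsto_eventually, elim eventually_mono) (simp add: W_def at_time_def)
  have w_lim: "(\<lambda>N. w (round_up (Suc N) \<tau> \<omega>)) \<longlonglongrightarrow> w (at_time \<tau> \<omega>)" for \<omega>
    unfolding w_def using round_up_LIMSEQ[where \<tau>=\<tau> and \<xi>=\<xi> and K=K and B=B and W=W and w=w and k=j and \<omega>=\<omega>, OF \<tau> \<xi> W j] j by (auto simp: at_time_def intro!: tendsto_diff)
  note S = stopped_expectation[where \<tau>=\<tau> and \<xi>=\<xi> and K=K and B=B and W=W and w=w and V="\<lambda>\<omega>. real (Y j b \<omega>)" and c=b, OF \<tau> \<xi> W V Vb wb W_lim w_lim]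
  show "integrable M (\<lambda>\<omega>. \<xi> \<omega> * (real (Y j b \<omega>) - real (Y j (\<tau> j \<omega>) \<omega>)))"
    and "integrable M (\<lambda>\<omega>. \<xi> \<omega> * (b - \<tau> j \<omega>))"
    and "expectation (\<lambda>\<omega>. \<xi> \<omega> * (real (Y j b \<omega>) - real (Y j (\<tau> j \<omega>) \<omega>))) = expectation (\<lambda>\<omega>. \<xi> \<omega> * (b - \<tau> j \<omega>))"
    using S j by (simp_all add: W_def w_def at_time_def)
qed

text \<open>Two instances of \<open>stopped_compensated\<close> with the common end
  \<open>K + 2\<close> are subtracted; hence the weight has to be measurable for both stopped
  histories.\<close>

lemma optional_sampling:
  assumes j: "j \<in> {1..p}"
    and \<tau>: "stopped_measurable \<tau> (\<lambda>_. 1)" "\<And>k \<omega>. 0 \<le> \<tau> k \<omega>" "\<And>k \<omega>. \<tau> k \<omega> \<le> K"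
    and \<tau>': "stopped_measurable \<tau>' (\<lambda>_. 1)" "\<And>k \<omega>. 0 \<le> \<tau>' k \<omega>" "\<And>k \<omega>. \<tau>' k \<omega> \<le> K"
    and \<xi>: "stopped_measurable \<tau> \<xi>" "stopped_measurable \<tau>' \<xi>" "\<And>\<omega>. \<bar>\<xi> \<omega>\<bar> \<le> B"
  shows "integrable M (\<lambda>\<omega>. \<xi> \<omega> * (real (Y j (\<tau>' j \<omega>) \<omega>) - real (Y j (\<tau> j \<omega>) \<omega>)))"
    and "integrable M (\<lambda>\<omega>. \<xi> \<omega> * (\<tau>' j \<omega> - \<tau> j \<omega>))"
    and "expectation (\<lambda>\<omega>. \<xi> \<omega> * (real (Y j (\<tau>' j \<omega>) \<omega>) - real (Y j (\<tau> j \<omega>) \<omega>))) = expectation (\<lambda>\<omega>. \<xi> \<omega> * (\<tau>' j \<omega> - \<tau> j \<omega>))"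
proof -
  note s = stopped_compensated[OF j \<tau> \<xi>(1,3), of "K + 2"]
  note s' = stopped_compensated[OF j \<tau>' \<xi>(2,3), of "K + 2"]
  have eq: "(\<lambda>\<omega>. \<xi> \<omega> * (real (Y j (\<tau>' j \<omega>) \<omega>) - real (Y j (\<tau> j \<omega>) \<omega>))) =
    (\<lambda>\<omega>. \<xi> \<omega> * (real (Y j (K + 2) \<omega>) - real (Y j (\<tau> j \<omega>) \<omega>)) - \<xi> \<omega> * (real (Y j (K + 2) \<omega>) - real (Y j (\<tau>' j \<omega>) \<omega>)))"
    "(\<lambda>\<omega>. \<xi> \<omega> * (\<tau>' j \<omega> - \<tau> j \<omega>)) = (\<lambda>\<omega>. \<xi> \<omega> * (K + 2 - \<tau> j \<omega>) - \<xi> \<omega> * (K + 2 - \<tau>' j \<omega>))"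
    by (auto simp: algebra_simps)
  show "integrable M (\<lambda>\<omega>. \<xi> \<omega> * (real (Y j (\<tau>' j \<omega>) \<omega>) - real (Y j (\<tau> j \<omega>) \<omega>)))"
    unfolding eq using s s' by (intro Bochner_Integration.integrable_diff) auto
  show "integrable M (\<lambda>\<omega>. \<xi> \<omega> * (\<tau>' j \<omega> - \<tau> j \<omega>))"
    unfolding eq using s s' by (intro Bochner_Integration.integrable_diff) auto
  show "expectation (\<lambda>\<omega>. \<xi> \<omega> * (real (Y j (\<tau>' j \<omega>) \<omega>) - real (Y j (\<tau> j \<omega>) \<omega>))) = expectation (\<lambda>\<omega>. \<xi> \<omega> * (\<tau>' j \<omega> - \<tau> j \<omega>))"
    unfolding eq using s s' by (simp add: Bochner_Integration.integral_diff)
qed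

section \<open>Factorial moment of all jumps in a clock window\<close>

definition total_increment :: "(nat \<Rightarrow> real) \<Rightarrow> real \<Rightarrow> 'w \<Rightarrow> nat" where
  "total_increment a d \<omega> = (\<Sum>k=1..p. Y k (a k + d) \<omega> - Y k (a k) \<omega>)"

text \<open>For \<open>S = D_1 + ... + D_p\<close>, the product \<open>S (S - 1)\<close> is the sum
  of the diagonal terms \<open>D_j (D_j - 1)\<close> and the mixed terms \<open>D_j D_k\<close>.
  With weight \<open>\<zeta>\<close>, each of the \<open>p\<^sup>2\<close> terms contributes
  \<open>d\<^sup>2\<close> times the mean of \<open>\<zeta>\<close>: the diagonal ones by the
  factorial moment, the mixed ones by taking means one path at a time.\<close>

lemma total_increment_moment:
  assumes a: "\<And>k. 0 \<le> a k" and d: "0 < d"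
    and \<zeta>: "\<zeta> \<in> borel_measurable (hist a)" "\<And>\<omega>. \<bar>\<zeta> \<omega>\<bar> \<le> B"
  shows "integrable M (\<lambda>\<omega>. \<zeta> \<omega> * (real (total_increment a d \<omega>) * (real (total_increment a d \<omega>) - 1)))"
    and "expectation (\<lambda>\<omega>. \<zeta> \<omega> * (real (total_increment a d \<omega>) * (real (total_increment a d \<omega>) - 1))) = expectation \<zeta> * (real p * d)\<^sup>2"
proof -
  define D where "D k \<omega> = real (Y k (a k + d) \<omega> - Y k (a k) \<omega>)" for k \<omega>
  define q where "q j k \<omega> = (if j = k then \<zeta> \<omega> * (D k \<omega> * (D k \<omega> - 1)) else (\<zeta> \<omega> * D j \<omega>) * D k \<omega>)" for j k \<omega>
  have lt: "a k < a k + d" for k using d by simp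
  note \<zeta>i = bounded_hist_integrable[OF \<zeta>]
  have q: "integrable M (q j k) \<and> expectation (q j k) = expectation \<zeta> * d\<^sup>2" if jk: "j \<in> {1..p}" "k \<in> {1..p}" for j k
  proof (cases "j = k")
    case True
    then show ?thesis
      using hist_increment_moment_integrable[where a=a and b="a k + d" and \<xi>=\<zeta>, OF jk(2) a lt \<zeta>(1) \<zeta>i] hist_increment_moment[where a=a and b="a k + d" and \<xi>=\<zeta>, OF jk(2) a lt \<zeta>(1) \<zeta>i]
      by (simp add: q_def[abs_def] D_def)
  next
    case False
    \<comment> \<open>\<open>\<zeta> D\<^sub>j\<close> belongs to the history with the \<open>j\<close>-th time advanced, so the mean formula applies to \<open>D\<^sub>k\<close>.\<close>
    define a' where "a' = a(j := a j + d)"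
    have a': "\<And>k. 0 \<le> a' k" "a' k = a k" "a' k < a k + d" using a d False by (auto simp: a'_def)
    have sub: "subalgebra (hist a') (hist a)"
      using hist_mono[of a a'] d by (auto simp: subalgebra_def a'_def)
    have "Y j (a j + d) \<in> measurable (hist a') (count_space UNIV)" "Y j (a j) \<in> measurable (hist a') (count_space UNIV)"
      using a d by (auto intro!: Y_hist_measurable jk simp: a'_def)
    then have "D j \<in> borel_measurable (hist a')" unfolding D_def by measurable
    then have m: "(\<lambda>\<omega>. \<zeta> \<omega> * D j \<omega>) \<in> borel_measurable (hist a')"
      using measurable_from_subalg[OF sub \<zeta>(1)] by (intro borel_measurable_times)
    have i: "integrable M (\<lambda>\<omega>. \<zeta> \<omega> * D j \<omega>)" "expectation (\<lambda>\<omega>. \<zeta> \<omega> * D j \<omega>) = expectation \<zeta> * d"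
      using hist_increment_integrable[where a=a and b="a j + d" and \<xi>=\<zeta>, OF jk(1) a lt \<zeta>(1) \<zeta>i] hist_increment_mean[where a=a and b="a j + d" and \<xi>=\<zeta>, OF jk(1) a lt \<zeta>(1) \<zeta>i]
      by (simp_all add: D_def)
    have "integrable M (\<lambda>\<omega>. (\<zeta> \<omega> * D j \<omega>) * D k \<omega>)" "expectation (\<lambda>\<omega>. (\<zeta> \<omega> * D j \<omega>) * D k \<omega>) = expectation \<zeta> * d * d"
      using hist_increment_integrable[where a=a' and b="a k + d" and \<xi>="\<lambda>\<omega>. \<zeta> \<omega> * D j \<omega>", OF jk(2) a'(1,3) m i(1)] hist_increment_mean[where a=a' and b="a k + d" and \<xi>="\<lambda>\<omega>. \<zeta> \<omega> * D j \<omega>", OF jk(2) a'(1,3) m i(1)] i(2) a'(2)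
      by (simp_all add: D_def)
    then show ?thesis using False by (simp add: q_def[abs_def] power2_eq_square)
  qed
  have eq: "\<zeta> \<omega> * (real (total_increment a d \<omega>) * (real (total_increment a d \<omega>) - 1)) = (\<Sum>j=1..p. \<Sum>k=1..p. q j k \<omega>)" for \<omega>
  proof -
    have T: "real (total_increment a d \<omega>) = (\<Sum>k=1..p. D k \<omega>)" by (simp add: total_increment_def D_def)
    have "(\<Sum>k=1..p. q j k \<omega>) = \<zeta> \<omega> * (D j \<omega> * (\<Sum>k=1..p. D k \<omega>) - D j \<omega>)" if "j \<in> {1..p}" for j
    proof -
      have "(\<Sum>k=1..p. q j k \<omega>) = (\<Sum>k=1..p. \<zeta> \<omega> * (D j \<omega> * D k \<omega>) - (if j = k then \<zeta> \<omega> * D j \<omega> else 0))"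
        by (intro sum.cong) (auto simp: q_def algebra_simps)
      also have "\<dots> = \<zeta> \<omega> * (D j \<omega> * (\<Sum>k=1..p. D k \<omega>) - D j \<omega>)"
        using that by (simp add: sum_subtractf sum_distrib_left algebra_simps)
      finally show ?thesis .
    qed
    then have "(\<Sum>j=1..p. \<Sum>k=1..p. q j k \<omega>) = (\<Sum>j=1..p. \<zeta> \<omega> * (D j \<omega> * (\<Sum>k=1..p. D k \<omega>) - D j \<omega>))"
      by (intro sum.cong) auto
    also have "\<dots> = \<zeta> \<omega> * ((\<Sum>j=1..p. D j \<omega>) * (\<Sum>k=1..p. D k \<omega>) - (\<Sum>j=1..p. D j \<omega>))"
      by (simp add: sum_subtractf sum_distrib_left[symmetric] sum_distrib_right[symmetric])
    finally show ?thesis unfolding T by (simp add: algebra_simps)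
  qed
  show "integrable M (\<lambda>\<omega>. \<zeta> \<omega> * (real (total_increment a d \<omega>) * (real (total_increment a d \<omega>) - 1)))"
    unfolding eq using q by (intro Bochner_Integration.integrable_sum) auto
  have "expectation (\<lambda>\<omega>. \<Sum>j=1..p. \<Sum>k=1..p. q j k \<omega>) = (\<Sum>j=1..p. \<Sum>k=1..p. expectation (q j k))"
    using q by (subst Bochner_Integration.integral_sum, blast intro: Bochner_Integration.integrable_sum)
      (intro sum.cong refl Bochner_Integration.integral_sum, blast)
  also have "\<dots> = (\<Sum>j=1..p. \<Sum>k=1..p. expectation \<zeta> * d\<^sup>2)" using q by (intro sum.cong) auto
  finally show "expectation (\<lambda>\<omega>. \<zeta> \<omega> * (real (total_increment a d \<omega>) * (real (total_increment a d \<omega>) - 1))) = expectation \<zeta> * (real p * d)\<^sup>2"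
    unfolding eq by (simp add: power2_eq_square)
qed

lemma nat_factorial_moment_mono: "n \<le> m \<Longrightarrow> real n * (real n - 1) \<le> real m * (real m - 1)"
  by (cases n; cases m) (auto intro!: mult_mono)

text \<open>A strong Markov property for this moment: it does not change when the window starts at a
  random stopping vector, since the conditional mean is the same constant at all deterministic
  starts.\<close>

lemma stopped_total_increment_moment:
  assumes \<tau>: "stopped_measurable \<tau> (\<lambda>_. 1)" "\<And>k \<omega>. 0 \<le> \<tau> k \<omega>" "\<And>k \<omega>. \<tau> k \<omega> \<le> K" and d: "0 < d"
  defines "S \<equiv> \<lambda>\<omega>. real (total_increment (at_time \<tau> \<omega>) d \<omega>)"
  shows "integrable M (\<lambda>\<omega>. S \<omega> * (S \<omega> - 1))" "expectation (\<lambda>\<omega>. S \<omega> * (S \<omega> - 1)) = (real p * d)\<^sup>2"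
proof -
  define W where "W a \<omega> = real (total_increment a d \<omega>) * (real (total_increment a d \<omega>) - 1)" for a \<omega>
  have K0: "0 \<le> K" using \<tau>(2,3)[of 0 undefined] by linarith
  have W: "hist_mean (K + 1) 1 W (\<lambda>_. (real p * d)\<^sup>2)"
    unfolding hist_mean_def W_def using total_increment_moment[OF _ d] by blast
  have \<xi>: "\<bar>1 :: real\<bar> \<le> 1" by simp
  \<comment> \<open>Domination: every window of length \<open>d\<close> with start in
    \<open>[0, K + 1]\<close> lies in \<open>[0, K + 1 + d]\<close>.\<close>
  define V where "V \<omega> = real (total_increment (\<lambda>_. 0) (K + 1 + d) \<omega>) * (real (total_increment (\<lambda>_. 0) (K + 1 + d) \<omega>) - 1)" for \<omega>
  have V: "integrable M V"
    using total_increment_moment(1)[of "\<lambda>_. 0" "K + 1 + d" "\<lambda>_. 1" 1] K0 d by (simp add: V_def[abs_def])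
  have Vb: "\<forall>a \<omega>. (\<forall>k. 0 \<le> a k \<and> a k \<le> K + 1) \<longrightarrow> \<bar>W a \<omega>\<bar> \<le> V \<omega>"
  proof (intro allI impI)
    fix a :: "nat \<Rightarrow> real" and \<omega> assume a: "\<forall>k. 0 \<le> a k \<and> a k \<le> K + 1"
    have "total_increment a d \<omega> \<le> total_increment (\<lambda>_. 0) (K + 1 + d) \<omega>"
      unfolding total_increment_def
    proof (rule sum_mono)
      fix k assume k: "k \<in> {1..p}"
      show "Y k (a k + d) \<omega> - Y k (a k) \<omega> \<le> Y k (0 + (K + 1 + d)) \<omega> - Y k 0 \<omega>"
        using Y_nonpos[OF k, of 0 \<omega>] Y_mono[OF k, of "a k + d" "K + 1 + d" \<omega>] a[rule_format, of k] by simp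
    qed
    moreover have "0 \<le> W a \<omega>" unfolding W_def using nat_factorial_moment_mono[of 0 "total_increment a d \<omega>"] by simp
    ultimately show "\<bar>W a \<omega>\<bar> \<le> V \<omega>" unfolding W_def V_def using nat_factorial_moment_mono by simp
  qed
  have wb: "\<forall>a. (\<forall>k. 0 \<le> a k \<and> a k \<le> K + 1) \<longrightarrow> \<bar>(real p * d)\<^sup>2\<bar> \<le> (real p * d)\<^sup>2" by simp
  have W_lim: "(\<lambda>N. W (round_up (Suc N) \<tau> \<omega>) \<omega>) \<longlonglongrightarrow> W (at_time \<tau> \<omega>) \<omega>" for \<omega>
  proof (rule tendsto_eventually)
    have "\<forall>\<^sub>F N in sequentially. \<forall>k\<in>{1..p}. Y k (round_up (Suc N) \<tau> \<omega> k + d) \<omega> = Y k (\<tau> k \<omega> + d) \<omega> \<and> Y k (round_up (Suc N) \<tau> \<omega> k + 0) \<omega> = Y k (\<tau> k \<omega> + 0) \<omega>"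
      by (intro eventually_ball_finite ballI eventually_conj Y_round_up_eventually[where \<tau>=\<tau> and \<xi>="\<lambda>_. 1" and K=K and B=1 and W=W and w="\<lambda>_. (real p * d)\<^sup>2", OF \<tau> \<tau>(1) \<xi> W]) auto
    then show "\<forall>\<^sub>F N in sequentially. W (round_up (Suc N) \<tau> \<omega>) \<omega> = W (at_time \<tau> \<omega>) \<omega>"
    proof eventually_elim
      case (elim N)
      have "total_increment (round_up (Suc N) \<tau> \<omega>) d \<omega> = total_increment (at_time \<tau> \<omega>) d \<omega>"
        unfolding total_increment_def using elim by (intro sum.cong) (auto simp: at_time_def)
      then show ?case by (simp add: W_def)
    qed
  qed
  note S' = stopped_expectation[where \<tau>=\<tau> and \<xi>="\<lambda>_. 1" and K=K and B=1 and W=W and w="\<lambda>_. (real p * d)\<^sup>2" and V=V and c="(real p * d)\<^sup>2", OF \<tau> \<tau>(1) \<xi> W V Vb wb W_lim tendsto_const]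
  show "integrable M (\<lambda>\<omega>. S \<omega> * (S \<omega> - 1))" "expectation (\<lambda>\<omega>. S \<omega> * (S \<omega> - 1)) = (real p * d)\<^sup>2"
    using S' by (simp_all add: W_def S_def prob_space)
qed

end

section \<open>The random solution and its clocks\<close>

lemma step_path_stopped:
  assumes "step_path y" shows "step_path (\<lambda>s. y (min s c))"
  unfolding step_path_def
proof (intro conjI allI)
  have m: "mono y" using assms by (simp add: step_path_def)
  show "mono (\<lambda>s. y (min s c))"
    by (intro monoI monoD[OF m]) auto
  fix t
  show "\<forall>\<^sub>F s in at_right t. y (min s c) = y (min t c)"
  proof (cases "t < c")
    case True
    have "\<forall>\<^sub>F s in at_right t. s < c" using True by (intro eventually_at_rightI[of t c]) auto
    moreover have "\<forall>\<^sub>F s in at_right t. y s = y t" using assms by (simp add: step_path_def)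
    ultimately show ?thesis by eventually_elim (use True in simp)
  next
    case False
    have "\<forall>\<^sub>F s in at_right t. t < s" by (intro eventually_at_rightI[of t "t + 1"]) auto
    then show ?thesis by eventually_elim (use False in simp)
  qed
qed

lemma process_integral_measurable:
  fixes Z :: "real \<Rightarrow> 'w \<Rightarrow> 'b :: {second_countable_topology, metric_space}" and g :: "'b \<Rightarrow> real"
  assumes Z: "\<And>t. Z t \<in> borel_measurable N" "\<And>\<omega>. \<omega> \<in> space N \<Longrightarrow> right_cont (\<lambda>t. Z t \<omega>)"
    and g[measurable]: "g \<in> borel_measurable borel"
  shows "(\<lambda>\<omega>. LBINT s:{0..t}. g (Z s \<omega>)) \<in> borel_measurable N"
proof -
  have [measurable]: "(\<lambda>(t, \<omega>). Z t \<omega>) \<in> borel_measurable (borel \<Otimes>\<^sub>M N)"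
    by (rule right_cont_process_measurable[OF Z])
  have [measurable]: "(\<lambda>z. Z (snd z) (fst z)) \<in> borel_measurable (N \<Otimes>\<^sub>M lborel)"
    using measurable_compose[OF _ \<open>(\<lambda>(t, \<omega>). Z t \<omega>) \<in> _\<close>, of "\<lambda>z. (snd z, fst z)" "N \<Otimes>\<^sub>M lborel"] by simp
  have "(\<lambda>\<omega>. \<integral>s. (if 0 \<le> s \<and> s \<le> t then g (Z (snd (\<omega>, s)) (fst (\<omega>, s))) else 0) \<partial>lborel) \<in> borel_measurable N"
    by (rule lborel.borel_measurable_lebesgue_integral) measurable
  also have "(\<lambda>\<omega>. \<integral>s. (if 0 \<le> s \<and> s \<le> t then g (Z (snd (\<omega>, s)) (fst (\<omega>, s))) else 0) \<partial>lborel) = (\<lambda>\<omega>. LBINT s:{0..t}. g (Z s \<omega>))"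
    unfolding set_lebesgue_integral_def by (auto simp: fun_eq_iff indicator_def intro!: Bochner_Integration.integral_cong)
  finally show ?thesis .
qed

context time_change
begin

lemma solves_upto_cong:
  assumes x: "x \<in> borel_measurable borel" and sol: "solves_upto y x0 t x"
    and eq: "\<And>k r. k \<in> {1..p} \<Longrightarrow> r \<le> clock x k t \<Longrightarrow> y k r = y' k r"
  shows "solves_upto y' x0 t x"
  unfolding solves_upto_def
proof
  fix s assume s: "s \<in> {0..t}"
  have "(\<Sum>k=1..p. real (y k (clock x k s)) *\<^sub>R \<nu> k) = (\<Sum>k=1..p. real (y' k (clock x k s)) *\<^sub>R \<nu> k)"
    using clock_mono[OF x, of s t] s eq by (intro sum.cong refl) auto
  then show "x s = x0 + (LBINT r:{0..s}. f (x r)) + (\<Sum>k=1..p. real (y' k (clock x k s)) *\<^sub>R \<nu> k)"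
    using sol s unfolding solves_upto_def by metis
qed

text \<open>The solution driven by \<open>y\<close> reads its paths only up to its own clocks, so it
  also solves the equation driven by \<open>y'\<close>, and uniqueness applies. Clocks of only one
  of the two solutions enter, so the roles can be exchanged.\<close>

lemma solution_agree:
  assumes y: "\<And>k. k \<in> {1..p} \<Longrightarrow> step_path (y k)" "\<And>k. k \<in> {1..p} \<Longrightarrow> step_path (y' k)"
    and eq: "\<And>k r. k \<in> {1..p} \<Longrightarrow> r \<le> clock (solution y x0) k t \<Longrightarrow> y k r = y' k r"
    and s: "s \<in> {0..t}"
  shows "solution y x0 s = solution y' x0 s"
proof (rule solves_upto_unique[of y' "solution y x0" "solution y' x0" x0 t])
  have "solution y x0 \<in> borel_measurable borel" by (rule solution_measurable) (rule y(1))
  then show "solves_upto y' x0 t (solution y x0)"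
    by (rule solves_upto_cong[OF _ solution_solves]) (use y eq in auto)
  show "solution y x0 \<in> borel_measurable borel" "solution y' x0 \<in> borel_measurable borel"
    using y by (auto intro: solution_measurable)
  show "solves_upto y' x0 t (solution y' x0)" by (rule solution_solves) (rule y(2))
qed (use y s in auto)

end

locale driven_process = time_change p f lam \<nu> L C R + poisson_family M p Y X0
  for p and f :: "real ^ 'd \<Rightarrow> real ^ 'd" and lam \<nu> L C R and M :: "'w measure" and Y and X0 :: "'w \<Rightarrow> real ^ 'd"
begin

definition X :: "real \<Rightarrow> 'w \<Rightarrow> real ^ 'd" where
  "X t \<omega> = solution (\<lambda>k s. Y k s \<omega>) (X0 \<omega>) t"

definition stoppedX :: "(nat \<Rightarrow> real) \<Rightarrow> real \<Rightarrow> 'w \<Rightarrow> real ^ 'd" where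
  "stoppedX a t \<omega> = solution (\<lambda>k s. Y k (min s (a k)) \<omega>) (X0 \<omega>) t"

definition tau :: "real \<Rightarrow> nat \<Rightarrow> 'w \<Rightarrow> real" where
  "tau t k \<omega> = clock (\<lambda>s. X s \<omega>) k t"

lemma X_eq_solution: "(\<lambda>s. X s \<omega>) = solution (\<lambda>k s. Y k s \<omega>) (X0 \<omega>)"
  by (simp add: X_def)

lemma stoppedX_eq_solution: "(\<lambda>s. stoppedX a s \<omega>) = solution (\<lambda>k s. Y k (min s (a k)) \<omega>) (X0 \<omega>)"
  by (simp add: stoppedX_def)

lemma Y_stopped_step: "k \<in> {1..p} \<Longrightarrow> step_path (\<lambda>s. Y k (min s (a k)) \<omega>)"
  by (rule step_path_stopped[OF Y_step])

lemma X_right_cont: "right_cont (\<lambda>t. X t \<omega>)"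
  unfolding X_eq_solution by (rule solution_right_cont) (rule Y_step)

lemma stoppedX_right_cont: "right_cont (\<lambda>t. stoppedX a t \<omega>)"
  unfolding stoppedX_eq_solution by (rule solution_right_cont) (rule Y_stopped_step)

lemma X_path_measurable [measurable]: "(\<lambda>t. X t \<omega>) \<in> borel_measurable borel"
  by (rule right_cont_borel_measurable[OF X_right_cont])

lemma X_solves: "solves_upto (\<lambda>k s. Y k s \<omega>) (X0 \<omega>) t (\<lambda>s. X s \<omega>)"
  unfolding X_eq_solution by (rule solution_solves) (rule Y_step)

lemma X_measurable [measurable]: "X t \<in> borel_measurable M"
proof -
  have "(\<lambda>\<omega>. solution (\<lambda>k s. Y k s \<omega>) (X0 \<omega>) t) \<in> borel_measurable M"
    by (rule solution_random_measurable) (auto intro: Y_step Y_measurable)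
  then show ?thesis by (simp add: X_def[abs_def])
qed

text \<open>A path frozen at \<open>a k\<close> is read at times up to \<open>a k\<close> only, so
  the solution functional can be evaluated with \<open>hist a\<close> as its sigma-algebra.\<close>

lemma stoppedX_hist_measurable:
  assumes "\<And>k. 0 \<le> a k" shows "stoppedX a t \<in> borel_measurable (hist a)"
proof -
  have "(\<lambda>\<omega>. solution (\<lambda>k s. Y k (min s (a k)) \<omega>) (X0 \<omega>) t) \<in> borel_measurable (hist a)"
  proof (rule solution_random_measurable[of "hist a" "\<lambda>k s. Y k (min s (a k))"])
    fix k s assume k: "k \<in> {1..p}"
    show "Y k (min s (a k)) \<in> measurable (hist a) (count_space UNIV)"
    proof (cases "min s (a k) \<le> 0")
      case True
      then have "Y k (min s (a k)) = (\<lambda>_. 0)" using Y_nonpos[OF k] by auto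
      then show ?thesis by simp
    next
      case False
      then show ?thesis by (intro Y_hist_measurable k) auto
    qed
  qed (auto intro: Y_stopped_step X0_hist_measurable)
  then show ?thesis by (simp add: stoppedX_def[abs_def])
qed

lemma stoppedX_agree:
  assumes "(\<forall>k\<in>{1..p}. tau t k \<omega> \<le> a k) \<or> (\<forall>k\<in>{1..p}. clock (\<lambda>s. stoppedX a s \<omega>) k t \<le> a k)" and s: "s \<in> {0..t}"
  shows "X s \<omega> = stoppedX a s \<omega>"
  using assms(1)
proof
  assume *: "\<forall>k\<in>{1..p}. tau t k \<omega> \<le> a k"
  show ?thesis unfolding X_def stoppedX_def
  proof (rule solution_agree[OF _ _ _ s])
    fix k r assume k: "k \<in> {1..p}" "r \<le> clock (solution (\<lambda>k s. Y k s \<omega>) (X0 \<omega>)) k t"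
    then have "r \<le> a k" using * unfolding tau_def X_eq_solution by (meson order_trans)
    then show "Y k r \<omega> = Y k (min r (a k)) \<omega>" by simp
  qed (auto intro: Y_step Y_stopped_step)
next
  assume *: "\<forall>k\<in>{1..p}. clock (\<lambda>s. stoppedX a s \<omega>) k t \<le> a k"
  show ?thesis unfolding X_def stoppedX_def
  proof (rule solution_agree[OF _ _ _ s, symmetric])
    fix k r assume k: "k \<in> {1..p}" "r \<le> clock (solution (\<lambda>k s. Y k (min s (a k)) \<omega>) (X0 \<omega>)) k t"
    then have "r \<le> a k" using * unfolding stoppedX_eq_solution by (meson order_trans)
    then show "Y k (min r (a k)) \<omega> = Y k r \<omega>" by simp
  qed (auto intro: Y_step Y_stopped_step)
qed

lemma tau_stoppedX:
  "(\<forall>k\<in>{1..p}. tau t k \<omega> \<le> a k) \<longleftrightarrow> (\<forall>k\<in>{1..p}. clock (\<lambda>s. stoppedX a s \<omega>) k t \<le> a k)"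
proof -
  have "tau t k \<omega> = clock (\<lambda>s. stoppedX a s \<omega>) k t"
    if "(\<forall>k\<in>{1..p}. tau t k \<omega> \<le> a k) \<or> (\<forall>k\<in>{1..p}. clock (\<lambda>s. stoppedX a s \<omega>) k t \<le> a k)" for k
    unfolding tau_def clock_def using stoppedX_agree[OF that] by (intro integral_Icc_cong) simp
  then show ?thesis by auto
qed

lemma clock_stoppedX_measurable:
  assumes "\<And>k. 0 \<le> a k" shows "(\<lambda>\<omega>. clock (\<lambda>s. stoppedX a s \<omega>) k t) \<in> borel_measurable (hist a)"
  unfolding clock_def
  by (rule process_integral_measurable) (auto intro: stoppedX_hist_measurable assms stoppedX_right_cont)

lemma tau_measurable [measurable]: "tau t k \<in> borel_measurable M"
proof -
  have "(\<lambda>\<omega>. clock (\<lambda>s. X s \<omega>) k t) \<in> borel_measurable M"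
    unfolding clock_def by (rule process_integral_measurable) (auto intro: X_right_cont)
  then show ?thesis by (simp add: tau_def[abs_def])
qed

lemma below_tau_hist:
  assumes "\<And>k. 0 \<le> a k" shows "below (tau t) a \<in> sets (hist a)"
proof -
  have "{\<omega>\<in>space (hist a). clock (\<lambda>s. stoppedX a s \<omega>) k t \<le> a k} \<in> sets (hist a)" for k
    using clock_stoppedX_measurable[where a=a and t=t and k=k, OF assms] unfolding borel_measurable_iff_le by blast
  then have "{\<omega>\<in>space (hist a). \<forall>k\<in>{1..p}. clock (\<lambda>s. stoppedX a s \<omega>) k t \<le> a k} \<in> sets (hist a)"
    by (intro sets.sets_Collect_finite_All) auto
  then show ?thesis unfolding below_def tau_stoppedX by simp
qed

lemma X_on_below:
  assumes "\<omega> \<in> below (tau t) a" "s \<in> {0..t}" shows "X s \<omega> = stoppedX a s \<omega>"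
  using assms by (intro stoppedX_agree) (auto simp: below_def)

text \<open>On \<open>below (tau t) a\<close> the solution up to time \<open>t\<close> equals the
  one driven by frozen paths, which \<open>hist a\<close> determines.\<close>

lemma stopped_measurable_X:
  assumes s: "s \<in> {0..t}" and h: "h \<in> borel_measurable borel"
  shows "stopped_measurable (tau t) (\<lambda>\<omega>. h (X s \<omega>))"
  unfolding stopped_measurable_def
proof (intro allI impI)
  fix a :: "nat \<Rightarrow> real" assume a: "\<forall>k. 0 \<le> a k"
  have "(\<lambda>\<omega>. indicator (below (tau t) a) \<omega> * h (stoppedX a s \<omega>)) \<in> borel_measurable (hist a)"
    using a by (intro borel_measurable_times borel_measurable_indicator below_tau_hist
        measurable_compose[OF stoppedX_hist_measurable h]) auto
  also have "(\<lambda>\<omega>. indicator (below (tau t) a) \<omega> * h (stoppedX a s \<omega>)) = (\<lambda>\<omega>. indicator (below (tau t) a) \<omega> * h (X s \<omega>))"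
    using X_on_below[OF _ s] by (auto simp: indicator_def fun_eq_iff)
  finally show "(\<lambda>\<omega>. indicator (below (tau t) a) \<omega> * h (X s \<omega>)) \<in> borel_measurable (hist a)" .
qed

lemma stopped_measurable_one: "0 \<le> t \<Longrightarrow> stopped_measurable (tau t) (\<lambda>_. 1)"
  using stopped_measurable_X[of 0 t "\<lambda>_. 1"] by simp

lemma sets_natural_filtration:
  "sets (natural_filtration M Z t) = sigma_sets (space M) (\<Union>s\<in>{0..t}. {Z s -` A \<inter> space M | A. A \<in> sets borel})"
  unfolding natural_filtration_def by (rule sets_measure_of) auto

lemma stopped_measurable_natural:
  assumes A: "A \<in> sets (natural_filtration M X s)" and s: "s \<le> t"
  shows "stopped_measurable (tau t) (indicator A)"
proof -
  have "\<forall>a. (\<forall>k. 0 \<le> a k) \<longrightarrow> A \<inter> below (tau t) a \<in> sets (hist a)"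
    using A unfolding sets_natural_filtration
  proof (induction rule: sigma_sets.induct)
    case (Basic A)
    then obtain r B where rB: "r \<in> {0..s}" "B \<in> sets borel" "A = X r -` B \<inter> space M" by auto
    show ?case
    proof (intro allI impI)
      fix a :: "nat \<Rightarrow> real" assume a: "\<forall>k. 0 \<le> a k"
      have "(stoppedX a r -` B \<inter> space (hist a)) \<inter> below (tau t) a \<in> sets (hist a)"
        using a by (intro sets.Int measurable_sets[OF stoppedX_hist_measurable rB(2)] below_tau_hist) auto
      also have "(stoppedX a r -` B \<inter> space (hist a)) \<inter> below (tau t) a = A \<inter> below (tau t) a"
        using X_on_below[of _ t a r] rB(1) s unfolding rB(3) by auto
      finally show "A \<inter> below (tau t) a \<in> sets (hist a)" .
    qed
  next
    case Empty then show ?case by simp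
  next
    case (Compl A)
    show ?case
    proof (intro allI impI)
      fix a :: "nat \<Rightarrow> real" assume a: "\<forall>k. 0 \<le> a k"
      have "below (tau t) a - (A \<inter> below (tau t) a) \<in> sets (hist a)"
        using a Compl by (intro sets.Diff below_tau_hist) auto
      also have "below (tau t) a - (A \<inter> below (tau t) a) = (space M - A) \<inter> below (tau t) a"
        by (auto simp: below_def)
      finally show "(space M - A) \<inter> below (tau t) a \<in> sets (hist a)" .
    qed
  next
    case (Union A)
    show ?case
    proof (intro allI impI)
      fix a :: "nat \<Rightarrow> real" assume a: "\<forall>k. 0 \<le> a k"
      have "(\<Union>i. A i \<inter> below (tau t) a) \<in> sets (hist a)"
        using a Union by (intro sets.countable_UN) auto
      then show "(\<Union>i. A i) \<inter> below (tau t) a \<in> sets (hist a)" by simp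
    qed
  qed
  moreover have "indicator (below (tau t) a) \<omega> * indicator A \<omega> = (indicator (A \<inter> below (tau t) a) \<omega> :: real)" for a \<omega>
    by (auto simp: indicator_def)
  ultimately show ?thesis unfolding stopped_measurable_def by (auto intro!: borel_measurable_indicator)
qed

end

section \<open>Functions with bounded continuous first derivatives\<close>

lemma C1b_has_derivative:
  fixes F :: "real ^ 'd \<Rightarrow> real"
  assumes "C1b F" shows "(F has_derivative grad_apply F x) (at x)"
proof -
  obtain D where D: "(F has_derivative D) (at x)"
    using assms by (auto simp: C1b_def differentiable_on_def differentiable_def)
  interpret D: bounded_linear D using D by (rule has_derivative_bounded_linear)
  \<comment> \<open>Restricting the total derivative to coordinate lines identifies the partial
    derivatives, so \<open>grad_apply\<close> is that derivative written in coordinates.\<close>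
  have "partial_derivative F j x = D (axis j 1)" for j
  proof -
    have "((\<lambda>h. x + h *\<^sub>R axis j 1) has_derivative (\<lambda>h. h *\<^sub>R axis j 1)) (at 0)"
      by (auto intro!: derivative_eq_intros)
    from has_derivative_compose[OF this, of F D] D
    have "((\<lambda>h. F (x + h *\<^sub>R axis j 1)) has_derivative (\<lambda>h. D (h *\<^sub>R axis j 1))) (at 0)" by simp
    then have "((\<lambda>h. F (x + h *\<^sub>R axis j 1)) has_real_derivative D (axis j 1)) (at 0)"
      unfolding has_field_derivative_def by (simp add: D.scaleR mult_commute_abs)
    then show ?thesis unfolding partial_derivative_def by (rule DERIV_imp_deriv)
  qed
  then have "grad_apply F x v = D v" for v
  proof -
    have "(\<Sum>j\<in>UNIV. v $ j *\<^sub>R axis j 1) = v" using basis_expansion[of v] by (simp add: scalar_mult_eq_scaleR)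
    then have "D v = D (\<Sum>j\<in>UNIV. v $ j *\<^sub>R axis j 1)" by (simp only:)
    then show ?thesis using \<open>\<And>j. partial_derivative F j x = D (axis j 1)\<close>
      by (simp add: grad_apply_def D.sum D.scaleR mult.commute)
  qed
  then have "grad_apply F x = D" by auto
  then show ?thesis using D by simp
qed

lemma C1b_grad_bound:
  fixes F :: "real ^ 'd \<Rightarrow> real"
  assumes "C1b F" shows "\<exists>K\<ge>0. \<forall>x v. \<bar>grad_apply F x v\<bar> \<le> K * norm v"
proof -
  have "\<forall>j. \<exists>K. \<forall>x. \<bar>partial_derivative F j x\<bar> \<le> K"
    using assms by (auto simp: C1b_def bounded_iff)
  then obtain K where K: "\<And>j x. \<bar>partial_derivative F j x\<bar> \<le> K j" by metis
  have K0: "0 \<le> K j" for j using K[of j undefined] by (meson abs_ge_zero order_trans)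
  show ?thesis
  proof (intro exI[of _ "\<Sum>j\<in>UNIV. K j"] conjI allI)
    show "0 \<le> (\<Sum>j\<in>UNIV. K j)" by (intro sum_nonneg K0)
    fix x v
    have "\<bar>grad_apply F x v\<bar> \<le> (\<Sum>j\<in>UNIV. \<bar>partial_derivative F j x * v $ j\<bar>)"
      unfolding grad_apply_def by (rule sum_abs)
    also have "\<dots> \<le> (\<Sum>j\<in>UNIV. K j * norm v)"
      unfolding abs_mult by (intro sum_mono mult_mono K component_le_norm_cart K0) auto
    finally show "\<bar>grad_apply F x v\<bar> \<le> (\<Sum>j\<in>UNIV. K j) * norm v" by (simp add: sum_distrib_right)
  qed
qed

lemma C1b_lipschitz:
  fixes F :: "real ^ 'd \<Rightarrow> real"
  assumes "C1b F" shows "\<exists>K\<ge>0. \<forall>x y. \<bar>F x - F y\<bar> \<le> K * norm (x - y)"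
proof -
  obtain K where K: "K \<ge> 0" "\<And>x v. \<bar>grad_apply F x v\<bar> \<le> K * norm v" using C1b_grad_bound[OF assms] by auto
  have "norm (F x - F y) \<le> K * norm (x - y)" for x y
  proof (rule differentiable_bound[of UNIV F "grad_apply F" K x y])
    show "onorm (grad_apply F x) \<le> K" for x
      by (rule onorm_le) (use K in \<open>simp add: real_norm_def\<close>)
  qed (auto intro: C1b_has_derivative[OF assms] has_derivative_at_withinI)
  then show ?thesis using K(1) by auto
qed

lemma C1b_bounded: "C1b F \<Longrightarrow> \<exists>B\<ge>0. \<forall>x. \<bar>F x\<bar> \<le> B"
  unfolding C1b_def bounded_iff by (metis UNIV_I abs_ge_zero image_eqI order_trans real_norm_def)

lemma C1b_continuous: "C1b F \<Longrightarrow> continuous_on UNIV F"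
  unfolding C1b_def by (auto intro: differentiable_imp_continuous_on)

lemma C1b_grad_continuous:
  assumes "C1b F" "continuous_on UNIV g" shows "continuous_on UNIV (\<lambda>x. grad_apply F x (g x))"
proof -
  have c: "continuous_on UNIV (\<lambda>x. partial_derivative F j x)" for j using assms(1) unfolding C1b_def by auto
  show ?thesis unfolding grad_apply_def by (intro continuous_intros c assms(2))
qed

section \<open>Short-time increments\<close>

text \<open>The factor \<open>S (S - 1)\<close> vanishes unless there are several jumps, and its mean over a time
  step \<open>h\<close> is \<open>O(h\<^sup>2)\<close>.\<close>

lemma multi_jump_bound:
  fixes F :: "'a :: real_vector \<Rightarrow> real" and n :: "nat \<Rightarrow> nat"
  assumes F: "\<And>x. \<bar>F x\<bar> \<le> B" and I: "finite I"
  defines "S \<equiv> real (\<Sum>k\<in>I. n k)"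
  shows "\<bar>F (x + (\<Sum>k\<in>I. real (n k) *\<^sub>R v k)) - F x - (\<Sum>k\<in>I. real (n k) * (F (x + v k) - F x))\<bar> \<le> 4 * B * (S * (S - 1))"
proof -
  have B: "0 \<le> B" using F abs_ge_zero order_trans by blast
  consider "(\<Sum>k\<in>I. n k) = 0" | "(\<Sum>k\<in>I. n k) = 1" | "2 \<le> (\<Sum>k\<in>I. n k)" by linarith
  then show ?thesis
  proof cases
    case 1
    then have "n k = 0" if "k \<in> I" for k using that I by simp
    then show ?thesis using 1 by (simp add: S_def)
  next
    case 2
    then obtain j where j: "j \<in> I" "n j = 1" "\<And>k. k \<in> I \<Longrightarrow> k \<noteq> j \<Longrightarrow> n k = 0"
      using sum_eq_1_iff[OF I, of n] by auto
    have "(\<Sum>k\<in>I. real (n k) *\<^sub>R v k) = (\<Sum>k\<in>{j}. real (n k) *\<^sub>R v k)"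
      "(\<Sum>k\<in>I. real (n k) * (F (x + v k) - F x)) = (\<Sum>k\<in>{j}. real (n k) * (F (x + v k) - F x))"
      using j I by (intro sum.mono_neutral_right; auto)+
    then show ?thesis using j(2) 2 by (simp add: S_def)
  next
    case 3
    then have S2: "2 \<le> S" unfolding S_def by (metis of_nat_le_iff of_nat_numeral)
    have *: "\<bar>F a - F b\<bar> \<le> 2 * B" for a b using F[of a] F[of b] by linarith
    have "\<bar>\<Sum>k\<in>I. real (n k) * (F (x + v k) - F x)\<bar> \<le> (\<Sum>k\<in>I. real (n k) * (2 * B))"
      by (rule order_trans[OF sum_abs]) (auto intro!: sum_mono mult_left_mono * simp: abs_mult)
    also have "\<dots> = 2 * B * S" by (simp add: S_def sum_distrib_right[symmetric])
    finally have "\<bar>F (x + (\<Sum>k\<in>I. real (n k) *\<^sub>R v k)) - F x - (\<Sum>k\<in>I. real (n k) * (F (x + v k) - F x))\<bar> \<le> 2 * B + 2 * B * S"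
      using *[of "x + (\<Sum>k\<in>I. real (n k) *\<^sub>R v k)" x] by linarith
    \<comment> \<open>For \<open>S \<ge> 2\<close> both 2 and \<open>S\<close> are at most
      \<open>S (S - 1)\<close>, which leaves room under the factor 4.\<close>
    also have "\<dots> \<le> 4 * B * (S * (S - 1))"
    proof -
      have "S * 1 \<le> S * (S - 1)" using S2 by (intro mult_left_mono) auto
      then have "2 + 2 * S \<le> 4 * (S * (S - 1))" using S2 by linarith
      from mult_left_mono[OF this B] show ?thesis by (simp add: algebra_simps)
    qed
    finally show ?thesis .
  qed
qed

context driven_process
begin

lemma tau_nonneg: "0 \<le> t \<Longrightarrow> 0 \<le> tau t k \<omega>"
  unfolding tau_def by (rule clock_nonneg[OF X_path_measurable])

lemma tau_le: "0 \<le> t \<Longrightarrow> tau t k \<omega> \<le> R * t"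
  unfolding tau_def using clock_le[OF X_path_measurable[of \<omega>], of 0 t k] clock_0[OF X_path_measurable[of \<omega>], of k] by simp

lemma tau_diff: "0 \<le> s \<Longrightarrow> s \<le> t \<Longrightarrow> tau t k \<omega> - tau s k \<omega> = (LBINT r:{s..t}. lam k (X r \<omega>))"
  unfolding tau_def using clock_diff[OF X_path_measurable[of \<omega>], of s t k] by simp

lemma tau_mono: "0 \<le> s \<Longrightarrow> s \<le> t \<Longrightarrow> tau s k \<omega> \<le> tau t k \<omega>"
  unfolding tau_def by (rule clock_mono[OF X_path_measurable])

lemma tau_increment_le: "0 \<le> s \<Longrightarrow> s \<le> t \<Longrightarrow> tau t k \<omega> \<le> tau s k \<omega> + R * (t - s)"
  unfolding tau_def by (rule clock_le[OF X_path_measurable])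

definition jumps :: "real \<Rightarrow> nat \<Rightarrow> 'w \<Rightarrow> nat" where
  "jumps t k \<omega> = Y k (tau t k \<omega>) \<omega>"

lemma jumps_measurable: "k \<in> {1..p} \<Longrightarrow> (\<lambda>\<omega>. real (jumps t k \<omega>)) \<in> borel_measurable M"
  unfolding jumps_def by (rule Y_joint_measurable[where N=M and Y=Y and ?X0.0=X0]) (auto intro: Y_step Y_measurable)

lemma jumps_mono: "k \<in> {1..p} \<Longrightarrow> 0 \<le> s \<Longrightarrow> s \<le> t \<Longrightarrow> jumps s k \<omega> \<le> jumps t k \<omega>"
  unfolding jumps_def by (intro Y_mono tau_mono)

definition displacement :: "real \<Rightarrow> real \<Rightarrow> 'w \<Rightarrow> real ^ 'd" where
  "displacement t h \<omega> = (\<Sum>k=1..p. real (jumps (t + h) k \<omega> - jumps t k \<omega>) *\<^sub>R \<nu> k)"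

lemma X_increment:
  assumes "0 \<le> t" "0 \<le> h"
  shows "X (t + h) \<omega> = X t \<omega> + displacement t h \<omega> + (LBINT r:{t..t+h}. f (X r \<omega>))"
proof -
  have eq: "X s \<omega> = X0 \<omega> + (LBINT r:{0..s}. f (X r \<omega>)) + (\<Sum>k=1..p. real (jumps s k \<omega>) *\<^sub>R \<nu> k)" if "0 \<le> s" for s
    using X_solves[of \<omega> s] that unfolding solves_upto_def jumps_def tau_def by simp
  have "(LBINT r:{0..t+h}. f (X r \<omega>)) = (LBINT r:{0..t}. f (X r \<omega>)) + (LBINT r:{t..t+h}. f (X r \<omega>))"
    using assms f_bounded by (intro integral_Icc_split[of _ C]) auto
  moreover have "(\<Sum>k=1..p. real (jumps (t + h) k \<omega>) *\<^sub>R \<nu> k) = (\<Sum>k=1..p. real (jumps t k \<omega>) *\<^sub>R \<nu> k) + displacement t h \<omega>"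
    unfolding displacement_def sum.distrib[symmetric]
    using jumps_mono assms by (intro sum.cong refl) (simp add: scaleR_add_left[symmetric] of_nat_diff)
  ultimately show ?thesis using eq[of t] eq[of "t + h"] assms by simp
qed

lemma displacement_measurable [measurable]: "displacement t h \<in> borel_measurable M" if "0 \<le> t" "0 \<le> h"
proof -
  have eq: "displacement t h = (\<lambda>\<omega>. \<Sum>k=1..p. (real (jumps (t + h) k \<omega>) - real (jumps t k \<omega>)) *\<^sub>R \<nu> k)"
    unfolding displacement_def using jumps_mono[of _ t "t + h"] that by (auto intro!: sum.cong simp: of_nat_diff)
  show ?thesis unfolding eq
    by (intro borel_measurable_sum borel_measurable_scaleR borel_measurable_diff jumps_measurable) auto
qed

text \<open>Each path is free of jumps for some time after \<open>t\<close>. How long depends on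
  \<open>\<omega>\<close>, so the fact enters a pointwise limit and not a uniform bound.\<close>

lemma displacement_eventually_0:
  assumes "0 \<le> t" shows "\<forall>\<^sub>F h in at_right 0. displacement t h \<omega> = 0"
proof -
  have "\<exists>d>0. \<forall>k\<in>{1..p}. \<forall>s. t \<le> s \<and> s < t + d \<longrightarrow> jumps s k \<omega> = jumps t k \<omega>"
    unfolding jumps_def tau_def
    by (rule clock_const_right[where y="\<lambda>k s. Y k s \<omega>", OF X_path_measurable _ assms]) (rule Y_step)
  then obtain d where d: "d > 0" "\<And>k s. k \<in> {1..p} \<Longrightarrow> t \<le> s \<Longrightarrow> s < t + d \<Longrightarrow> jumps s k \<omega> = jumps t k \<omega>"
    by blast
  have "displacement t h \<omega> = 0" if "0 < h" "h < d" for h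
    unfolding displacement_def
  proof (rule sum.neutral, rule ballI)
    fix k assume k: "k \<in> {1..p}"
    have "jumps (t + h) k \<omega> = jumps t k \<omega>" by (rule d(2)[OF k]) (use that in auto)
    then show "real (jumps (t + h) k \<omega> - jumps t k \<omega>) *\<^sub>R \<nu> k = 0" by simp
  qed
  then show ?thesis using d(1) by (intro eventually_at_rightI[of 0 d]) auto
qed

text \<open>Clocks advance by at most \<open>R * h\<close>, so all jumps fall into the larger
  window; its length \<open>(R + 1) * h\<close> is positive even for \<open>R = 0\<close>, as the
  moment formula requires.\<close>

lemma jump_count_le:
  assumes "0 \<le> t" "0 < h"
  shows "(\<Sum>k=1..p. jumps (t + h) k \<omega> - jumps t k \<omega>) \<le> total_increment (at_time (tau t) \<omega>) ((R + 1) * h) \<omega>"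
  unfolding total_increment_def jumps_def
proof (rule sum_mono)
  fix k assume k: "k \<in> {1..p}"
  have "tau (t + h) k \<omega> \<le> tau t k \<omega> + (R + 1) * h"
    using tau_increment_le[of t "t + h" k \<omega>] assms by (simp add: algebra_simps)
  then show "Y k (tau (t + h) k \<omega>) \<omega> - Y k (tau t k \<omega>) \<omega> \<le> Y k (at_time (tau t) \<omega> k + (R + 1) * h) \<omega> - Y k (at_time (tau t) \<omega> k) \<omega>"
    using Y_mono[OF k, of "tau (t + h) k \<omega>" "tau t k \<omega> + (R + 1) * h" \<omega>] k by (simp add: at_time_def)
qed

end

locale test_function = driven_process p f lam \<nu> L C R M Y X0
  for p and f :: "real ^ 'd \<Rightarrow> real ^ 'd" and lam \<nu> L C R and M :: "'w measure" and Y and X0 :: "'w \<Rightarrow> real ^ 'd" +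
  fixes F :: "real ^ 'd \<Rightarrow> real" and B K :: real
  assumes F: "C1b F" and F_bound: "\<And>x. \<bar>F x\<bar> \<le> B" and F_lipschitz: "\<And>x y. \<bar>F x - F y\<bar> \<le> K * norm (x - y)" and K_nonneg: "0 \<le> K"
begin

abbreviation "G \<equiv> generator p f lam \<nu> F"

lemma F_continuous: "continuous_on UNIV F" by (rule C1b_continuous[OF F])

lemma F_measurable [measurable]: "F \<in> borel_measurable borel"
  by (rule borel_measurable_continuous_onI[OF F_continuous])

lemma B_nonneg: "0 \<le> B" using F_bound abs_ge_zero order_trans by blast

lemma G_continuous: "continuous_on UNIV G"
  unfolding generator_def
  by (intro continuous_intros C1b_grad_continuous F f_continuous lam_continuous
      continuous_on_compose2[OF F_continuous] F_continuous) auto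

lemma G_measurable [measurable]: "G \<in> borel_measurable borel"
  by (rule borel_measurable_continuous_onI[OF G_continuous])

lemma F_diff_le: "\<bar>F x - F y\<bar> \<le> 2 * B"
  using F_bound[of x] F_bound[of y] by linarith

lemma jump_rate_le: "\<bar>\<Sum>k=1..p. lam k x * (F (y + \<nu> k) - F y)\<bar> \<le> real p * (R * (2 * B))"
proof -
  have "\<bar>\<Sum>k=1..p. lam k x * (F (y + \<nu> k) - F y)\<bar> \<le> (\<Sum>k=1..p. \<bar>lam k x * (F (y + \<nu> k) - F y)\<bar>)" by (rule sum_abs)
  also have "\<dots> \<le> (\<Sum>k=1..p. R * (2 * B))"
    unfolding abs_mult using lam_nonneg lam_le R_nonneg F_diff_le by (intro sum_mono mult_mono) auto
  finally show ?thesis by simp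
qed

lemma G_bounded: "\<exists>c\<ge>0. \<forall>x. \<bar>G x\<bar> \<le> c"
proof -
  obtain D where D: "D \<ge> 0" "\<And>x v. \<bar>grad_apply F x v\<bar> \<le> D * norm v" using C1b_grad_bound[OF F] by auto
  have "\<bar>G x\<bar> \<le> D * C + real p * (R * (2 * B))" for x
  proof -
    have "\<bar>grad_apply F x (f x)\<bar> \<le> D * C" using D(2)[of x "f x"] mult_left_mono[OF f_bounded[of x] D(1)] by linarith
    then show ?thesis unfolding generator_def using jump_rate_le[of x x] by linarith
  qed
  then show ?thesis by (meson abs_ge_zero order_trans)
qed

definition c :: real where "c = (SOME c. c \<ge> 0 \<and> (\<forall>x. \<bar>G x\<bar> \<le> c))"

lemma G_le: "0 \<le> c" "\<bar>G x\<bar> \<le> c"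
  using someI_ex[OF G_bounded] unfolding c_def by auto

definition Z :: "real \<Rightarrow> 'w \<Rightarrow> real" where
  "Z t \<omega> = F (X t \<omega>) - F (X 0 \<omega>) - (LBINT s:{0..t}. G (X s \<omega>))"

lemma Z_measurable [measurable]: "Z t \<in> borel_measurable M"
proof -
  have [measurable]: "(\<lambda>\<omega>. LBINT s:{0..t}. G (X s \<omega>)) \<in> borel_measurable M"
    by (rule process_integral_measurable) (auto intro: X_right_cont)
  show ?thesis unfolding Z_def[abs_def] by measurable
qed

lemma Z_bound: "0 \<le> t \<Longrightarrow> \<bar>Z t \<omega>\<bar> \<le> 2 * B + c * t"
  using norm_integral_Icc_le[of "\<lambda>s. G (X s \<omega>)" c 0 t] G_le F_diff_le[of "X t \<omega>" "X 0 \<omega>"] unfolding Z_def by simp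

lemma Z_integrable: "0 \<le> t \<Longrightarrow> integrable M (Z t)"
  using Z_bound by (intro integrable_const_bound[of _ "2 * B + c * t"]) auto

text \<open>The part of the increment of \<^term>\<open>Z\<close> left over once the jumps are compensated and
  multiple jumps are discarded.\<close>

definition V :: "real \<Rightarrow> real \<Rightarrow> 'w \<Rightarrow> real" where
  "V t h \<omega> = F (X (t + h) \<omega>) - F (X t \<omega> + displacement t h \<omega>)
     + (\<Sum>k=1..p. (F (X t \<omega> + \<nu> k) - F (X t \<omega>)) * (tau (t + h) k \<omega> - tau t k \<omega>))
     - (LBINT s:{t..t+h}. G (X s \<omega>))"

lemma V_measurable: "V t h \<in> borel_measurable M" if "0 \<le> t" "0 \<le> h"
proof -
  have [measurable]: "displacement t h \<in> borel_measurable M" by (rule displacement_measurable[OF that])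
  have eq: "(LBINT s:{t..t+h}. G (X s \<omega>)) = (LBINT s:{0..t+h}. G (X s \<omega>)) - (LBINT s:{0..t}. G (X s \<omega>))" for \<omega>
    using integral_Icc_split[of "\<lambda>s. G (X s \<omega>)" c 0 t "t + h"] G_le that by simp
  have [measurable]: "(\<lambda>\<omega>. LBINT s:{0..t}. G (X s \<omega>)) \<in> borel_measurable M" for t
    by (rule process_integral_measurable) (auto intro: X_right_cont)
  show ?thesis unfolding V_def[abs_def] eq by measurable
qed

lemma V_bound:
  assumes "0 \<le> t" "0 \<le> h" shows "\<bar>V t h \<omega>\<bar> \<le> (K * C + real p * (2 * B * R) + c) * h"
proof -
  have "\<bar>F (X (t + h) \<omega>) - F (X t \<omega> + displacement t h \<omega>)\<bar> \<le> K * norm (LBINT r:{t..t+h}. f (X r \<omega>))"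
    using F_lipschitz[of "X (t + h) \<omega>" "X t \<omega> + displacement t h \<omega>"] X_increment[OF assms] by simp
  also have "\<dots> \<le> K * (C * h)"
    using norm_integral_Icc_le[of "\<lambda>r. f (X r \<omega>)" C t "t + h"] f_bounded assms K_nonneg by (intro mult_left_mono) auto
  finally have 1: "\<bar>F (X (t + h) \<omega>) - F (X t \<omega> + displacement t h \<omega>)\<bar> \<le> K * (C * h)" .
  have "\<bar>\<Sum>k=1..p. (F (X t \<omega> + \<nu> k) - F (X t \<omega>)) * (tau (t + h) k \<omega> - tau t k \<omega>)\<bar> \<le> (\<Sum>k=1..p. (2 * B) * (R * h))"
  proof (rule order_trans[OF sum_abs], rule sum_mono)
    fix k
    have "\<bar>tau (t + h) k \<omega> - tau t k \<omega>\<bar> \<le> R * h"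
      using tau_mono[of t "t + h" k \<omega>] tau_increment_le[of t "t + h" k \<omega>] assms by simp
    then show "\<bar>(F (X t \<omega> + \<nu> k) - F (X t \<omega>)) * (tau (t + h) k \<omega> - tau t k \<omega>)\<bar> \<le> (2 * B) * (R * h)"
      unfolding abs_mult using F_diff_le B_nonneg by (intro mult_mono) auto
  qed
  moreover have "\<bar>LBINT s:{t..t+h}. G (X s \<omega>)\<bar> \<le> c * h"
    using norm_integral_Icc_le[of "\<lambda>s. G (X s \<omega>)" c t "t + h"] G_le assms by simp
  ultimately have "\<bar>V t h \<omega>\<bar> \<le> K * (C * h) + real p * ((2 * B) * (R * h)) + c * h"
    using 1 unfolding V_def by simp
  then show ?thesis by (simp add: algebra_simps)
qed

text \<open>Before the next jump the displacement is zero, and the three parts of \<open>V\<close>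
  divided by \<open>h\<close> tend to the drift derivative, to the jump part of the generator, and
  to minus the generator.\<close>

lemma V_limit:
  assumes t: "0 \<le> t" shows "((\<lambda>h. V t h \<omega> / h) \<longlongrightarrow> 0) (at_right 0)"
proof -
  let ?x = "X t \<omega>"
  define w where "w h = (LBINT r:{t..t+h}. f (X r \<omega>))" for h
  have rc: "((\<lambda>s. g (X s \<omega>)) \<longlongrightarrow> g ?x) (at_right t)" if "continuous_on UNIV g" for g :: "real ^ 'd \<Rightarrow> 'b :: topological_space"
    using right_cont_compose[OF X_right_cont that] unfolding right_cont_def by simp
  have w_lim: "((\<lambda>h. w h /\<^sub>R h) \<longlongrightarrow> f ?x) (at_right 0)"
    unfolding w_def using rc[OF f_continuous] by (intro average_right_limit[of _ C]) (auto simp: f_bounded)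
  have tau_lim: "((\<lambda>h. (tau (t + h) k \<omega> - tau t k \<omega>) / h) \<longlongrightarrow> lam k ?x) (at_right 0)" for k
  proof -
    have "((\<lambda>h. (LBINT s:{t..t+h}. lam k (X s \<omega>)) /\<^sub>R h) \<longlongrightarrow> lam k ?x) (at_right 0)"
      using rc[OF lam_continuous] by (intro average_right_limit[of _ R]) (auto simp: norm_lam_le[simplified])
    moreover have "\<forall>\<^sub>F h in at_right 0. (LBINT s:{t..t+h}. lam k (X s \<omega>)) /\<^sub>R h = (tau (t + h) k \<omega> - tau t k \<omega>) / h"
      using t by (intro eventually_at_rightI[of 0 1]) (auto simp: tau_diff divide_inverse_commute)
    ultimately show ?thesis by (rule Lim_transform_eventually)
  qed
  have G_lim: "((\<lambda>h. (LBINT s:{t..t+h}. G (X s \<omega>)) / h) \<longlongrightarrow> G ?x) (at_right 0)"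
  proof -
    have "((\<lambda>h. (LBINT s:{t..t+h}. G (X s \<omega>)) /\<^sub>R h) \<longlongrightarrow> G ?x) (at_right 0)"
      using rc[OF G_continuous] G_le by (intro average_right_limit[of _ c]) auto
    then show ?thesis by (simp add: divide_inverse_commute)
  qed
  have F_lim: "((\<lambda>h. (F (?x + w h) - F ?x) / h) \<longlongrightarrow> grad_apply F ?x (f ?x)) (at_right 0)"
  proof -
    \<comment> \<open>The drift curve with its value at 0 fixed as the current position; its right
      derivative there is \<open>f\<close>, so the chain rule within the positive half-line
      applies.\<close>
    define u where "u h = (if h = 0 then ?x else ?x + w h)" for h
    have lin: "linear (grad_apply F ?x)" using C1b_has_derivative[OF F] by (metis has_derivative_linear)
    have "(u has_derivative (\<lambda>h. h *\<^sub>R f ?x)) (at 0 within {0<..})"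
      unfolding has_derivative_within
    proof (intro conjI bounded_linear_scaleR_left)
      have "((\<lambda>h. w h /\<^sub>R h - f ?x) \<longlongrightarrow> 0) (at_right 0)" using w_lim by (simp add: LIM_zero)
      moreover have "\<forall>\<^sub>F h in at_right 0. w h /\<^sub>R h - f ?x = (1 / norm (h - 0)) *\<^sub>R (u h - (u 0 + (h - 0) *\<^sub>R f ?x))"
        by (intro eventually_at_rightI[of 0 1]) (auto simp: u_def scaleR_diff_right divide_inverse)
      ultimately show "((\<lambda>h. (1 / norm (h - 0)) *\<^sub>R (u h - (u 0 + (h - 0) *\<^sub>R f ?x))) \<longlongrightarrow> 0) (at_right 0)"
        by (rule Lim_transform_eventually)
    qed
    moreover have "(F has_derivative grad_apply F ?x) (at (u 0) within u ` {0<..})"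
      using C1b_has_derivative[OF F, of ?x] by (simp add: u_def has_derivative_at_withinI)
    ultimately have "((F \<circ> u) has_derivative (grad_apply F ?x \<circ> (\<lambda>h. h *\<^sub>R f ?x))) (at 0 within {0<..})"
      by (rule diff_chain_within)
    then have "((\<lambda>h. (1 / norm (h - 0)) *\<^sub>R ((F \<circ> u) h - ((F \<circ> u) 0 + (grad_apply F ?x \<circ> (\<lambda>h. h *\<^sub>R f ?x)) (h - 0)))) \<longlongrightarrow> 0) (at_right 0)"
      unfolding has_derivative_within by blast
    moreover have "\<forall>\<^sub>F h in at_right 0. (1 / norm (h - 0)) *\<^sub>R ((F \<circ> u) h - ((F \<circ> u) 0 + (grad_apply F ?x \<circ> (\<lambda>h. h *\<^sub>R f ?x)) (h - 0)))
       = (F (?x + w h) - F ?x) / h - grad_apply F ?x (f ?x)"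
      by (intro eventually_at_rightI[of 0 1]) (auto simp: u_def linear_scale[OF lin] field_simps)
    ultimately have "((\<lambda>h. (F (?x + w h) - F ?x) / h - grad_apply F ?x (f ?x)) \<longlongrightarrow> 0) (at_right 0)"
      by (rule Lim_transform_eventually)
    then show ?thesis by (rule LIM_zero_cancel)
  qed
  have "((\<lambda>h. (F (?x + w h) - F ?x) / h + (\<Sum>k=1..p. (F (?x + \<nu> k) - F ?x) * ((tau (t + h) k \<omega> - tau t k \<omega>) / h)) - (LBINT s:{t..t+h}. G (X s \<omega>)) / h)
    \<longlongrightarrow> grad_apply F ?x (f ?x) + (\<Sum>k=1..p. (F (?x + \<nu> k) - F ?x) * lam k ?x) - G ?x) (at_right 0)"
    by (intro tendsto_intros F_lim tau_lim G_lim)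
  also have "grad_apply F ?x (f ?x) + (\<Sum>k=1..p. (F (?x + \<nu> k) - F ?x) * lam k ?x) - G ?x = 0"
    by (simp add: generator_def mult.commute)
  finally have lim: "((\<lambda>h. (F (?x + w h) - F ?x) / h + (\<Sum>k=1..p. (F (?x + \<nu> k) - F ?x) * ((tau (t + h) k \<omega> - tau t k \<omega>) / h)) - (LBINT s:{t..t+h}. G (X s \<omega>)) / h)
    \<longlongrightarrow> 0) (at_right 0)" .
  have "\<forall>\<^sub>F h in at_right 0. 0 < (h :: real)" by (intro eventually_at_rightI[of 0 1]) auto
  with displacement_eventually_0[OF t, of \<omega>]
  have "\<forall>\<^sub>F h in at_right 0. (F (?x + w h) - F ?x) / h + (\<Sum>k=1..p. (F (?x + \<nu> k) - F ?x) * ((tau (t + h) k \<omega> - tau t k \<omega>) / h)) - (LBINT s:{t..t+h}. G (X s \<omega>)) / h = V t h \<omega> / h"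
  proof eventually_elim
    case (elim h)
    then have "X (t + h) \<omega> = ?x + w h" using X_increment[of t h \<omega>] t by (simp add: w_def)
    then show ?case using elim by (simp add: V_def add_divide_distrib diff_divide_distrib sum_divide_distrib right_diff_distrib)
  qed
  with lim show ?thesis by (rule Lim_transform_eventually)
qed

end

section \<open>The martingale property\<close>

lemma step_sequence_at_right: "filterlim (\<lambda>m. 1 / real (Suc m)) (at_right 0) sequentially"
  unfolding filterlim_at using LIMSEQ_Suc[OF lim_1_over_n[where 'a=real]] by (auto intro!: always_eventually)

section \<open>Natural filtrations and almost surely equal processes\<close>

lemma natural_filtration_events:
  assumes "\<And>s. 0 \<le> s \<Longrightarrow> s \<le> t \<Longrightarrow> Z s \<in> borel_measurable M"
  shows "sets (natural_filtration M Z t) \<subseteq> sets M"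
proof -
  have "(\<Union>s\<in>{0..t}. {Z s -` A \<inter> space M | A. A \<in> sets borel}) \<subseteq> sets M"
    using assms measurable_sets by fastforce
  then show ?thesis
    unfolding natural_filtration_def by (subst sets_measure_of) (auto intro!: sets.sigma_sets_subset)
qed

lemma space_natural_filtration [simp]: "space (natural_filtration M Z t) = space M"
  unfolding natural_filtration_def by (rule space_measure_of) auto

lemma natural_filtration_measurable:
  fixes Z :: "real \<Rightarrow> 'w \<Rightarrow> 'b :: topological_space"
  assumes "0 \<le> s" "s \<le> t" shows "Z s \<in> borel_measurable (natural_filtration M Z t)"
proof (rule measurableI)
  fix A :: "'b set" assume A: "A \<in> sets borel"
  have "sets (natural_filtration M Z t) = sigma_sets (space M) (\<Union>s\<in>{0..t}. {Z s -` A \<inter> space M | A. A \<in> sets borel})"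
    unfolding natural_filtration_def by (rule sets_measure_of) auto
  moreover have "Z s -` A \<inter> space M \<in> (\<Union>s\<in>{0..t}. {Z s -` A \<inter> space M | A. A \<in> sets borel})"
    using A assms by (intro UN_I[of s]) auto
  ultimately show "Z s -` A \<inter> space (natural_filtration M Z t) \<in> sets (natural_filtration M Z t)" by auto
qed auto

text \<open>Natural filtrations are not completed, so those of two almost surely equal processes may
  differ; each event of one still has a partner in the other up to a null set, by induction over the
  generation of the sigma-algebra.\<close>

lemma natural_filtration_AE_eq:
  fixes Z :: "real \<Rightarrow> 'w \<Rightarrow> 'b :: topological_space"
  assumes ae: "AE \<omega> in M. \<forall>s. 0 \<le> s \<longrightarrow> Z s \<omega> = Z' s \<omega>" and A: "A \<in> sets (natural_filtration M Z t)"
  shows "\<exists>A'\<in>sets (natural_filtration M Z' t). AE \<omega> in M. \<omega> \<in> A \<longleftrightarrow> \<omega> \<in> A'"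
proof -
  have sets: "sets (natural_filtration M Z t) = sigma_sets (space M) (\<Union>s\<in>{0..t}. {Z s -` A \<inter> space M | A. A \<in> sets borel})" for Z :: "real \<Rightarrow> 'w \<Rightarrow> 'b"
    unfolding natural_filtration_def by (rule sets_measure_of) auto
  show ?thesis
    using A unfolding sets[of Z]
  proof (induction rule: sigma_sets.induct)
    case (Basic A)
    then obtain s B where B: "0 \<le> s" "s \<le> t" "B \<in> sets borel" "A = Z s -` B \<inter> space M" by auto
    then have "Z' s -` B \<inter> space M \<in> sets (natural_filtration M Z' t)"
      using measurable_sets[OF natural_filtration_measurable[OF B(1,2), of Z' M] B(3)] by simp
    moreover have "AE \<omega> in M. \<omega> \<in> A \<longleftrightarrow> \<omega> \<in> Z' s -` B \<inter> space M"
      using ae by eventually_elim (use B in auto)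
    ultimately show ?case by blast
  next
    case Empty
    show ?case by (rule bexI[of _ "{}"]) auto
  next
    case (Compl A)
    then obtain A' where A': "A' \<in> sets (natural_filtration M Z' t)" "AE \<omega> in M. \<omega> \<in> A \<longleftrightarrow> \<omega> \<in> A'" by blast
    have "space M - A' \<in> sets (natural_filtration M Z' t)"
      using sets.compl_sets[OF A'(1)] by simp
    moreover have "AE \<omega> in M. \<omega> \<in> space M - A \<longleftrightarrow> \<omega> \<in> space M - A'" using A'(2) by eventually_elim auto
    ultimately show ?case by blast
  next
    case (Union A)
    then obtain A' where A': "\<And>i. A' i \<in> sets (natural_filtration M Z' t)" "\<And>i. AE \<omega> in M. \<omega> \<in> A i \<longleftrightarrow> \<omega> \<in> A' i"
      by metis
    have "AE \<omega> in M. \<forall>i. \<omega> \<in> A i \<longleftrightarrow> \<omega> \<in> A' i" using A'(2) by (simp add: AE_all_countable)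
    then have "AE \<omega> in M. \<omega> \<in> (\<Union>i. A i) \<longleftrightarrow> \<omega> \<in> (\<Union>i. A' i)" by eventually_elim auto
    moreover have "(\<Union>i. A' i) \<in> sets (natural_filtration M Z' t)" using A'(1) by auto
    ultimately show ?case by blast
  qed
qed

text \<open>Completeness enters here: whatever \<open>g\<close> does on the exceptional null set is
  measurable.\<close>

lemma complete_measure_AE_measurable:
  assumes "complete_measure M" and f: "f \<in> measurable M N" and ae: "AE \<omega> in M. f \<omega> = g \<omega>"
    and g: "\<And>\<omega>. \<omega> \<in> space M \<Longrightarrow> g \<omega> \<in> space N"
  shows "g \<in> measurable M N"
proof (rule measurableI[OF g])
  interpret complete_measure M by fact
  obtain S where S: "{\<omega>\<in>space M. f \<omega> \<noteq> g \<omega>} \<subseteq> S" "S \<in> null_sets M"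
    using ae by (auto elim!: AE_E simp: null_sets_def)
  fix A assume A: "A \<in> sets N"
  have "g -` A \<inter> space M \<inter> S \<in> sets M" by (rule complete[OF _ S(2)]) auto
  moreover have "f -` A \<inter> space M - S \<in> sets M" using measurable_sets[OF f A] S(2) by auto
  moreover have "g -` A \<inter> space M = (f -` A \<inter> space M - S) \<union> (g -` A \<inter> space M \<inter> S)" using S(1) by auto
  ultimately show "g -` A \<inter> space M \<in> sets M" by (metis sets.Un)
qed

context test_function
begin

text \<open>The increment of \<open>Z\<close> splits into \<open>V\<close>, the multiple-jump error
  \<open>Q\<close>, and jump counts minus clock increments weighted by \<open>\<xi> k\<close>. The
  last part has mean zero by optional sampling between the clocks at \<open>t\<close> and
  \<open>t + h\<close>; the factorial moment bounds \<open>Q\<close>.\<close>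

lemma Z_increment_expectation:
  assumes s: "0 \<le> s" "s \<le> t" and h: "0 < h" and A: "A \<in> sets (natural_filtration M X s)"
  shows "\<bar>expectation (\<lambda>\<omega>. indicator A \<omega> * Z (t + h) \<omega>) - expectation (\<lambda>\<omega>. indicator A \<omega> * Z t \<omega>)\<bar> \<le>
    \<bar>expectation (\<lambda>\<omega>. indicator A \<omega> * V t h \<omega>)\<bar> + 4 * B * (real p * ((R + 1) * h))\<^sup>2"
proof -
  have t: "0 \<le> t" "0 \<le> t + h" "0 \<le> h" using s h by auto
  have A_ev [measurable]: "A \<in> events" using A natural_filtration_events[of s X M] by auto
  define \<xi> where "\<xi> k \<omega> = indicator A \<omega> * (F (X t \<omega> + \<nu> k) - F (X t \<omega>))" for k \<omega>
  define N where "N k \<omega> = real (jumps (t + h) k \<omega>) - real (jumps t k \<omega>)" for k \<omega>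
  define D where "D k \<omega> = tau (t + h) k \<omega> - tau t k \<omega>" for k \<omega>
  define Q where "Q \<omega> = F (X t \<omega> + displacement t h \<omega>) - F (X t \<omega>) - (\<Sum>k=1..p. N k \<omega> * (F (X t \<omega> + \<nu> k) - F (X t \<omega>)))" for \<omega>
  define W where "W \<omega> = real (total_increment (at_time (tau t) \<omega>) ((R + 1) * h) \<omega>) * (real (total_increment (at_time (tau t) \<omega>) ((R + 1) * h) \<omega>) - 1)" for \<omega>
  have bound: "tau t k \<omega> \<le> R * (t + h)" "tau (t + h) k \<omega> \<le> R * (t + h)" for k \<omega>
    using tau_le[of t k \<omega>] tau_le[of "t + h" k \<omega>] t mult_left_mono[of t "t + h" R] R_nonneg by auto
  \<comment> \<open>Optional sampling uses the weight at both clock vectors, so \<open>t'\<close>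
    will be \<open>t\<close> and \<open>t + h\<close>.\<close>
  have Gk: "stopped_measurable (tau t') (\<xi> k)" if "t \<le> t'" for t' k
    unfolding \<xi>_def
  proof (rule stopped_measurable_mult)
    show "stopped_measurable (tau t') (indicator A)" using s that by (intro stopped_measurable_natural[OF A]) auto
    have "(\<lambda>x. F (x + \<nu> k) - F x) \<in> borel_measurable borel" by measurable
    then show "stopped_measurable (tau t') (\<lambda>\<omega>. F (X t \<omega> + \<nu> k) - F (X t \<omega>))"
      using stopped_measurable_X[of t t' "\<lambda>x. F (x + \<nu> k) - F x"] t that by simp
  qed
  have \<xi>_bound: "\<bar>\<xi> k \<omega>\<bar> \<le> 2 * B" for k \<omega>
    using F_diff_le B_nonneg by (auto simp: \<xi>_def indicator_def)
  have sampling: "integrable M (\<lambda>\<omega>. \<xi> k \<omega> * N k \<omega>) \<and> integrable M (\<lambda>\<omega>. \<xi> k \<omega> * D k \<omega>) \<and>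
      expectation (\<lambda>\<omega>. \<xi> k \<omega> * N k \<omega>) = expectation (\<lambda>\<omega>. \<xi> k \<omega> * D k \<omega>)" if k: "k \<in> {1..p}" for k
    using optional_sampling[where \<tau>="tau t" and \<tau>'="tau (t + h)" and K="R * (t + h)" and B="2 * B" and \<xi>="\<xi> k" and j=k,
        OF k stopped_measurable_one[OF t(1)] tau_nonneg[OF t(1)] bound(1) stopped_measurable_one[OF t(2)] tau_nonneg[OF t(2)] bound(2) Gk Gk \<xi>_bound]
      h unfolding N_def D_def jumps_def by simp
  have d: "0 < (R + 1) * h" using R_nonneg h by simp
  note moment = stopped_total_increment_moment[where \<tau>="tau t" and K="R * (t + h)", OF stopped_measurable_one[OF t(1)] tau_nonneg[OF t(1)] bound(1) d]
  have W: "integrable M W" "expectation W = (real p * ((R + 1) * h))\<^sup>2"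
    using moment by (simp_all add: W_def[abs_def])
  have N_eq: "N k \<omega> = real (jumps (t + h) k \<omega> - jumps t k \<omega>)" if "k \<in> {1..p}" for k \<omega>
    unfolding N_def using jumps_mono[OF that, of t "t + h" \<omega>] t by (simp add: of_nat_diff)
  have Q_bound: "\<bar>Q \<omega>\<bar> \<le> 4 * B * W \<omega>" for \<omega>
  proof -
    define S where "S = (\<Sum>k=1..p. jumps (t + h) k \<omega> - jumps t k \<omega>)"
    have "\<bar>Q \<omega>\<bar> \<le> 4 * B * (real S * (real S - 1))"
      using multi_jump_bound[of F B "{1..p}" "X t \<omega>" "\<lambda>k. jumps (t + h) k \<omega> - jumps t k \<omega>" \<nu>] F_bound N_eq
      unfolding Q_def displacement_def S_def by simp
    also have "\<dots> \<le> 4 * B * W \<omega>"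
      unfolding W_def S_def using B_nonneg jump_count_le[OF t(1) h] by (intro mult_left_mono nat_factorial_moment_mono) auto
    finally show ?thesis .
  qed
  have [measurable]: "V t h \<in> borel_measurable M" "displacement t h \<in> borel_measurable M"
    using V_measurable displacement_measurable t by auto
  have N_meas: "(\<lambda>\<omega>. N k \<omega>) \<in> borel_measurable M" if "k \<in> {1..p}" for k
    unfolding N_def by (intro borel_measurable_diff jumps_measurable that)
  have F_meas: "(\<lambda>\<omega>. F (X t \<omega> + displacement t h \<omega>)) \<in> borel_measurable M"
    "(\<lambda>\<omega>. F (X t \<omega>)) \<in> borel_measurable M" "(\<lambda>\<omega>. F (X t \<omega> + \<nu> k)) \<in> borel_measurable M" for k
    using t by measurable
  have [measurable]: "Q \<in> borel_measurable M"
    unfolding Q_def[abs_def] by (intro borel_measurable_diff borel_measurable_sum borel_measurable_times N_meas F_meas)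
  have Q_int: "integrable M (\<lambda>\<omega>. indicator A \<omega> * Q \<omega>)"
  proof (rule Bochner_Integration.integrable_bound)
    show "integrable M (\<lambda>\<omega>. 4 * B * W \<omega>)" using W by simp
    show "AE \<omega> in M. norm (indicator A \<omega> * Q \<omega>) \<le> norm (4 * B * W \<omega>)"
      by (rule AE_I2) (use order_trans[OF Q_bound abs_ge_self] in \<open>auto simp: indicator_def\<close>)
  qed measurable
  have V_int: "integrable M (\<lambda>\<omega>. indicator A \<omega> * V t h \<omega>)"
    using V_bound[OF t(1,3)]
    by (intro integrable_const_bound[of _ "\<bar>(K * C + real p * (2 * B * R) + c) * h\<bar>"]) (auto simp: indicator_def intro!: AE_I2 order_trans[OF V_bound[OF t(1,3)] abs_ge_self])
  have Z_diff: "Z (t + h) \<omega> - Z t \<omega> = V t h \<omega> + Q \<omega> + (\<Sum>k=1..p. (F (X t \<omega> + \<nu> k) - F (X t \<omega>)) * (N k \<omega> - D k \<omega>))" for \<omega>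
  proof -
    have "(LBINT r:{0..t+h}. G (X r \<omega>)) = (LBINT r:{0..t}. G (X r \<omega>)) + (LBINT r:{t..t+h}. G (X r \<omega>))"
      using t h G_le by (intro integral_Icc_split[of _ c]) auto
    moreover have "(\<Sum>k=1..p. (F (X t \<omega> + \<nu> k) - F (X t \<omega>)) * (N k \<omega> - D k \<omega>)) =
      (\<Sum>k=1..p. N k \<omega> * (F (X t \<omega> + \<nu> k) - F (X t \<omega>))) - (\<Sum>k=1..p. (F (X t \<omega> + \<nu> k) - F (X t \<omega>)) * D k \<omega>)"
      unfolding sum_subtractf[symmetric] by (intro sum.cong refl) (simp add: algebra_simps)
    ultimately show ?thesis
      unfolding Z_def V_def Q_def D_def[symmetric] by simp
  qed
  have split: "indicator A \<omega> * Z (t + h) \<omega> - indicator A \<omega> * Z t \<omega> =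
     indicator A \<omega> * V t h \<omega> + indicator A \<omega> * Q \<omega> + (\<Sum>k=1..p. \<xi> k \<omega> * N k \<omega> - \<xi> k \<omega> * D k \<omega>)" for \<omega>
  proof -
    have "indicator A \<omega> * Z (t + h) \<omega> - indicator A \<omega> * Z t \<omega> = indicator A \<omega> * (V t h \<omega> + Q \<omega> + (\<Sum>k=1..p. (F (X t \<omega> + \<nu> k) - F (X t \<omega>)) * (N k \<omega> - D k \<omega>)))"
      unfolding Z_diff[symmetric] by (simp add: right_diff_distrib)
    also have "\<dots> = indicator A \<omega> * V t h \<omega> + indicator A \<omega> * Q \<omega> + (\<Sum>k=1..p. \<xi> k \<omega> * N k \<omega> - \<xi> k \<omega> * D k \<omega>)"
      unfolding distrib_left sum_distrib_left \<xi>_def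
      by (intro arg_cong2[where f="(+)"] refl sum.cong) (simp add: algebra_simps)
    finally show ?thesis .
  qed
  have sum_int: "integrable M (\<lambda>\<omega>. \<Sum>k=1..p. \<xi> k \<omega> * N k \<omega> - \<xi> k \<omega> * D k \<omega>)"
    using sampling by (intro Bochner_Integration.integrable_sum Bochner_Integration.integrable_diff) auto
  have sum_0: "expectation (\<lambda>\<omega>. \<Sum>k=1..p. \<xi> k \<omega> * N k \<omega> - \<xi> k \<omega> * D k \<omega>) = 0"
  proof -
    have "expectation (\<lambda>\<omega>. \<Sum>k=1..p. \<xi> k \<omega> * N k \<omega> - \<xi> k \<omega> * D k \<omega>) = (\<Sum>k=1..p. expectation (\<lambda>\<omega>. \<xi> k \<omega> * N k \<omega> - \<xi> k \<omega> * D k \<omega>))"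
      using sampling by (intro Bochner_Integration.integral_sum Bochner_Integration.integrable_diff) auto
    also have "\<dots> = 0" using sampling by (intro sum.neutral) auto
    finally show ?thesis .
  qed
  have Zi: "integrable M (\<lambda>\<omega>. indicator A \<omega> * Z t \<omega>)" "integrable M (\<lambda>\<omega>. indicator A \<omega> * Z (t + h) \<omega>)"
    using integrable_real_mult_indicator[OF A_ev Z_integrable] t by (auto simp: mult.commute)
  have "expectation (\<lambda>\<omega>. indicator A \<omega> * Z (t + h) \<omega>) - expectation (\<lambda>\<omega>. indicator A \<omega> * Z t \<omega>)
    = expectation (\<lambda>\<omega>. indicator A \<omega> * V t h \<omega> + indicator A \<omega> * Q \<omega> + (\<Sum>k=1..p. \<xi> k \<omega> * N k \<omega> - \<xi> k \<omega> * D k \<omega>))"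
    using Zi by (simp add: Bochner_Integration.integral_diff[symmetric] split)
  also have "\<dots> = expectation (\<lambda>\<omega>. indicator A \<omega> * V t h \<omega>) + expectation (\<lambda>\<omega>. indicator A \<omega> * Q \<omega>)"
    using V_int Q_int sum_int sum_0 by simp
  finally have main: "expectation (\<lambda>\<omega>. indicator A \<omega> * Z (t + h) \<omega>) - expectation (\<lambda>\<omega>. indicator A \<omega> * Z t \<omega>)
    = expectation (\<lambda>\<omega>. indicator A \<omega> * V t h \<omega>) + expectation (\<lambda>\<omega>. indicator A \<omega> * Q \<omega>)" .
  have "\<bar>expectation (\<lambda>\<omega>. indicator A \<omega> * Q \<omega>)\<bar> \<le> expectation (\<lambda>\<omega>. \<bar>indicator A \<omega> * Q \<omega>\<bar>)"
    by (rule integral_abs_bound)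
  also have "\<dots> \<le> expectation (\<lambda>\<omega>. 4 * B * W \<omega>)"
    using Q_int W(1) order_trans[OF abs_ge_zero Q_bound] Q_bound
    by (intro integral_mono) (auto simp: indicator_def)
  also have "\<dots> = 4 * B * (real p * ((R + 1) * h))\<^sup>2" using W by simp
  finally show ?thesis unfolding main by linarith
qed

text \<open>The bound of \<open>V\<close> by a multiple of \<open>h\<close> is used twice: it gives
  continuity of the expectation, which constancy requires along with the vanishing right derivative,
  and it dominates the quotients \<open>V / h\<close> in the limit.\<close>

lemma Z_expectation_const:
  assumes s: "0 \<le> s" "s \<le> b" and A: "A \<in> sets (natural_filtration M X s)"
  shows "expectation (\<lambda>\<omega>. indicator A \<omega> * Z b \<omega>) = expectation (\<lambda>\<omega>. indicator A \<omega> * Z s \<omega>)"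
proof -
  define q where "q t = expectation (\<lambda>\<omega>. indicator A \<omega> * Z t \<omega>)" for t
  define c1 where "c1 = \<bar>K * C + real p * (2 * B * R) + c\<bar>"
  define c2 where "c2 = 4 * B * (real p * (R + 1))\<^sup>2"
  have c0: "0 \<le> c1" "0 \<le> c2" using B_nonneg by (auto simp: c1_def c2_def)
  have A_ev [measurable]: "A \<in> events" using A natural_filtration_events[of s X M] by auto
  have c2_eq: "4 * B * (real p * ((R + 1) * h))\<^sup>2 = c2 * h * h" for h
    by (simp add: c2_def power2_eq_square)
  have V_le: "\<bar>V t h \<omega>\<bar> \<le> c1 * h" if "0 \<le> t" "0 \<le> h" for t h \<omega>
    using V_bound[OF that, of \<omega>] mult_right_mono[OF abs_ge_self that(2), of "K * C + real p * (2 * B * R) + c"]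
    unfolding c1_def by linarith
  have incr: "\<bar>q (t + h) - q t\<bar> \<le> \<bar>expectation (\<lambda>\<omega>. indicator A \<omega> * V t h \<omega>)\<bar> + c2 * h * h" if "s \<le> t" "0 < h" for t h
    using Z_increment_expectation[OF s(1) that A] unfolding q_def c2_eq .
  have lip: "\<bar>q (t + h) - q t\<bar> \<le> (c1 + c2) * h" if t: "s \<le> t" and h: "0 < h" "h \<le> 1" for t h
  proof -
    have t0: "0 \<le> t" using s t by simp
    have "\<bar>expectation (\<lambda>\<omega>. indicator A \<omega> * V t h \<omega>)\<bar> \<le> expectation (\<lambda>\<omega>. \<bar>indicator A \<omega> * V t h \<omega>\<bar>)"
      by (rule integral_abs_bound)
    also have "\<dots> \<le> expectation (\<lambda>\<omega>. c1 * h)"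
    proof (rule integral_mono)
      have [measurable]: "V t h \<in> borel_measurable M" using V_measurable t0 h by auto
      have b: "\<bar>indicator A \<omega> * V t h \<omega>\<bar> \<le> c1 * h" for \<omega>
        using V_le[of t h \<omega>] t0 h c0 by (auto simp: indicator_def)
      then show "\<bar>indicator A \<omega> * V t h \<omega>\<bar> \<le> c1 * h" for \<omega> .
      show "integrable M (\<lambda>\<omega>. \<bar>indicator A \<omega> * V t h \<omega>\<bar>)"
        by (rule integrable_const_bound[of _ "c1 * h"]) (use b in auto)
    qed simp
    also have "\<dots> = c1 * h" by (simp add: prob_space)
    finally have "\<bar>expectation (\<lambda>\<omega>. indicator A \<omega> * V t h \<omega>)\<bar> \<le> c1 * h" .
    moreover have "c2 * h * h \<le> c2 * h" using mult_left_mono[of h 1 "c2 * h"] c0 h by simp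
    ultimately show ?thesis using incr[OF t h(1)] by (simp add: distrib_right)
  qed
  have cont: "continuous_on {s..b} q"
    unfolding continuous_on_iff
  proof (intro ballI allI impI)
    fix x e :: real assume x: "x \<in> {s..b}" and e: "0 < e"
    define d where "d = min 1 (e / (c1 + c2 + 1))"
    have d: "0 < d" using e c0 by (simp add: d_def)
    show "\<exists>d>0. \<forall>x'\<in>{s..b}. dist x' x < d \<longrightarrow> dist (q x') (q x) < e"
    proof (intro exI[of _ d] conjI ballI impI d)
      fix x' assume x': "x' \<in> {s..b}" "dist x' x < d"
      then have dd: "\<bar>x' - x\<bar> \<le> 1" "\<bar>x' - x\<bar> < e / (c1 + c2 + 1)" by (auto simp: d_def dist_real_def)
      have "\<bar>q x' - q x\<bar> \<le> (c1 + c2) * \<bar>x' - x\<bar>"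
        using lip[of x "x' - x"] lip[of x' "x - x'"] x x'(1) dd(1) by (cases x x' rule: linorder_cases) (auto simp: abs_minus_commute)
      also have "\<dots> \<le> (c1 + c2 + 1) * \<bar>x' - x\<bar>" by (intro mult_right_mono) auto
      also have "\<dots> < e" using dd(2) c0 by (simp add: field_simps)
      finally show "dist (q x') (q x) < e" by (simp add: dist_real_def)
    qed
  qed
  have "q b = q s"
  proof (rule right_derivative_zero_imp_const[OF s(2) cont])
    fix x e :: real assume x: "s \<le> x" "x < b" and e: "0 < e"
    have x0: "0 \<le> x" using s x by simp
    \<comment> \<open>One suitable step per \<open>e\<close> is all that is asked for, so steps may
      be taken from a sequence, along which dominated convergence applies.\<close>
    define h where "h m = 1 / real (Suc m)" for m
    have h: "0 < h m" for m by (simp add: h_def)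
    have "(\<lambda>m. expectation (\<lambda>\<omega>. indicator A \<omega> * (V x (h m) \<omega> / h m))) \<longlonglongrightarrow> expectation (\<lambda>\<omega>. 0)"
    proof (rule integral_dominated_convergence[where w="\<lambda>_. c1"])
      show "AE \<omega> in M. (\<lambda>m. indicator A \<omega> * (V x (h m) \<omega> / h m)) \<longlonglongrightarrow> 0"
      proof (rule AE_I2)
        fix \<omega>
        have "(\<lambda>m. V x (h m) \<omega> / h m) \<longlonglongrightarrow> 0"
          using filterlim_compose[OF V_limit[OF x0] step_sequence_at_right] by (simp add: h_def)
        from tendsto_mult[OF tendsto_const this, of "indicator A \<omega>"]
        show "(\<lambda>m. indicator A \<omega> * (V x (h m) \<omega> / h m)) \<longlonglongrightarrow> 0" by simp
      qed
      fix m
      have [measurable]: "V x (h m) \<in> borel_measurable M" using V_measurable x0 h[of m] by auto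
      show "(\<lambda>\<omega>. indicator A \<omega> * (V x (h m) \<omega> / h m)) \<in> borel_measurable M" by measurable
      show "AE \<omega> in M. norm (indicator A \<omega> * (V x (h m) \<omega> / h m)) \<le> c1"
      proof (rule AE_I2)
        fix \<omega>
        have "\<bar>V x (h m) \<omega> / h m\<bar> \<le> c1" using V_le[of x "h m" \<omega>] x0 h[of m] by (simp add: divide_le_eq)
        then show "norm (indicator A \<omega> * (V x (h m) \<omega> / h m)) \<le> c1" using c0 by (auto simp: indicator_def)
      qed
    qed auto
    then have "(\<lambda>m. \<bar>expectation (\<lambda>\<omega>. indicator A \<omega> * (V x (h m) \<omega> / h m))\<bar> + c2 * h m) \<longlonglongrightarrow> \<bar>0\<bar> + c2 * 0"
      using LIMSEQ_Suc[OF lim_1_over_n[where 'a=real]] by (intro tendsto_intros) (auto simp: h_def)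
    then have "\<forall>\<^sub>F m in sequentially. \<bar>expectation (\<lambda>\<omega>. indicator A \<omega> * (V x (h m) \<omega> / h m))\<bar> + c2 * h m < e"
      using e by (intro order_tendstoD(2)) auto
    moreover have "\<forall>\<^sub>F m in sequentially. h m < b - x"
      unfolding h_def using x LIMSEQ_Suc[OF lim_1_over_n[where 'a=real]] by (intro order_tendstoD(2)[where y=0]) auto
    ultimately have "\<forall>\<^sub>F m in sequentially. \<bar>expectation (\<lambda>\<omega>. indicator A \<omega> * (V x (h m) \<omega> / h m))\<bar> + c2 * h m < e \<and> h m < b - x"
      by (rule eventually_conj)
    then obtain m where m: "\<bar>expectation (\<lambda>\<omega>. indicator A \<omega> * (V x (h m) \<omega> / h m))\<bar> + c2 * h m < e" "h m < b - x"
      using eventually_happens[of _ sequentially] by auto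
    have "expectation (\<lambda>\<omega>. indicator A \<omega> * (V x (h m) \<omega> / h m)) = expectation (\<lambda>\<omega>. indicator A \<omega> * V x (h m) \<omega>) / h m"
      by simp
    then have "\<bar>expectation (\<lambda>\<omega>. indicator A \<omega> * V x (h m) \<omega>)\<bar> + c2 * h m * h m \<le> e * h m"
      using m(1) h[of m] by (simp add: field_simps)
    then show "\<exists>h>0. x + h \<le> b \<and> \<bar>q (x + h) - q x\<bar> \<le> e * h"
      using incr[OF x(1) h[of m]] m(2) h[of m] by (intro exI[of _ "h m"]) auto
  qed
  then show ?thesis by (simp add: q_def)
qed

end

section \<open>Regular modifications and the main theorem\<close>

text \<open>A limit in the discrete space of natural numbers is eventually attained, so cadlag
  counts are step paths. The condition \<open>y 0 = 0\<close> makes the extension by zero constant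
  just to the right of 0.\<close>

lemma step_path_truncated:
  fixes y :: "real \<Rightarrow> nat"
  assumes y: "y 0 = 0" "mono_on {0..} y" "cadlag y"
  shows "step_path (\<lambda>t. if 0 < t then y t else 0)"
  unfolding step_path_def
proof (intro conjI allI)
  show "mono (\<lambda>t. if 0 < t then y t else 0)"
    using y(2) by (auto simp: mono_def mono_on_def)
  fix t :: real
  show "\<forall>\<^sub>F s in at_right t. (if 0 < s then y s else 0) = (if 0 < t then y t else 0)"
  proof (cases "0 \<le> t")
    case True
    have "\<forall>\<^sub>F s in at_right t. y s = y t"
      using y(3) True by (auto simp: cadlag_def tendsto_discrete)
    moreover have "\<forall>\<^sub>F s in at_right t. t < s" by (intro eventually_at_rightI[of t "t + 1"]) auto
    ultimately show ?thesis by eventually_elim (use y(1) True in auto)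
  next
    case False
    then have "\<forall>\<^sub>F s in at_right t. s < 0" by (intro eventually_at_rightI[of t 0]) auto
    then show ?thesis by eventually_elim (use False in auto)
  qed
qed

text \<open>The exceptional sets of the finitely many paths are covered by one measurable null set.
  On it all paths are set to zero; off it values at times \<open>t \<ge> 0\<close> are kept.\<close>

lemma poisson_modification:
  assumes Y: "\<And>k. k \<in> {1..p} \<Longrightarrow> unit_poisson_process M (Y k)"
  obtains Y' :: "nat \<Rightarrow> real \<Rightarrow> 'w \<Rightarrow> nat" where
    "\<And>k \<omega>. step_path (\<lambda>t. Y' k t \<omega>)" "\<And>k t \<omega>. t \<le> 0 \<Longrightarrow> Y' k t \<omega> = 0"
    "\<And>k t. Y' k t \<in> measurable M (count_space UNIV)"
    "AE \<omega> in M. \<forall>k\<in>{1..p}. \<forall>t\<ge>0. Y' k t \<omega> = Y k t \<omega>"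
proof -
  define P where "P \<omega> \<longleftrightarrow> (\<forall>k\<in>{1..p}. Y k 0 \<omega> = 0 \<and> mono_on {0..} (\<lambda>t. Y k t \<omega>) \<and> cadlag (\<lambda>t. Y k t \<omega>))" for \<omega>
  have "AE \<omega> in M. P \<omega>"
    unfolding P_def using Y by (intro AE_finite_allI) (auto simp: unit_poisson_process_def)
  then obtain S where S: "{\<omega>\<in>space M. \<not> P \<omega>} \<subseteq> S" "emeasure M S = 0" "S \<in> sets M" by (rule AE_E)
  define Y' where "Y' k t \<omega> = (if \<omega> \<in> space M - S \<and> k \<in> {1..p} then if 0 < t then Y k t \<omega> else 0 else 0)" for k t \<omega>
  show ?thesis
  proof (rule that)
    show "step_path (\<lambda>t. Y' k t \<omega>)" for k \<omega>
    proof (cases "\<omega> \<in> space M - S \<and> k \<in> {1..p}")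
      case True
      then have "P \<omega>" using S(1) by auto
      then show ?thesis using step_path_truncated[of "\<lambda>t. Y k t \<omega>"] True by (auto simp: Y'_def P_def)
    next
      case False
      then have "(\<lambda>t. Y' k t \<omega>) = (\<lambda>_. 0)" by (auto simp: Y'_def)
      then show ?thesis by (simp add: step_path_def mono_def)
    qed
    show "Y' k t \<omega> = 0" if "t \<le> 0" for k t \<omega> using that by (simp add: Y'_def)
    show "Y' k t \<in> measurable M (count_space UNIV)" for k t
    proof (cases "k \<in> {1..p} \<and> 0 < t")
      case True
      then have [measurable]: "Y k t \<in> measurable M (count_space UNIV)" using Y[of k] by (auto simp: unit_poisson_process_def)
      have "Y' k t = (\<lambda>\<omega>. if \<omega> \<in> space M - S then Y k t \<omega> else 0)" using True by (auto simp: Y'_def)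
      moreover have [measurable]: "space M - S \<in> sets M" using S(3) by auto
      have "(\<lambda>\<omega>. if \<omega> \<in> space M - S then Y k t \<omega> else 0) \<in> measurable M (count_space UNIV)" by measurable
      ultimately show ?thesis by (simp only:)
    next
      case False
      then have "Y' k t = (\<lambda>_. 0)" by (auto simp: Y'_def)
      then show ?thesis by simp
    qed
    have "AE \<omega> in M. \<omega> \<notin> S" using S(2,3) by (intro AE_not_in) auto
    then show "AE \<omega> in M. \<forall>k\<in>{1..p}. \<forall>t\<ge>0. Y' k t \<omega> = Y k t \<omega>"
      using AE_space
    proof eventually_elim
      case (elim \<omega>)
      then have "P \<omega>" using S(1) by auto
      then show ?case using elim by (auto simp: Y'_def P_def)
    qed
  qed
qed

text \<open>Independence is a property of the joint law and the marginal laws, and these do not see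
  null sets.\<close>

lemma (in prob_space) indep_vars_AE_cong:
  assumes "indep_vars M' X I" "finite I" "\<And>i. i \<in> I \<Longrightarrow> X' i \<in> measurable M (M' i)"
    and ae: "\<And>i. i \<in> I \<Longrightarrow> AE \<omega> in M. X i \<omega> = X' i \<omega>"
  shows "indep_vars M' X' I"
\<comment> \<open>The characterisation by product laws requires a nonempty index set.\<close>
proof (cases "I = {}")
  case True
  then show ?thesis by (simp add: indep_vars_def indep_sets_def)
next
  case False
  have X: "\<And>i. i \<in> I \<Longrightarrow> X i \<in> measurable M (M' i)" using assms(1) by (auto simp: indep_vars_def)
  have "AE \<omega> in M. \<forall>i\<in>I. X i \<omega> = X' i \<omega>" using assms(2) ae by (intro AE_finite_allI)
  then have "AE \<omega> in M. (\<lambda>i\<in>I. X i \<omega>) = (\<lambda>i\<in>I. X' i \<omega>)" by eventually_elim auto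
  then have "distr M (PiM I M') (\<lambda>\<omega>. \<lambda>i\<in>I. X i \<omega>) = distr M (PiM I M') (\<lambda>\<omega>. \<lambda>i\<in>I. X' i \<omega>)"
    using X assms(3) by (intro distr_cong_AE measurable_restrict) auto
  moreover have "(\<Pi>\<^sub>M i\<in>I. distr M (M' i) (X i)) = (\<Pi>\<^sub>M i\<in>I. distr M (M' i) (X' i))"
    using X assms(3) ae by (intro PiM_cong refl distr_cong_AE) auto
  ultimately show ?thesis
    using assms(1) indep_vars_iff_distr_eq_PiM'[OF False X] indep_vars_iff_distr_eq_PiM'[OF False assms(3)] by simp
qed

lemma path_of_measurable:
  assumes "\<And>t. 0 \<le> t \<Longrightarrow> Z t \<in> measurable M (count_space UNIV)"
  shows "path_of Z \<in> measurable M path_space"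
  unfolding path_of_def path_space_def using assms by (intro measurable_restrict) auto

text \<open>\<open>ind0\<close> separates \<open>X0\<close> from the family of paths and
  \<open>ind\<close> separates the paths from each other; together they give the product formula on
  rectangles. Laws and independence pass to \<open>Y'\<close> because the events involved change by
  null sets only.\<close>

lemma poisson_family_modification:
  fixes X0 :: "'w \<Rightarrow> 'e :: euclidean_space"
  assumes M: "prob_space M"
    and Y: "\<And>k. k \<in> {1..p} \<Longrightarrow> unit_poisson_process M (Y k)"
    and ind: "prob_space.indep_vars M (\<lambda>_. path_space) (\<lambda>k. path_of (Y k)) {1..p}"
    and X0: "X0 \<in> borel_measurable M"
    and ind0: "prob_space.indep_set M (sets (vimage_algebra (space M) X0 borel))
      (sets (vimage_algebra (space M) (\<lambda>\<omega>. \<lambda>k\<in>{1..p}. path_of (Y k) \<omega>) (Pi\<^sub>M {1..p} (\<lambda>_. path_space))))"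
    and Y': "\<And>k \<omega>. step_path (\<lambda>t. Y' k t \<omega>)" "\<And>k t \<omega>. t \<le> 0 \<Longrightarrow> Y' k t \<omega> = 0"
      "\<And>k t. Y' k t \<in> measurable M (count_space UNIV)"
      "AE \<omega> in M. \<forall>k\<in>{1..p}. \<forall>t\<ge>0. Y' k t \<omega> = Y k t \<omega>"
  shows "poisson_family M p Y' X0"
proof -
  interpret prob_space M by fact
  have Ym: "Y k t \<in> measurable M (count_space UNIV)" if "k \<in> {1..p}" "0 \<le> t" for k t
    using Y[OF that(1)] that(2) by (auto simp: unit_poisson_process_def)
  have pm: "path_of (Y k) \<in> measurable M path_space" if "k \<in> {1..p}" for k
    using Ym[OF that] by (rule path_of_measurable)
  have pm': "path_of (Y' k) \<in> measurable M path_space" for k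
    using Y'(3) by (rule path_of_measurable)
  have path_eq: "AE \<omega> in M. \<forall>k\<in>{1..p}. path_of (Y' k) \<omega> = path_of (Y k) \<omega>"
    using Y'(4) by eventually_elim (auto simp: path_of_def)
  have Y_AE: "AE \<omega> in M. Y' k t \<omega> = Y k t \<omega>" if "k \<in> {1..p}" "0 \<le> t" for k t
    using Y'(4) by eventually_elim (use that in auto)
  show ?thesis
  proof (intro poisson_family.intro poisson_family_axioms.intro M)
    show "step_path (\<lambda>t. Y' k t \<omega>)" for k \<omega> by (rule Y'(1))
    show "Y' k t \<omega> = 0" if "t \<le> 0" for k t \<omega> using that by (rule Y'(2))
    show "Y' k t \<in> measurable M (count_space UNIV)" for k t by (rule Y'(3))
    show "X0 \<in> borel_measurable M" by fact
  next
    fix B :: "'e set" and E assume B: "B \<in> sets borel" and E: "\<And>k. k \<in> {1..p} \<Longrightarrow> E k \<in> sets path_space"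
    let ?J = "\<lambda>\<omega>. \<lambda>k\<in>{1..p}. path_of (Y k) \<omega>"
    have E_sets: "{\<omega>\<in>space M. path_of (Y k) \<omega> \<in> E k} \<in> events" "{\<omega>\<in>space M. path_of (Y' k) \<omega> \<in> E k} \<in> events" if "k \<in> {1..p}" for k
      using measurable_sets[OF pm[OF that] E[OF that]] measurable_sets[OF pm' E[OF that], of k] by (simp_all add: vimage_def Int_def conj_commute)
    have B_set: "{\<omega>\<in>space M. X0 \<omega> \<in> B} \<in> events"
      using measurable_sets[OF X0 B] by (simp add: vimage_def Int_def conj_commute)
    have all: "{\<omega>\<in>space M. \<forall>k\<in>{1..p}. path_of (Y k) \<omega> \<in> E k} \<in> events" "{\<omega>\<in>space M. \<forall>k\<in>{1..p}. path_of (Y' k) \<omega> \<in> E k} \<in> events"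
      using E_sets by (auto intro!: sets.sets_Collect_finite_All)
    have both: "{\<omega>\<in>space M. X0 \<omega> \<in> B \<and> (\<forall>k\<in>{1..p}. path_of (Y k) \<omega> \<in> E k)} = {\<omega>\<in>space M. X0 \<omega> \<in> B} \<inter> {\<omega>\<in>space M. \<forall>k\<in>{1..p}. path_of (Y k) \<omega> \<in> E k}"
      "{\<omega>\<in>space M. X0 \<omega> \<in> B \<and> (\<forall>k\<in>{1..p}. path_of (Y' k) \<omega> \<in> E k)} = {\<omega>\<in>space M. X0 \<omega> \<in> B} \<inter> {\<omega>\<in>space M. \<forall>k\<in>{1..p}. path_of (Y' k) \<omega> \<in> E k}"
      by auto
    have "prob {\<omega>\<in>space M. X0 \<omega> \<in> B \<and> (\<forall>k\<in>{1..p}. path_of (Y' k) \<omega> \<in> E k)} = prob {\<omega>\<in>space M. X0 \<omega> \<in> B \<and> (\<forall>k\<in>{1..p}. path_of (Y k) \<omega> \<in> E k)}"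
    proof (rule measure_eq_AE)
      show "AE \<omega> in M. (\<omega> \<in> {\<omega>\<in>space M. X0 \<omega> \<in> B \<and> (\<forall>k\<in>{1..p}. path_of (Y' k) \<omega> \<in> E k)}) = (\<omega> \<in> {\<omega>\<in>space M. X0 \<omega> \<in> B \<and> (\<forall>k\<in>{1..p}. path_of (Y k) \<omega> \<in> E k)})"
        using path_eq by eventually_elim auto
    qed (unfold both, (intro sets.Int B_set all)+)
    also have "\<dots> = prob {\<omega>\<in>space M. X0 \<omega> \<in> B} * prob {\<omega>\<in>space M. \<forall>k\<in>{1..p}. path_of (Y k) \<omega> \<in> E k}"
      unfolding both
    proof (rule indep_setD[OF ind0])
      have "X0 -` B \<inter> space M \<in> sets (vimage_algebra (space M) X0 borel)" using B by (rule in_vimage_algebra)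
      then show "{\<omega>\<in>space M. X0 \<omega> \<in> B} \<in> sets (vimage_algebra (space M) X0 borel)" by (simp add: vimage_def Int_def conj_commute)
      have "PiE {1..p} E \<in> sets (Pi\<^sub>M {1..p} (\<lambda>_. path_space))" using E by (intro sets_PiM_I_finite) auto
      then have "?J -` PiE {1..p} E \<inter> space M \<in> sets (vimage_algebra (space M) ?J (Pi\<^sub>M {1..p} (\<lambda>_. path_space)))" by (rule in_vimage_algebra)
      also have "?J -` PiE {1..p} E \<inter> space M = {\<omega>\<in>space M. \<forall>k\<in>{1..p}. path_of (Y k) \<omega> \<in> E k}" by (auto simp: PiE_iff)
      finally show "{\<omega>\<in>space M. \<forall>k\<in>{1..p}. path_of (Y k) \<omega> \<in> E k} \<in> sets (vimage_algebra (space M) ?J (Pi\<^sub>M {1..p} (\<lambda>_. path_space)))" .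
    qed
    also have "prob {\<omega>\<in>space M. \<forall>k\<in>{1..p}. path_of (Y k) \<omega> \<in> E k} = (\<Prod>k=1..p. prob {\<omega>\<in>space M. path_of (Y k) \<omega> \<in> E k})"
    \<comment> \<open>With no paths the event is the whole space and the product is empty; the
      product rule for independent variables covers nonempty index sets.\<close>
    proof (cases "p = 0")
      case True then show ?thesis by (simp add: prob_space)
    next
      case False
      have "{\<omega>\<in>space M. \<forall>k\<in>{1..p}. path_of (Y k) \<omega> \<in> E k} = (\<Inter>k\<in>{1..p}. path_of (Y k) -` E k \<inter> space M)"
        using False by auto
      then show ?thesis
        using indep_varsD_finite[OF ind, of E] False E by (simp add: vimage_def Int_def conj_commute)
    qed
    also have "(\<Prod>k=1..p. prob {\<omega>\<in>space M. path_of (Y k) \<omega> \<in> E k}) = (\<Prod>k=1..p. prob {\<omega>\<in>space M. path_of (Y' k) \<omega> \<in> E k})"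
    proof (intro prod.cong refl measure_eq_AE E_sets)
      fix k assume k: "k \<in> {1..p}"
      show "AE \<omega> in M. (\<omega> \<in> {\<omega>\<in>space M. path_of (Y k) \<omega> \<in> E k}) = (\<omega> \<in> {\<omega>\<in>space M. path_of (Y' k) \<omega> \<in> E k})"
        using path_eq by eventually_elim (use k in auto)
    qed
    finally show "prob {\<omega>\<in>space M. X0 \<omega> \<in> B \<and> (\<forall>k\<in>{1..p}. path_of (Y' k) \<omega> \<in> E k)} =
      prob {\<omega>\<in>space M. X0 \<omega> \<in> B} * (\<Prod>k=1..p. prob {\<omega>\<in>space M. path_of (Y' k) \<omega> \<in> E k})" .
  next
    fix k n and r :: "nat \<Rightarrow> real" assume k: "k \<in> {1..p}" and r: "0 \<le> r 0" "strict_mono_on {..n} r"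
    have r0: "0 \<le> r i" if "i \<le> n" for i
      using r(1) strict_mono_onD[OF r(2), of 0 i] that by (cases "i = 0") auto
    show "indep_vars (\<lambda>_. count_space UNIV) (\<lambda>i \<omega>. Y' k (r (Suc i)) \<omega> - Y' k (r i) \<omega>) {..<n}"
    proof (rule indep_vars_AE_cong)
      show "indep_vars (\<lambda>_. count_space UNIV) (\<lambda>i \<omega>. Y k (r (Suc i)) \<omega> - Y k (r i) \<omega>) {..<n}"
        using Y[OF k] r by (auto simp: unit_poisson_process_def)
      fix i assume i: "i \<in> {..<n}"
      show "(\<lambda>\<omega>. Y' k (r (Suc i)) \<omega> - Y' k (r i) \<omega>) \<in> measurable M (count_space UNIV)"
        using Y'(3)[of k "r (Suc i)"] Y'(3)[of k "r i"] by measurable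
      show "AE \<omega> in M. Y k (r (Suc i)) \<omega> - Y k (r i) \<omega> = Y' k (r (Suc i)) \<omega> - Y' k (r i) \<omega>"
        using Y_AE[OF k r0[of i]] Y_AE[OF k r0[of "Suc i"]] i by auto
    qed simp
  next
    fix k and s t :: real assume k: "k \<in> {1..p}" and st: "0 \<le> s" "s < t"
    have "distr M (count_space UNIV) (\<lambda>\<omega>. Y' k t \<omega> - Y' k s \<omega>) = distr M (count_space UNIV) (\<lambda>\<omega>. Y k t \<omega> - Y k s \<omega>)"
    proof (rule distr_cong_AE)
      have [measurable]: "Y k t \<in> measurable M (count_space UNIV)" "Y k s \<in> measurable M (count_space UNIV)"
        "Y' k t \<in> measurable M (count_space UNIV)" "Y' k s \<in> measurable M (count_space UNIV)"
        using Ym k st Y'(3) by auto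
      show "(\<lambda>\<omega>. Y' k t \<omega> - Y' k s \<omega>) \<in> measurable M (count_space UNIV)" "(\<lambda>\<omega>. Y k t \<omega> - Y k s \<omega>) \<in> measurable M (count_space UNIV)"
        by measurable
      show "AE \<omega> in M. Y' k t \<omega> - Y' k s \<omega> = Y k t \<omega> - Y k s \<omega>"
        using Y_AE[OF k st(1)] Y_AE[OF k, of t] st by auto
    qed simp_all
    also have "\<dots> = measure_pmf (poisson_pmf (t - s))"
      using Y[OF k] st by (simp add: unit_poisson_process_def)
    finally show "distr M (count_space UNIV) (\<lambda>\<omega>. Y' k t \<omega> - Y' k s \<omega>) = measure_pmf (poisson_pmf (t - s))" .
  qed
qed

section \<open>From the given coefficients to the path equation\<close>

lemma C1b_vec_lipschitz:
  fixes f :: "real ^ 'd \<Rightarrow> real ^ 'd"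
  assumes "C1b_vec f" shows "\<exists>L\<ge>0. \<forall>x y. norm (f x - f y) \<le> L * norm (x - y)"
proof -
  have "\<forall>i. \<exists>K\<ge>0. \<forall>x y. \<bar>f x $ i - f y $ i\<bar> \<le> K * norm (x - y)"
    using assms C1b_lipschitz unfolding C1b_vec_def by blast
  then obtain K where K: "\<And>i. 0 \<le> K i" "\<And>i x y. \<bar>f x $ i - f y $ i\<bar> \<le> K i * norm (x - y)" by metis
  show ?thesis
  proof (intro exI[of _ "\<Sum>i\<in>UNIV. K i"] conjI allI)
    show "0 \<le> (\<Sum>i\<in>UNIV. K i)" using K(1) by (simp add: sum_nonneg)
    fix x y
    have "norm (f x - f y) \<le> (\<Sum>i\<in>UNIV. \<bar>(f x - f y) $ i\<bar>)" by (rule norm_le_l1_cart)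
    also have "\<dots> \<le> (\<Sum>i\<in>UNIV. K i * norm (x - y))" using K(2) by (intro sum_mono) simp
    finally show "norm (f x - f y) \<le> (\<Sum>i\<in>UNIV. K i) * norm (x - y)" by (simp add: sum_distrib_right)
  qed
qed

lemma C1b_vec_bounded:
  fixes f :: "real ^ 'd \<Rightarrow> real ^ 'd"
  assumes "C1b_vec f" shows "\<exists>C. \<forall>x. norm (f x) \<le> C"
proof -
  have "\<forall>i. \<exists>B. \<forall>x. \<bar>f x $ i\<bar> \<le> B" using assms C1b_bounded unfolding C1b_vec_def by blast
  then obtain B where B: "\<And>i x. \<bar>f x $ i\<bar> \<le> B i" by metis
  have "norm (f x) \<le> (\<Sum>i\<in>UNIV. B i)" for x
    by (rule order_trans[OF norm_le_l1_cart]) (intro sum_mono B)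
  then show ?thesis by blast
qed

text \<open>Clipping negative times makes the path measurable on the whole line and leaves the
  integrals alone. Clocks are nonnegative, so the two systems of paths have to agree at nonnegative
  arguments only.\<close>

lemma (in time_change) solves_time_change_iff:
  assumes lam0: "\<And>k. k \<in> {1..p} \<Longrightarrow> lam0 k = lam k" and y: "\<And>k t. k \<in> {1..p} \<Longrightarrow> 0 \<le> t \<Longrightarrow> y' k t = y k t"
    and x: "(\<lambda>t. x (max 0 t)) \<in> borel_measurable borel"
  shows "solves_time_change p f lam0 \<nu> y x0 x \<longleftrightarrow> (\<forall>T. solves_upto y' x0 T (\<lambda>t. x (max 0 t)))"
proof -
  have f_eq: "(LBINT s:{0..t}. f (x (max 0 s))) = (LBINT s:{0..t}. f (x s))" for t
    by (rule integral_Icc_cong) simp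
  have lam_eq: "clock (\<lambda>t. x (max 0 t)) k t = (LBINT s:{0..t}. lam0 k (x s))" if "k \<in> {1..p}" for k t
    unfolding clock_def lam0[OF that] by (rule integral_Icc_cong) simp
  have sum_eq: "(\<Sum>k=1..p. real (y' k (clock (\<lambda>t. x (max 0 t)) k t)) *\<^sub>R \<nu> k) =
      (\<Sum>k=1..p. real (y k (LBINT s:{0..t}. lam0 k (x s))) *\<^sub>R \<nu> k)" if "0 \<le> t" for t
    using clock_nonneg[OF x that] by (intro sum.cong refl) (simp add: y lam_eq[symmetric])
  have "solves_time_change p f lam0 \<nu> y x0 x \<longleftrightarrow> (\<forall>t\<ge>0. x (max 0 t) = x0 + (LBINT s:{0..t}. f (x (max 0 s))) +
     (\<Sum>k=1..p. real (y' k (clock (\<lambda>t. x (max 0 t)) k t)) *\<^sub>R \<nu> k))"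
    unfolding solves_time_change_def f_eq using sum_eq by simp
  also have "\<dots> \<longleftrightarrow> (\<forall>T. solves_upto y' x0 T (\<lambda>t. x (max 0 t)))"
    unfolding solves_upto_def by (meson atLeastAtMost_iff order_refl)
  finally show ?thesis .
qed

lemma cadlag_clip_right_cont: "cadlag x \<Longrightarrow> right_cont (\<lambda>t. x (max 0 t))"
  unfolding cadlag_def by (intro right_cont_clip) auto

text \<open>The filtration is that of the given process \<open>X'\<close>, so adaptedness is shown
  for \<open>X'\<close> itself, from its cadlag paths; expectations over past events are transferred
  from the constructed solution.\<close>

lemma (in test_function) martingale_AE_eq:
  assumes complete: "complete_measure M" and X': "\<And>\<omega>. \<omega> \<in> space M \<Longrightarrow> cadlag (\<lambda>t. X' t \<omega>)"
    and ae: "AE \<omega> in M. \<forall>t\<ge>0. X' t \<omega> = X t \<omega>"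
  shows "martingale M (natural_filtration M X')
    (\<lambda>t \<omega>. F (X' t \<omega>) - F (X' 0 \<omega>) - (LBINT s:{0..t}. G (X' s \<omega>)))"
proof -
  define Z' where "Z' t \<omega> = F (X' t \<omega>) - F (X' 0 \<omega>) - (LBINT s:{0..t}. G (X' s \<omega>))" for t \<omega>
  have X'_meas: "X' t \<in> borel_measurable M" if "0 \<le> t" for t
    by (rule complete_measure_AE_measurable[OF complete X_measurable[of t]]) (use ae that in auto)
  have sub: "subalgebra M (natural_filtration M X' t)" for t
    using natural_filtration_events[of t X' M] X'_meas by (simp add: subalgebra_def)
  have Z'_adapted: "Z' t \<in> borel_measurable (natural_filtration M X' t)" if t: "0 \<le> t" for t
  proof -
    have [measurable]: "X' t \<in> borel_measurable (natural_filtration M X' t)" "X' 0 \<in> borel_measurable (natural_filtration M X' t)"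
      using t by (auto intro: natural_filtration_measurable)
    \<comment> \<open>Clipping to \<open>[0,t]\<close> leaves the integral unchanged and makes every
      value that enters measurable for the past of \<open>t\<close>.\<close>
    have "(\<lambda>\<omega>. LBINT s:{0..t}. G (X' (max 0 (min s t)) \<omega>)) \<in> borel_measurable (natural_filtration M X' t)"
    proof (rule process_integral_measurable[where Z="\<lambda>s. X' (max 0 (min s t))"])
      show "X' (max 0 (min s t)) \<in> borel_measurable (natural_filtration M X' t)" for s
        using t by (intro natural_filtration_measurable) auto
      fix \<omega> assume "\<omega> \<in> space (natural_filtration M X' t)"
      then have "cadlag (\<lambda>t. X' t \<omega>)" using X' by simp
      then show "right_cont (\<lambda>s. X' (max 0 (min s t)) \<omega>)" using t by (intro right_cont_clip2) (auto simp: cadlag_def)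
    qed simp
    also have "(\<lambda>\<omega>. LBINT s:{0..t}. G (X' (max 0 (min s t)) \<omega>)) = (\<lambda>\<omega>. LBINT s:{0..t}. G (X' s \<omega>))"
      by (intro ext integral_Icc_cong) simp
    finally have [measurable]: "(\<lambda>\<omega>. LBINT s:{0..t}. G (X' s \<omega>)) \<in> borel_measurable (natural_filtration M X' t)" .
    show ?thesis unfolding Z'_def[abs_def] by measurable
  qed
  have Z'_ae: "AE \<omega> in M. Z' t \<omega> = Z t \<omega>" if t: "0 \<le> t" for t
    using ae
  proof eventually_elim
    case (elim \<omega>)
    have "(LBINT s:{0..t}. G (X' s \<omega>)) = (LBINT s:{0..t}. G (X s \<omega>))" using elim by (intro integral_Icc_cong) simp
    then show ?case using elim t by (simp add: Z'_def Z_def)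
  qed
  have Z'_meas: "Z' t \<in> borel_measurable M" if "0 \<le> t" for t
    by (rule measurable_from_subalg[OF sub Z'_adapted[OF that]])
  have Z'_int: "integrable M (Z' t)" if t: "0 \<le> t" for t
    using integrable_cong_AE[OF Z'_meas[OF t] borel_measurable_integrable[OF Z_integrable[OF t]] Z'_ae[OF t]] Z_integrable[OF t] by simp
  have cond: "AE \<omega> in M. real_cond_exp M (natural_filtration M X' s) (Z' t) \<omega> = Z' s \<omega>" if s: "0 \<le> s" "s \<le> t" for s t
  proof -
    have t: "0 \<le> t" using s by simp
    interpret S: finite_measure_subalgebra M "natural_filtration M X' s"
      by unfold_locales (rule sub)
    show ?thesis
    proof (rule S.real_cond_exp_charact)
      fix A assume A: "A \<in> sets (natural_filtration M X' s)"
      \<comment> \<open>The partner of \<open>A\<close> in the past of the constructed solution, for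
        which constancy of expectations has been proved.\<close>
      obtain A' where A': "A' \<in> sets (natural_filtration M X s)" "AE \<omega> in M. \<omega> \<in> A \<longleftrightarrow> \<omega> \<in> A'"
        using natural_filtration_AE_eq[OF _ A, of X] ae by auto
      have A_ev: "A \<in> events" using A sub[of s] by (auto simp: subalgebra_def)
      have A'_ev: "A' \<in> events" using A'(1) natural_filtration_events[of s X M] by auto
      have eq: "(\<integral>\<omega>\<in>A. Z' r \<omega> \<partial>M) = expectation (\<lambda>\<omega>. indicator A' \<omega> * Z r \<omega>)" if r: "0 \<le> r" for r
        unfolding set_lebesgue_integral_def
      proof (rule integral_cong_AE)
        show "(\<lambda>\<omega>. indicat_real A \<omega> *\<^sub>R Z' r \<omega>) \<in> borel_measurable M"
          using A_ev Z'_meas[OF r] by measurable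
        show "(\<lambda>\<omega>. indicat_real A' \<omega> * Z r \<omega>) \<in> borel_measurable M" using A'_ev by measurable
        show "AE \<omega> in M. indicat_real A \<omega> *\<^sub>R Z' r \<omega> = indicat_real A' \<omega> * Z r \<omega>"
          using A'(2) Z'_ae[OF r] by eventually_elim (auto simp: indicator_def)
      qed
      show "(\<integral>\<omega>\<in>A. Z' t \<omega> \<partial>M) = (\<integral>\<omega>\<in>A. Z' s \<omega> \<partial>M)"
        unfolding eq[OF t] eq[OF s(1)] by (rule Z_expectation_const[OF s A'(1)])
    qed (use Z'_int Z'_adapted s t in auto)
  qed
  have "filtration (space M) (natural_filtration M X')"
  proof
    fix i j :: real assume "i \<le> j"
    then show "sets (natural_filtration M X' i) \<subseteq> sets (natural_filtration M X' j)"
      unfolding sets_natural_filtration by (intro sigma_sets_mono') force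
  qed simp
  then have "martingale M (natural_filtration M X') Z'"
    unfolding martingale_def using sub Z'_adapted Z'_int cond by blast
  then show ?thesis by (simp add: Z'_def[abs_def])
qed

theorem theorem2p1:
  fixes M :: "'w measure"
    and p :: nat
    and Y :: "nat \<Rightarrow> real \<Rightarrow> 'w \<Rightarrow> nat"
    and X0 :: "'w \<Rightarrow> real ^ 'd"
    and \<nu> :: "nat \<Rightarrow> real ^ 'd"
    and f :: "real ^ 'd \<Rightarrow> real ^ 'd"
    and lam :: "nat \<Rightarrow> real ^ 'd \<Rightarrow> real"
  assumes "prob_space M" and "complete_measure M"
    and "\<And>k. k \<in> {1..p} \<Longrightarrow> unit_poisson_process M (Y k)"
    and "prob_space.indep_vars M (\<lambda>_. path_space) (\<lambda>k. path_of (Y k)) {1..p}"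
    and "X0 \<in> borel_measurable M"
    and "C1b_vec f"
    and "\<And>k. k \<in> {1..p} \<Longrightarrow> C1b (lam k)"
    and "\<And>k x. k \<in> {1..p} \<Longrightarrow> 0 \<le> lam k x"
  shows "(AE \<omega> in M. \<exists>x. cadlag x \<and> solves_time_change p f lam \<nu> (\<lambda>k t. Y k t \<omega>) (X0 \<omega>) x \<and>
            (\<forall>x'. cadlag x' \<and> solves_time_change p f lam \<nu> (\<lambda>k t. Y k t \<omega>) (X0 \<omega>) x' \<longrightarrow>
               (\<forall>t\<ge>0. x' t = x t))) \<and>
         (prob_space.indep_set M
            (sets (vimage_algebra (space M) X0 borel))
            (sets (vimage_algebra (space M) (\<lambda>\<omega>. \<lambda>k\<in>{1..p}. path_of (Y k) \<omega>)
              (Pi\<^sub>M {1..p} (\<lambda>_. path_space)))) \<longrightarrow>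
          (\<forall>X :: real \<Rightarrow> 'w \<Rightarrow> real ^ 'd.
             (\<forall>\<omega>\<in>space M. cadlag (\<lambda>t. X t \<omega>)) \<and>
             (AE \<omega> in M. solves_time_change p f lam \<nu> (\<lambda>k t. Y k t \<omega>) (X0 \<omega>) (\<lambda>t. X t \<omega>)) \<longrightarrow>
             (\<forall>F. C1b F \<longrightarrow>
                martingale M (natural_filtration M X)
                  (\<lambda>t \<omega>. F (X t \<omega>) - F (X 0 \<omega>) -
                     set_lebesgue_integral lborel {0..t} (\<lambda>s. generator p f lam \<nu> F (X s \<omega>))))))"
proof -
  \<comment> \<open>The rates are controlled for \<open>k \<in> {1..p}\<close> only, while
    \<open>time_change\<close> bounds all of them; zero is an admissible rate.\<close>
  define lam' where "lam' k = (if k \<in> {1..p} then lam k else (\<lambda>_. 0))" for k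
  have lam': "lam k = lam' k" if "k \<in> {1..p}" for k using that by (simp add: lam'_def)
  obtain L where L: "0 \<le> L" "\<And>x y. norm (f x - f y) \<le> L * norm (x - y)" using C1b_vec_lipschitz[OF assms(6)] by auto
  obtain C where C: "\<And>x. norm (f x) \<le> C" using C1b_vec_bounded[OF assms(6)] by auto
  have "\<forall>k\<in>{1..p}. \<exists>B\<ge>0. \<forall>x. \<bar>lam k x\<bar> \<le> B" using C1b_bounded assms(7) by blast
  then obtain B where B: "\<And>k. k \<in> {1..p} \<Longrightarrow> 0 \<le> B k" "\<And>k x. k \<in> {1..p} \<Longrightarrow> \<bar>lam k x\<bar> \<le> B k" by metis
  \<comment> \<open>A sum of nonnegative bounds dominates each of them, and it also bounds the zero
    rates when \<open>p = 0\<close>.\<close>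
  define R where "R = (\<Sum>k=1..p. B k)"
  have lam'_le: "lam' k x \<le> R" for k x
  proof (cases "k \<in> {1..p}")
    case True
    have "lam k x \<le> B k" using B(2)[OF True, of x] by simp
    also have "\<dots> \<le> R" unfolding R_def using B(1) True by (intro member_le_sum) auto
    finally show ?thesis using True by (simp add: lam'_def)
  next
    case False
    then show ?thesis using B(1) by (auto simp: lam'_def R_def intro: sum_nonneg)
  qed
  interpret time_change p f lam' \<nu> L C R
  proof
    show "continuous_on UNIV (lam' k)" for k using C1b_continuous[OF assms(7), of k] by (auto simp: lam'_def)
    show "0 \<le> lam' k x" for k x using assms(8) by (simp add: lam'_def)
  qed (use L C lam'_le in auto)
  obtain Y' where Y': "\<And>k \<omega>. step_path (\<lambda>t. Y' k t \<omega>)" "\<And>k t \<omega>. t \<le> 0 \<Longrightarrow> Y' k t \<omega> = 0"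
    "\<And>k t. Y' k t \<in> measurable M (count_space UNIV)"
    "AE \<omega> in M. \<forall>k\<in>{1..p}. \<forall>t\<ge>0. Y' k t \<omega> = Y k t \<omega>"
  proof (rule poisson_modification[where p=p and M=M and Y=Y])
    show "\<And>k. k \<in> {1..p} \<Longrightarrow> unit_poisson_process M (Y k)" by (rule assms(3))
    fix Z :: "nat \<Rightarrow> real \<Rightarrow> 'w \<Rightarrow> nat"
    assume "\<And>k \<omega>. step_path (\<lambda>t. Z k t \<omega>)" "\<And>k t \<omega>. t \<le> 0 \<Longrightarrow> Z k t \<omega> = 0"
      "\<And>k t. Z k t \<in> measurable M (count_space UNIV)"
      "AE \<omega> in M. \<forall>k\<in>{1..p}. \<forall>t\<ge>0. Z k t \<omega> = Y k t \<omega>"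
    then show ?thesis by (rule that)
  qed
  define x where "x \<omega> = solution (\<lambda>k t. Y' k t \<omega>) (X0 \<omega>)" for \<omega>
  have x_cadlag: "cadlag (x \<omega>)" for \<omega> unfolding x_def by (rule solution_cadlag) (rule Y'(1))
  have x_meas: "(\<lambda>t. x' (max 0 t)) \<in> borel_measurable borel" if "cadlag x'" for x' :: "real \<Rightarrow> real ^ 'd"
    by (rule right_cont_borel_measurable[OF cadlag_clip_right_cont[OF that]])
  have x_clip: "x \<omega> (max 0 t) = x \<omega> t" for \<omega> t
    unfolding x_def using solution_neg[of "\<lambda>k t. Y' k t \<omega>" t "X0 \<omega>"] Y'(1) by (simp add: max_def)
  have solves_iff: "solves_time_change p f lam \<nu> (\<lambda>k t. Y k t \<omega>) (X0 \<omega>) x' \<longleftrightarrow>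
      (\<forall>T. solves_upto (\<lambda>k t. Y' k t \<omega>) (X0 \<omega>) T (\<lambda>t. x' (max 0 t)))"
    if "\<forall>k\<in>{1..p}. \<forall>t\<ge>0. Y' k t \<omega> = Y k t \<omega>" "cadlag x'" for \<omega> x'
    by (rule solves_time_change_iff[OF lam' _ x_meas[OF that(2)]]) (use that(1) in simp_all)
  have unique: "x' t = x \<omega> t"
    if eq: "\<forall>k\<in>{1..p}. \<forall>t\<ge>0. Y' k t \<omega> = Y k t \<omega>" and x': "cadlag x'"
      "solves_time_change p f lam \<nu> (\<lambda>k t. Y k t \<omega>) (X0 \<omega>) x'" and t: "0 \<le> t" for \<omega> x' t
  proof -
    have "x' (max 0 t) = x \<omega> t"
    proof (rule solves_upto_unique[where y="\<lambda>k t. Y' k t \<omega>" and x="\<lambda>t. x' (max 0 t)" and x'="x \<omega>" and ?x0.0="X0 \<omega>" and T=t and t=t])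
      show "solves_upto (\<lambda>k t. Y' k t \<omega>) (X0 \<omega>) t (\<lambda>t. x' (max 0 t))"
        using solves_iff[OF eq x'(1)] x'(2) by blast
      show "solves_upto (\<lambda>k t. Y' k t \<omega>) (X0 \<omega>) t (x \<omega>)"
        unfolding x_def by (rule solution_solves) (rule Y'(1))
      show "x \<omega> \<in> borel_measurable borel"
        unfolding x_def by (rule solution_measurable) (rule Y'(1))
      show "(\<lambda>t. x' (max 0 t)) \<in> borel_measurable borel" by (rule x_meas[OF x'(1)])
      show "t \<in> {0..t}" using t by simp
    qed (rule Y'(1))
    then show ?thesis using t by simp
  qed
  have existence: "AE \<omega> in M. \<exists>x. cadlag x \<and> solves_time_change p f lam \<nu> (\<lambda>k t. Y k t \<omega>) (X0 \<omega>) x \<and>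
            (\<forall>x'. cadlag x' \<and> solves_time_change p f lam \<nu> (\<lambda>k t. Y k t \<omega>) (X0 \<omega>) x' \<longrightarrow>
               (\<forall>t\<ge>0. x' t = x t))"
    using Y'(4)
  proof eventually_elim
    case (elim \<omega>)
    have "solves_upto (\<lambda>k t. Y' k t \<omega>) (X0 \<omega>) T (\<lambda>t. x \<omega> (max 0 t))" for T
      unfolding x_clip unfolding x_def by (rule solution_solves) (rule Y'(1))
    then have "solves_time_change p f lam \<nu> (\<lambda>k t. Y k t \<omega>) (X0 \<omega>) (x \<omega>)"
      using solves_iff[OF elim x_cadlag] by blast
    then show ?case using x_cadlag unique[OF elim] by (intro exI[of _ "x \<omega>"] conjI allI impI) auto
  qed
  have "martingale M (natural_filtration M Z) (\<lambda>t \<omega>. F (Z t \<omega>) - F (Z 0 \<omega>) -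
      (LBINT s:{0..t}. generator p f lam \<nu> F (Z s \<omega>)))"
    if ind0: "prob_space.indep_set M (sets (vimage_algebra (space M) X0 borel))
      (sets (vimage_algebra (space M) (\<lambda>\<omega>. \<lambda>k\<in>{1..p}. path_of (Y k) \<omega>) (Pi\<^sub>M {1..p} (\<lambda>_. path_space))))"
      and Z: "\<forall>\<omega>\<in>space M. cadlag (\<lambda>t. Z t \<omega>)"
      "AE \<omega> in M. solves_time_change p f lam \<nu> (\<lambda>k t. Y k t \<omega>) (X0 \<omega>) (\<lambda>t. Z t \<omega>)"
      and F: "C1b F" for Z :: "real \<Rightarrow> 'w \<Rightarrow> real ^ 'd" and F
  proof -
    obtain B where B: "\<And>x. \<bar>F x\<bar> \<le> B" using C1b_bounded[OF F] by auto
    obtain K where K: "0 \<le> K" "\<And>x y. \<bar>F x - F y\<bar> \<le> K * norm (x - y)" using C1b_lipschitz[OF F] by auto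
    \<comment> \<open>The independence of \<open>X0\<close> and the driving paths enters through
      this interpretation.\<close>
    interpret pf: poisson_family M p Y' X0
      by (rule poisson_family_modification[OF assms(1,3,4,5) ind0 Y'])
    interpret tf: test_function p f lam' \<nu> L C R M Y' X0 F B K
      by unfold_locales (use F B K in auto)
    \<comment> \<open>Pathwise uniqueness identifies any given solution process with the constructed
      one, for which the stopping structure is available.\<close>
    have "AE \<omega> in M. \<forall>t\<ge>0. Z t \<omega> = x \<omega> t"
        using Y'(4) Z(2) AE_space
    proof eventually_elim
      case (elim \<omega>)
      then show ?case using unique[OF elim(1) Z(1)[rule_format, OF elim(3)] elim(2)] by simp
    qed
    then have ae: "AE \<omega> in M. \<forall>t\<ge>0. Z t \<omega> = tf.X t \<omega>"
      unfolding x_def tf.X_def .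
    have "generator p f lam \<nu> F = generator p f lam' \<nu> F"
      unfolding generator_def using lam' by (intro ext arg_cong2[where f="(+)"] refl sum.cong) simp_all
    moreover have "cadlag (\<lambda>t. Z t \<omega>)" if "\<omega> \<in> space M" for \<omega> using Z(1) that by blast
    note tf.martingale_AE_eq[OF assms(2) this ae]
    ultimately show ?thesis by (simp only:)
  qed
  then show ?thesis by (intro conjI existence impI allI) simp
qed

end
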